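(* Let $n\geq2$ and consider the conformal class of the split version of the Fubini–Study metric, i.e. of the (unique up to a constant multiple) invariant split signature metric, on $K/H=Sl(n+1,\mathbb{R})/Gl(n,\mathbb{R})$. The following curves $\gamma=(\gamma_1,\dots,\gamma_{2n})$ are conformal circles (up to parametrization) for all $c\in\mathbb{R}$, $c>0$: $$\gamma_1=\frac{2c^2-t}{2c^3},\quad\gamma_2=-\frac1{2c^3t},\quad\gamma_i=0\ (n\ge i>2),\quad\gamma_{n+1}=\frac1t,\quad\gamma_{n+2}=t,\quad\gamma_i=0\ (2n\ge i>n+2),$$ in the exponential coordinates $$\mathsf{c}:\left[\begin{smallmatrix} 0 & X_2^t \\ X_1 & 0 \end{smallmatrix}\right]\mapsto\left[\begin{smallmatrix} 1 & 0 \\ X_1 & \mathrm{id} \end{smallmatrix}\right]\left[\begin{smallmatrix} 1 & X_2^t \\ 0 & \mathrm{id} \end{smallmatrix}\right]o,$$ and their $K$-orbit (the set of all translates by $K=Sl(n+1,\mathbb{R})$ of the curves of this family, $c>0$) is of codimension one in the space of (unparametrized, nowhere null) conformal circles.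
   Context: $o$ is the base point of $Sl(n+1,\mathbb{R})/Gl(n,\mathbb{R})$, with $Gl(n,\mathbb{R})$ the block diagonal (sizes $1,n$) subgroup. Coordinates: $X_1=(x_1,\dots,x_n)^t$, $X_2=(x_{n+1},\dots,x_{2n})^t$. The invariant metric at $o$ is $2X_1^tX_2$, which in these coordinates gives $g=2\sum_{i=1}^ndx_i\,dx_{n+i}-2\big(\sum_{i=1}^nx_{n+i}dx_i\big)^2$. The parameter $t\ne0$. Conformal circles: for a metric $g$ in the conformal class with Levi-Civita connection $\nabla$ and Schouten tensor $\mathsf{P}$, the standard tractor bundle is $\mathbb{R}\oplus TM\oplus\mathbb{R}$ with connection $\nabla_Y(\rho,\mu,\sigma)=(Y\rho-\mathsf{P}(Y,\mu),\ \nabla_Y\mu+\rho Y+\sigma\mathsf{P}^\sharp(Y),\ Y\sigma-g(Y,\mu))$, $\mathsf{P}=\frac1{m-2}\big(\mathrm{Ric}-\frac{\mathrm{Scal}}{2(m-1)}g\big)$, $m=\dim M=2n$. For a nowhere null curve $\gamma$ with $u=|g(\gamma',\gamma')|^{1/2}$ put $X^\gamma=(1/u,0,0)$, $U^\gamma=\nabla_{\gamma'}X^\gamma$, $A^\gamma=\nabla_{\gamma'}U^\gamma$. The curve is (up to parametrization) a conformal circle iff $X^\gamma\wedge U^\gamma\wedge A^\gamma\wedge\nabla_{\gamma'}A^\gamma=0$. *)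

theory Defs
  imports "HOL-Analysis.Analysis"
begin

section \<open>Smooth maps and submanifolds of Euclidean space\<close>

primrec Ck_on :: "nat \<Rightarrow> 'a::euclidean_space set \<Rightarrow> ('a \<Rightarrow> 'b::real_normed_vector) \<Rightarrow> bool" where
  "Ck_on 0 S f \<longleftrightarrow> continuous_on S f"
| "Ck_on (Suc k) S f \<longleftrightarrow>
     (\<forall>x\<in>S. f differentiable (at x)) \<and> (\<forall>v. Ck_on k S (\<lambda>x. frechet_derivative f (at x) v))"

text \<open>Only used for open \<open>S\<close>.\<close>

definition smooth_on :: "'a::euclidean_space set \<Rightarrow> ('a \<Rightarrow> 'b::real_normed_vector) \<Rightarrow> bool" where
  "smooth_on S f \<longleftrightarrow> (\<forall>k. Ck_on k S f)"

text \<open>Embedded submanifolds (without boundary) of dimension \<open>d\<close>: locally the common zero set of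
  \<open>DIM('a) - d\<close> smooth functions whose differentials are linearly independent.\<close>

definition submanifold :: "nat \<Rightarrow> 'a::euclidean_space set \<Rightarrow> bool" where
  "submanifold d N \<longleftrightarrow> d \<le> DIM('a) \<and>
     (\<forall>p\<in>N. \<exists>W (f :: nat \<Rightarrow> 'a \<Rightarrow> real). open W \<and> p \<in> W \<and>
        (\<forall>i < DIM('a) - d. smooth_on W (f i)) \<and>
        (\<forall>q\<in>W. \<forall>c :: nat \<Rightarrow> real.
           (\<forall>v. (\<Sum>i < DIM('a) - d. c i * frechet_derivative (f i) (at q) v) = 0)
           \<longrightarrow> (\<forall>i < DIM('a) - d. c i = 0)) \<and>
        N \<inter> W = {q \<in> W. \<forall>i < DIM('a) - d. f i q = 0})"

text \<open>Dimension of an arbitrary subset, such as a union of orbits: \<open>A\<close> is covered by countably many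
  \<open>d\<close>-dimensional submanifolds, and near each of its points it contains a nonempty
  \<open>d\<close>-dimensional submanifold.  Such a \<open>d\<close> is unique, and a nonempty submanifold of
  dimension \<open>d\<close> has dimension \<open>d\<close> in this sense; but \<open>A\<close> itself is not required to
  be an embedded submanifold.\<close>

definition has_dimension :: "nat \<Rightarrow> 'a::euclidean_space set \<Rightarrow> bool" where
  "has_dimension d A \<longleftrightarrow> A \<noteq> {} \<and>
     (\<exists>N :: nat \<Rightarrow> 'a set. (\<forall>j. submanifold d (N j)) \<and> A \<subseteq> (\<Union>j. N j)) \<and>
     (\<forall>W. open W \<and> W \<inter> A \<noteq> {} \<longrightarrow> (\<exists>N. submanifold d N \<and> N \<noteq> {} \<and> N \<subseteq> W \<inter> A))"


section \<open>Pseudo-Riemannian metrics in coordinates\<close>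

text \<open>A metric is given by its matrix \<open>g x\<close> in coordinates \<open>x :: real^'m\<close>.\<close>

type_synonym 'm metric = "real^'m \<Rightarrow> real^'m^'m"

definition ip :: "'m::finite metric \<Rightarrow> real^'m \<Rightarrow> real^'m \<Rightarrow> real^'m \<Rightarrow> real" where
  "ip g x v w = (\<Sum>i\<in>UNIV. \<Sum>j\<in>UNIV. g x $ i $ j * v $ i * w $ j)"

definition partial :: "'m::finite \<Rightarrow> (real^'m \<Rightarrow> real) \<Rightarrow> real^'m \<Rightarrow> real" where
  "partial i f x = frechet_derivative f (at x) (axis i 1)"

text \<open>\<open>christoffel g x k i j\<close> is the coefficient of \<open>\<partial>\<^sub>k\<close> in \<open>\<nabla>\<^bsub>\<partial>\<^sub>i\<^esub> \<partial>\<^sub>j\<close>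
  for the Levi-Civita connection.\<close>

definition christoffel :: "'m::finite metric \<Rightarrow> real^'m \<Rightarrow> 'm \<Rightarrow> 'm \<Rightarrow> 'm \<Rightarrow> real" where
  "christoffel g x k i j = (1/2) * (\<Sum>l\<in>UNIV. matrix_inv (g x) $ k $ l *
     (partial i (\<lambda>y. g y $ j $ l) x + partial j (\<lambda>y. g y $ i $ l) x - partial l (\<lambda>y. g y $ i $ j) x))"

text \<open>\<open>curvature g x l i j k\<close> is the coefficient of \<open>\<partial>\<^sub>l\<close> in
  \<open>R(\<partial>\<^sub>i,\<partial>\<^sub>j)\<partial>\<^sub>k = \<nabla>\<^sub>i\<nabla>\<^sub>j\<partial>\<^sub>k - \<nabla>\<^sub>j\<nabla>\<^sub>i\<partial>\<^sub>k\<close>; with the trace below,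
  round spheres have positive Ricci curvature, as the sign of the Schouten tensor in the tractor
  connection requires.\<close>

definition curvature :: "'m::finite metric \<Rightarrow> real^'m \<Rightarrow> 'm \<Rightarrow> 'm \<Rightarrow> 'm \<Rightarrow> 'm \<Rightarrow> real" where
  "curvature g x l i j k =
     partial i (\<lambda>y. christoffel g y l j k) x - partial j (\<lambda>y. christoffel g y l i k) x
     + (\<Sum>p\<in>UNIV. christoffel g x l i p * christoffel g x p j k
                 - christoffel g x l j p * christoffel g x p i k)"

definition Ric :: "'m::finite metric \<Rightarrow> real^'m \<Rightarrow> real^'m^'m" where
  "Ric g x = (\<chi> j k. \<Sum>i\<in>UNIV. curvature g x i i j k)"

definition Scal :: "'m::finite metric \<Rightarrow> real^'m \<Rightarrow> real" where
  "Scal g x = (\<Sum>i\<in>UNIV. \<Sum>j\<in>UNIV. matrix_inv (g x) $ i $ j * Ric g x $ i $ j)"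

definition Schouten :: "'m::finite metric \<Rightarrow> 'm metric" where
  "Schouten g x = (1 / (real CARD('m) - 2)) *\<^sub>R
     (Ric g x - (Scal g x / (2 * (real CARD('m) - 1))) *\<^sub>R g x)"

definition Schouten_sharp :: "'m::finite metric \<Rightarrow> real^'m \<Rightarrow> real^'m \<Rightarrow> real^'m" where
  "Schouten_sharp g x v = matrix_inv (g x) *v (Schouten g x *v v)"


section \<open>Standard tractors along a curve, conformal circles\<close>

abbreviation velocity :: "(real \<Rightarrow> 'a::real_normed_vector) \<Rightarrow> real \<Rightarrow> 'a" where
  "velocity \<gamma> t \<equiv> vector_derivative \<gamma> (at t)"

definition cov_deriv ::
  "'m::finite metric \<Rightarrow> (real \<Rightarrow> real^'m) \<Rightarrow> (real \<Rightarrow> real^'m) \<Rightarrow> real \<Rightarrow> real^'m" where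
  "cov_deriv g \<gamma> \<mu> t = velocity \<mu> t +
     (\<chi> k. \<Sum>i\<in>UNIV. \<Sum>j\<in>UNIV. christoffel g (\<gamma> t) k i j * velocity \<gamma> t $ i * \<mu> t $ j)"

type_synonym 'm tractor = "real \<times> (real^'m) \<times> real"

definition tractor_deriv ::
  "'m::finite metric \<Rightarrow> (real \<Rightarrow> real^'m) \<Rightarrow> (real \<Rightarrow> 'm tractor) \<Rightarrow> real \<Rightarrow> 'm tractor" where
  "tractor_deriv g \<gamma> V t =
     (let \<rho> = (\<lambda>s. fst (V s)); \<mu> = (\<lambda>s. fst (snd (V s))); \<sigma> = (\<lambda>s. snd (snd (V s))); Y = velocity \<gamma> t
      in (velocity \<rho> t - ip (Schouten g) (\<gamma> t) Y (\<mu> t),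
          cov_deriv g \<gamma> \<mu> t + \<rho> t *\<^sub>R Y + \<sigma> t *\<^sub>R Schouten_sharp g (\<gamma> t) Y,
          velocity \<sigma> t - ip g (\<gamma> t) Y (\<mu> t)))"

definition tractor_X :: "'m::finite metric \<Rightarrow> (real \<Rightarrow> real^'m) \<Rightarrow> real \<Rightarrow> 'm tractor" where
  "tractor_X g \<gamma> t = (1 / sqrt \<bar>ip g (\<gamma> t) (velocity \<gamma> t) (velocity \<gamma> t)\<bar>, 0, 0)"

definition tractor_U :: "'m::finite metric \<Rightarrow> (real \<Rightarrow> real^'m) \<Rightarrow> real \<Rightarrow> 'm tractor" where
  "tractor_U g \<gamma> = tractor_deriv g \<gamma> (tractor_X g \<gamma>)"

definition tractor_A :: "'m::finite metric \<Rightarrow> (real \<Rightarrow> real^'m) \<Rightarrow> real \<Rightarrow> 'm tractor" where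
  "tractor_A g \<gamma> = tractor_deriv g \<gamma> (tractor_U g \<gamma>)"

text \<open>The decomposable 4-vector \<open>v1 \<and> v2 \<and> v3 \<and> v4\<close>, seen as the alternating 4-form
  \<open>(\<phi>\<^sub>1,\<dots>,\<phi>\<^sub>4) \<mapsto> det (\<phi>\<^sub>j (v\<^sub>i))\<close> on the dual space; functionals are written as
  Euclidean inner products with vectors \<open>b\<^sub>j\<close>.\<close>

definition wedge4 :: "'a::euclidean_space \<Rightarrow> 'a \<Rightarrow> 'a \<Rightarrow> 'a \<Rightarrow> ('a^4 \<Rightarrow> real)" where
  "wedge4 v1 v2 v3 v4 = (\<lambda>b. det (\<chi> i j. (vector [v1, v2, v3, v4] :: 'a^4) $ i \<bullet> b $ j))"

text \<open>\<open>\<gamma>\<close> is, on the open set \<open>T\<close>, a smooth nowhere null curve which is a conformal circle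
  up to parametrization, for the conformal class of \<open>g\<close>.\<close>

definition conformal_circle_on :: "'m::finite metric \<Rightarrow> real set \<Rightarrow> (real \<Rightarrow> real^'m) \<Rightarrow> bool" where
  "conformal_circle_on g T \<gamma> \<longleftrightarrow> smooth_on T \<gamma> \<and>
     (\<forall>t\<in>T. ip g (\<gamma> t) (velocity \<gamma> t) (velocity \<gamma> t) \<noteq> 0 \<and>
        wedge4 (tractor_X g \<gamma> t) (tractor_U g \<gamma> t) (tractor_A g \<gamma> t)
          (tractor_deriv g \<gamma> (tractor_A g \<gamma>) t) = (\<lambda>b. 0))"


section \<open>The homogeneous space \<open>K/H = Sl(n+1,\<real>)/Gl(n,\<real>)\<close>\<close>

text \<open>\<open>\<real>\<^sup>n\<close> is \<open>real^'n\<close>; the rows and columns of matrices in \<open>K\<close> are indexed by \<open>'n option\<close>,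
  the block of size 1 being the index \<open>None\<close>.  The coordinates \<open>x\<^sub>i\<close> and \<open>x\<^bsub>n+i\<^esub>\<close> (\<open>i \<le> n\<close>)
  are those with index \<open>Inl i\<close> and \<open>Inr i\<close>.\<close>

type_synonym 'n mat_K = "real^('n option)^('n option)"
type_synonym 'n coords = "real^('n + 'n)"

definition K_grp :: "'n::finite mat_K set" where
  "K_grp = {A. det A = 1}"

definition H_grp :: "'n::finite mat_K set" where
  "H_grp = {A \<in> K_grp. \<forall>i. A $ None $ Some i = 0 \<and> A $ Some i $ None = 0}"

text \<open>Points of \<open>K/H\<close> are left cosets \<open>k H\<close>, and \<open>K\<close> acts by left translation.\<close>

type_synonym 'n point = "'n mat_K set"

definition act :: "'n::finite mat_K \<Rightarrow> 'n point \<Rightarrow> 'n point" where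
  "act k p = (\<lambda>A. k ** A) ` p"

definition base_point :: "'n::finite point" where
  "base_point = H_grp"

definition lower_mat :: "'n::finite coords \<Rightarrow> 'n mat_K" where
  "lower_mat x = (\<chi> a b. if a = b then 1 else
     (case (a, b) of (Some i, None) \<Rightarrow> x $ Inl i | _ \<Rightarrow> 0))"

definition upper_mat :: "'n::finite coords \<Rightarrow> 'n mat_K" where
  "upper_mat x = (\<chi> a b. if a = b then 1 else
     (case (a, b) of (None, Some i) \<Rightarrow> x $ Inr i | _ \<Rightarrow> 0))"

definition expo_coords :: "'n::finite coords \<Rightarrow> 'n point" where
  "expo_coords x = act (lower_mat x ** upper_mat x) base_point"

text \<open>The matrix of \<open>2 \<Sum> dx\<^sub>i dx\<^bsub>n+i\<^esub> - 2 (\<Sum> x\<^bsub>n+i\<^esub> dx\<^sub>i)\<^sup>2\<close>; products of 1-forms are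
  symmetric products, so \<open>2 dx\<^sub>i dx\<^bsub>n+i\<^esub>\<close> contributes \<open>1\<close> to each of two entries.\<close>

definition fs_metric :: "('n::finite + 'n) metric" where
  "fs_metric x = (\<chi> a b. case (a, b) of
       (Inl i, Inl j) \<Rightarrow> - 2 * x $ Inr i * x $ Inr j
     | (Inl i, Inr j) \<Rightarrow> if i = j then 1 else 0
     | (Inr i, Inl j) \<Rightarrow> if i = j then 1 else 0
     | (Inr i, Inr j) \<Rightarrow> 0)"


section \<open>Unparametrized curves in \<open>K/H\<close> and the codimension of families of them\<close>

text \<open>A family of unparametrized curves is represented by the set of all parametrized arcs
  \<open>(I, \<gamma>)\<close>, \<open>\<gamma>\<close> restricted to the open interval \<open>I\<close>, of its members; it is thus stable under
  reparametrization and under passing to subintervals.\<close>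

type_synonym 'n arc = "real set \<times> (real \<Rightarrow> 'n point)"

definition open_interval :: "real set \<Rightarrow> bool" where
  "open_interval I \<longleftrightarrow> open I \<and> connected I \<and> I \<noteq> {}"

text \<open>Since the metric is invariant under \<open>K\<close>, it is given by \<open>fs_metric\<close> in each of the charts
  \<open>x \<mapsto> act k (expo_coords x)\<close>, \<open>k \<in> K\<close>, which cover \<open>K/H\<close>.\<close>

definition conformal_circles :: "'n::finite arc set" where
  "conformal_circles = {(I, \<gamma>). open_interval I \<and>
     (\<forall>t0\<in>I. \<exists>k\<in>K_grp. \<exists>T x. open T \<and> t0 \<in> T \<and> T \<subseteq> I \<and>
        conformal_circle_on fs_metric T x \<and> (\<forall>t\<in>T. \<gamma> t = act k (expo_coords (x t))))}"

text \<open>All translates by \<open>K\<close> of the curves \<open>cs c\<close>, \<open>c > 0\<close>, given in exponential coordinates and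
  defined for \<open>t \<noteq> 0\<close>.\<close>

definition K_orbit :: "(real \<Rightarrow> real \<Rightarrow> 'n::finite coords) \<Rightarrow> 'n arc set" where
  "K_orbit cs = {(I, \<gamma>). open_interval I \<and>
     (\<exists>k\<in>K_grp. \<exists>c>0. \<exists>\<phi>. smooth_on I \<phi> \<and> (\<forall>t\<in>I. \<phi> t \<noteq> 0 \<and> deriv \<phi> t \<noteq> 0) \<and>
        (\<forall>t\<in>I. \<gamma> t = act k (expo_coords (cs c (\<phi> t)))))}"

text \<open>The 2-jets \<open>(x, x', x'')\<close>, in the chart translated by \<open>k\<close>, of all arcs in a family.\<close>

definition jets2 ::
  "'n::finite mat_K \<Rightarrow> 'n arc set \<Rightarrow> ('n coords \<times> 'n coords \<times> 'n coords) set" where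
  "jets2 k F = {(x t, velocity x t, velocity (velocity x) t) | x t.
     \<exists>I \<gamma> T. (I, \<gamma>) \<in> F \<and> open T \<and> t \<in> T \<and> T \<subseteq> I \<and> smooth_on T x \<and>
       (\<forall>s\<in>T. \<gamma> s = act k (expo_coords (x s)))}"

text \<open>The conformal circle equation is of third order, so an unparametrized nowhere null conformal
  circle is determined by the 2-jet of any of its parametrizations at any of its points.  Hence the
  space of such circles is the quotient of the manifold of their 2-jets by moving the point along
  the circle and changing the 2-jet of the parameter, and it carries the quotient manifold
  structure.  The projection is a submersion with 3-dimensional fibres, so the codimension of a set
  of circles equals that of its full preimage, the set of all 2-jets of its members.\<close>

definition has_codimension_in :: "nat \<Rightarrow> 'n::finite arc set \<Rightarrow> 'n arc set \<Rightarrow> bool" where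
  "has_codimension_in e F C \<longleftrightarrow> F \<subseteq> C \<and>
     (\<exists>d. \<forall>k\<in>K_grp. submanifold (d + e) (jets2 k C) \<and> has_dimension d (jets2 k F))"


section \<open>The family of curves\<close>

text \<open>The distinct indices \<open>i1\<close>, \<open>i2\<close> are those numbered 1 and 2 in \<open>{1,\<dots>,n}\<close>; quantifying
  over all such pairs covers every enumeration of the index type.\<close>

definition circle_curve :: "'n::finite \<Rightarrow> 'n \<Rightarrow> real \<Rightarrow> real \<Rightarrow> 'n coords" where
  "circle_curve i1 i2 c t = (\<chi> a. case a of
       Inl i \<Rightarrow> if i = i1 then (2 * c^2 - t) / (2 * c^3)
                else if i = i2 then - 1 / (2 * c^3 * t) else 0
     | Inr i \<Rightarrow> if i = i1 then 1 / t else if i = i2 then t else 0)"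

end

theory Submission
  imports Defs
begin

text \<open>The metric \<open>g\<close> is Einstein, so \<open>P\<close> is a multiple of \<open>g\<close> and contributes only multiples of the velocity \<open>v\<close> to the
  tractor derivatives. With \<open>a = \<nabla>\<^sub>v v\<close>, a nowhere null curve is therefore a conformal circle as soon as
  \<open>g(v,v) \<nabla>\<^sub>v a - 3 g(v,a) a\<close> is a multiple of \<open>v\<close>. This can be solved for any initial 2-jet with
  \<open>g(v,v) \<noteq> 0\<close>, so the 2-jets of conformal circles form an open set.

  \<open>K/H\<close> is embedded equivariantly into matrices as the rank-one projections \<open>p q\<^sup>T\<close>, \<open>q \<bullet> p = 1\<close>. A tangent
  vector is \<open>\<xi> q\<^sup>T + p \<eta>\<^sup>T\<close> with \<open>q \<bullet> \<xi> = 0 = \<eta> \<bullet> p\<close>, and the \<open>K\<close>-invariants of a 2-jet are the pairings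
  \<open>\<eta> \<bullet> \<xi>\<close> of \<open>v\<close> and \<open>a\<close>; their symmetric part is given by \<open>g\<close>, their antisymmetric part is one number \<open>\<omega>(v,a)\<close>.
  On the family \<open>\<omega>(v,a) = 0\<close>, a hypersurface. Conversely the remaining invariants of a jet with \<open>\<omega>(v,a) = 0\<close> and
  nondegenerate pairing matrix \<open>B\<close>, near a jet of the family, are those of the family with
  \<open>c\<^sup>3 = 1 + det B / B\<^sub>1\<^sub>1\<^sup>3\<close> in a suitable parametrization, and jets with equal invariants are related by a linear map
  close to the given one.\<close>

section \<open>Calculus of smooth maps\<close>

text \<open>Once \<open>\<omega>(v,a) = 0\<close>, the pairing matrix \<open>B\<close> holds three
  invariants, and a member of the family has three parameters to match them: \<open>c\<close> and
  the first two derivatives of the change of parameter, while the time \<open>t\<close> may be held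
  fixed. Adding a multiple of \<open>v\<close> to \<open>a\<close> does not change
  \<open>det B\<close>, and rescaling \<open>v\<close> multiplies \<open>det B\<close> and
  \<open>B\<^sub>1\<^sub>1\<^sup>3\<close> by the same factor, so their quotient sees
  \<open>c\<close> alone. The obstacle is \<open>c = 1\<close>: there \<open>det B = 0\<close>, and
  no inverse Gram matrix is available to build the linear map from. The notion of dimension asks for
  a piece of hypersurface inside every neighbourhood, not through a prescribed jet, so such a jet is
  first moved to one with a nearby \<open>c\<close>. Staying close to the given element of
  \<open>K\<close> makes the linear map invertible with positive determinant for every
  \<open>n\<close>, and a scalar factor then brings it into \<open>K\<close>. The orbit fills only a
  part of the hypersurface, since \<open>g(v,v) > 0\<close> on it; hence containment in the
  hypersurface and local filling are proved separately.\<close>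

lemma Ck_on_cong:
  assumes "open S" "\<And>x. x \<in> S \<Longrightarrow> f x = g x" "Ck_on k S f"
  shows "Ck_on k S g"
  using assms(2,3)
proof (induction k arbitrary: f g)
  case 0
  then show ?case by (metis Ck_on.simps(1) continuous_on_cong)
next
  case (Suc k)
  have d: "f differentiable at x" if "x \<in> S" for x using Suc.prems that by auto
  have e: "frechet_derivative f (at x) = frechet_derivative g (at x)" if "x \<in> S" for x
    using frechet_derivative_transform_within_open[OF d[OF that] assms(1) that] Suc.prems(1) by blast
  have "g differentiable at x" if x: "x \<in> S" for x
  proof -
    obtain D where D: "(f has_derivative D) (at x)" using d[OF x] unfolding differentiable_def by blast
    have "(g has_derivative D) (at x)"
      by (rule has_derivative_transform_within_open[OF D assms(1) x]) (rule Suc.prems(1))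
    then show ?thesis unfolding differentiable_def by blast
  qed
  moreover have "Ck_on k S (\<lambda>x. frechet_derivative g (at x) v)" for v
    using Suc.IH[of "\<lambda>x. frechet_derivative f (at x) v" "\<lambda>x. frechet_derivative g (at x) v"] e Suc.prems by auto
  ultimately show ?case by auto
qed

text \<open>Smoothness can be checked with any explicit derivative: on an open set it agrees with
  the \<open>frechet_derivative\<close> that the recursion of \<open>Ck_on\<close> uses.\<close>

lemma Ck_on_SucI:
  assumes "open S" "\<And>x. x \<in> S \<Longrightarrow> (f has_derivative f' x) (at x)" "\<And>v. Ck_on k S (\<lambda>x. f' x v)"
  shows "Ck_on (Suc k) S f"
proof -
  have "frechet_derivative f (at x) = f' x" if "x \<in> S" for x
    by (rule frechet_derivative_at[OF assms(2)[OF that], symmetric])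
  then have "Ck_on k S (\<lambda>x. frechet_derivative f (at x) v)" for v
    by (intro Ck_on_cong[OF assms(1) _ assms(3)[of v]]) simp
  moreover have "f differentiable at x" if "x \<in> S" for x
    by (rule differentiableI[OF assms(2)[OF that]])
  ultimately show ?thesis by simp
qed

lemma Ck_on_SucD: "Ck_on (Suc k) S f \<Longrightarrow> Ck_on k S f"
proof (induction k arbitrary: f)
  case 0
  then show ?case
    by (simp add: continuous_at_imp_continuous_on differentiable_imp_continuous_within)
next
  case (Suc k)
  then show ?case by auto
qed

lemma Ck_on_Suc_has_derivative:
  assumes "Ck_on (Suc k) S f" "x \<in> S"
  shows "(f has_derivative frechet_derivative f (at x)) (at x)"
  using assms frechet_derivative_works by auto

lemma Ck_on_subset: "Ck_on k S f \<Longrightarrow> T \<subseteq> S \<Longrightarrow> Ck_on k T f"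
proof (induction k arbitrary: f)
  case 0 then show ?case using continuous_on_subset by auto
next
  case (Suc k) then show ?case by auto
qed

lemma Ck_on_const: "open S \<Longrightarrow> Ck_on k S (\<lambda>x. c)"
proof (induction k arbitrary: c)
  case 0 then show ?case by simp
next
  case (Suc k)
  show ?case
    by (rule Ck_on_SucI[where f'="\<lambda>x v. 0"]) (use Suc in auto)
qed

lemma Ck_on_linear:
  assumes "open S" "bounded_linear L" shows "Ck_on k S L"
proof (cases k)
  case 0 then show ?thesis using assms linear_continuous_on by auto
next
  case (Suc m)
  have "Ck_on (Suc m) S L"
    by (rule Ck_on_SucI[where f'="\<lambda>x. L"])
       (use assms bounded_linear_imp_has_derivative Ck_on_const in auto)
  then show ?thesis using Suc by simp
qed

lemma Ck_on_linear_compose: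
  assumes "open S" "bounded_linear L" "Ck_on k S f" shows "Ck_on k S (\<lambda>x. L (f x))"
  using assms(3)
proof (induction k arbitrary: f)
  case 0
  then show ?case using assms(2) by (simp add: bounded_linear.continuous_on)
next
  case (Suc k)
  show ?case
  proof (rule Ck_on_SucI[where f'="\<lambda>x v. L (frechet_derivative f (at x) v)"])
    show "Ck_on k S (\<lambda>x. L (frechet_derivative f (at x) v))" for v
      by (rule Suc.IH) (use Suc.prems in simp)
    show "((\<lambda>x. L (f x)) has_derivative (\<lambda>v. L (frechet_derivative f (at x) v))) (at x)" if "x \<in> S" for x
      by (rule bounded_linear.has_derivative[OF assms(2) Ck_on_Suc_has_derivative[OF Suc.prems that]])
  qed (rule assms(1))
qed

lemma Ck_on_add:
  assumes "open S" "Ck_on k S f" "Ck_on k S g" shows "Ck_on k S (\<lambda>x. f x + g x)"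
  using assms(2,3)
proof (induction k arbitrary: f g)
  case 0
  then show ?case by (simp add: continuous_on_add)
next
  case (Suc k)
  show ?case
  proof (rule Ck_on_SucI[where f'="\<lambda>x v. frechet_derivative f (at x) v + frechet_derivative g (at x) v"])
    show "Ck_on k S (\<lambda>x. frechet_derivative f (at x) v + frechet_derivative g (at x) v)" for v
      using Suc by simp
    show "((\<lambda>x. f x + g x) has_derivative
        (\<lambda>v. frechet_derivative f (at x) v + frechet_derivative g (at x) v)) (at x)" if "x \<in> S" for x
      by (rule has_derivative_add[OF Ck_on_Suc_has_derivative[OF Suc.prems(1) that]
          Ck_on_Suc_has_derivative[OF Suc.prems(2) that]])
  qed (rule assms(1))
qed

text \<open>The product rule gives a sum of two products of the same kind, so the induction closes.
  One statement for all bounded bilinear maps covers scalar, inner, outer and matrix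
  products.\<close>

lemma Ck_on_bilinear:
  assumes "open S" "bounded_bilinear B" "Ck_on k S f" "Ck_on k S g"
  shows "Ck_on k S (\<lambda>x. B (f x) (g x))"
  using assms(3,4)
proof (induction k arbitrary: f g)
  case 0
  then show ?case using assms(2) by (simp add: bounded_bilinear.continuous_on)
next
  case (Suc k)
  show ?case
  proof (rule Ck_on_SucI[where f'="\<lambda>x v. B (f x) (frechet_derivative g (at x) v) + B (frechet_derivative f (at x) v) (g x)"])
    show "Ck_on k S (\<lambda>x. B (f x) (frechet_derivative g (at x) v) + B (frechet_derivative f (at x) v) (g x))" for v
      by (intro Ck_on_add assms(1) Suc.IH Ck_on_SucD[OF Suc.prems(1)] Ck_on_SucD[OF Suc.prems(2)])
        (use Suc.prems in simp_all)
    show "((\<lambda>x. B (f x) (g x)) has_derivative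
        (\<lambda>v. B (f x) (frechet_derivative g (at x) v) + B (frechet_derivative f (at x) v) (g x))) (at x)"
      if "x \<in> S" for x
      using bounded_bilinear.FDERIV[OF assms(2) Ck_on_Suc_has_derivative[OF Suc.prems(1) that]
          Ck_on_Suc_has_derivative[OF Suc.prems(2) that]] .
  qed (rule assms(1))
qed

lemmas Ck_on_scaleR = Ck_on_bilinear[OF _ bounded_bilinear_scaleR]
lemmas Ck_on_inner = Ck_on_bilinear[OF _ bounded_bilinear_inner]
lemmas Ck_on_mult = Ck_on_bilinear[OF _ bounded_bilinear_mult]

lemma Ck_on_minus: "open S \<Longrightarrow> Ck_on k S f \<Longrightarrow> Ck_on k S (\<lambda>x. - f x)"
  using Ck_on_linear_compose[of S "\<lambda>x. - x"] bounded_linear_minus[OF bounded_linear_ident] by blast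

lemma Ck_on_diff:
  assumes "open S" "Ck_on k S f" "Ck_on k S g" shows "Ck_on k S (\<lambda>x. f x - g x)"
  using Ck_on_add[OF assms(1,2) Ck_on_minus[OF assms(1,3)]] by simp

lemma Ck_on_sum:
  assumes "open S" "\<And>i. i \<in> I \<Longrightarrow> Ck_on k S (f i)"
  shows "Ck_on k S (\<lambda>x. \<Sum>i\<in>I. f i x)"
  using assms(2)
  by (induction I rule: infinite_finite_induct) (auto intro: Ck_on_const Ck_on_add assms(1))

lemma Ck_on_power:
  fixes f :: "_ \<Rightarrow> real"
  assumes "open S" "Ck_on k S f" shows "Ck_on k S (\<lambda>x. f x ^ m)"
  by (induction m) (auto intro: Ck_on_const Ck_on_mult assms)

text \<open>The derivative is a product of \<open>inverse f\<close> with a derivative of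
  \<open>f\<close>, so order k for \<open>inverse f\<close> itself, the induction hypothesis, yields
  order k + 1.\<close>

lemma Ck_on_inverse:
  fixes f :: "_ \<Rightarrow> real"
  assumes "open S" "Ck_on k S f" "\<And>x. x \<in> S \<Longrightarrow> f x \<noteq> 0" shows "Ck_on k S (\<lambda>x. inverse (f x))"
  using assms(2)
proof (induction k)
  case 0
  then show ?case using assms(3) by (simp add: continuous_on_inverse)
next
  case (Suc k)
  have *: "Ck_on k S f" using Suc.prems Ck_on_SucD by blast
  show ?case
  proof (rule Ck_on_SucI[where f'="\<lambda>x v. - (inverse (f x) * frechet_derivative f (at x) v * inverse (f x))"])
    show "Ck_on k S (\<lambda>x. - (inverse (f x) * frechet_derivative f (at x) v * inverse (f x)))" for v
      using Suc.IH[OF *] Suc.prems by (intro Ck_on_minus Ck_on_mult assms(1)) auto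
    show "((\<lambda>x. inverse (f x)) has_derivative
        (\<lambda>v. - (inverse (f x) * frechet_derivative f (at x) v * inverse (f x)))) (at x)" if "x \<in> S" for x
      by (rule Deriv.has_derivative_inverse[OF assms(3)[OF that] Ck_on_Suc_has_derivative[OF Suc.prems that]])
  qed (rule assms(1))
qed

lemma Ck_on_divide:
  fixes f g :: "_ \<Rightarrow> real"
  assumes "open S" "Ck_on k S f" "Ck_on k S g" "\<And>x. x \<in> S \<Longrightarrow> g x \<noteq> 0"
  shows "Ck_on k S (\<lambda>x. f x / g x)"
  unfolding divide_inverse by (intro Ck_on_mult Ck_on_inverse assms)

lemma Ck_on_nth: "open S \<Longrightarrow> Ck_on k S f \<Longrightarrow> Ck_on k S (\<lambda>x. f x $ i)"
  by (rule Ck_on_linear_compose[OF _ bounded_linear_vec_nth])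

lemma Ck_on_vec:
  fixes f :: "_ \<Rightarrow> real^'m::finite"
  assumes "open S" "\<And>i. Ck_on k S (\<lambda>x. f x $ i)" shows "Ck_on k S f"
proof -
  have "Ck_on k S (\<lambda>x. \<Sum>i\<in>UNIV. (f x $ i) *\<^sub>R axis i (1::real))"
    by (intro Ck_on_sum Ck_on_scaleR Ck_on_const assms)
  then show ?thesis using basis_expansion[of "f _"] by (simp add: scalar_mult_eq_scaleR)
qed

lemma Ck_on_real_SucI:
  fixes f :: "real \<Rightarrow> _"
  assumes "open S" "\<And>x. x \<in> S \<Longrightarrow> (f has_vector_derivative f' x) (at x)" "Ck_on k S f'"
  shows "Ck_on (Suc k) S f"
  by (rule Ck_on_SucI[where f'="\<lambda>x v. v *\<^sub>R f' x"])
    (use assms in \<open>auto simp: has_vector_derivative_def intro: Ck_on_scaleR Ck_on_const\<close>)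

lemma has_derivative_real_scaleR:
  fixes f :: "real \<Rightarrow> 'b::real_normed_vector"
  assumes "(f has_derivative D) (at x)" shows "D h = h *\<^sub>R D 1"
proof -
  interpret bounded_linear D using assms by (rule has_derivative_bounded_linear)
  show ?thesis using scaleR[of h 1] by simp
qed

lemma Ck_on_velocity:
  fixes f :: "real \<Rightarrow> _"
  assumes "open S" "Ck_on (Suc k) S f" shows "Ck_on k S (velocity f)"
proof (rule Ck_on_cong[OF assms(1)])
  show "Ck_on k S (\<lambda>x. frechet_derivative f (at x) 1)" using assms(2) by simp
  fix x assume "x \<in> S"
  then have D: "(f has_derivative frechet_derivative f (at x)) (at x)"
    using Ck_on_Suc_has_derivative[OF assms(2)] by blast
  have "(\<lambda>h. h *\<^sub>R frechet_derivative f (at x) 1) = frechet_derivative f (at x)"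
    by (rule ext) (rule has_derivative_real_scaleR[OF D, symmetric])
  with D have "(f has_vector_derivative frechet_derivative f (at x) 1) (at x)"
    unfolding has_vector_derivative_def by simp
  then show "frechet_derivative f (at x) 1 = velocity f x"
    by (simp add: vector_derivative_at)
qed

lemma smooth_on_subset: "smooth_on S f \<Longrightarrow> T \<subseteq> S \<Longrightarrow> smooth_on T f"
  unfolding smooth_on_def using Ck_on_subset by blast

lemma smooth_on_velocity: "open S \<Longrightarrow> smooth_on S f \<Longrightarrow> smooth_on S (velocity f)"
  unfolding smooth_on_def using Ck_on_velocity by blast

lemma smooth_on_has_vector_derivative:
  fixes f :: "real \<Rightarrow> _"
  assumes "smooth_on S f" "x \<in> S"
  shows "(f has_vector_derivative velocity f x) (at x)"
proof -
  have "Ck_on (Suc 0) S f" using assms unfolding smooth_on_def by blast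
  then have "f differentiable at x" using assms(2) by simp
  then show ?thesis by (rule vector_derivative_works[THEN iffD1])
qed

lemmas Ck_on_intros = Ck_on_const Ck_on_add Ck_on_diff Ck_on_minus Ck_on_mult Ck_on_scaleR
  Ck_on_inner Ck_on_power Ck_on_divide Ck_on_sum

text \<open>The chain rule applies the derivative of \<open>F\<close> to a direction that moves with
  \<open>x\<close>, whereas \<open>Ck_on\<close> speaks of fixed directions only. Expansion in
  \<open>Basis\<close> gives fixed directions with smooth coefficients.\<close>

lemma Ck_on_compose:
  fixes F :: "'b::euclidean_space \<Rightarrow> 'c::real_normed_vector"
  assumes "open S" "open U" "Ck_on k U F" "Ck_on k S z" "\<And>x. x \<in> S \<Longrightarrow> z x \<in> U"
  shows "Ck_on k S (\<lambda>x. F (z x))"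
  using assms(3,4)
proof (induction k arbitrary: F)
  case 0
  then show ?case using assms(5) by (auto intro: continuous_on_compose2)
next
  case (Suc k)
  have expand: "D h = (\<Sum>b\<in>Basis. (h \<bullet> b) *\<^sub>R D b)" if "bounded_linear D" for D :: "'b \<Rightarrow> 'c" and h
  proof -
    interpret bounded_linear D by fact
    have "D h = D (\<Sum>b\<in>Basis. (h \<bullet> b) *\<^sub>R b)" by (simp add: euclidean_representation)
    then show ?thesis by (simp add: sum scaleR)
  qed
  let ?F = "\<lambda>y. frechet_derivative F (at y)" and ?z = "\<lambda>x. frechet_derivative z (at x)"
  show ?case
  proof (rule Ck_on_SucI[where f'="\<lambda>x v. \<Sum>b\<in>Basis. (?z x v \<bullet> b) *\<^sub>R ?F (z x) b"])
    show "Ck_on k S (\<lambda>x. \<Sum>b\<in>Basis. (?z x v \<bullet> b) *\<^sub>R ?F (z x) b)" for v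
    proof (intro Ck_on_sum Ck_on_scaleR Ck_on_inner Ck_on_const assms(1))
      show "Ck_on k S (\<lambda>x. ?z x v)" using Suc.prems(2) by simp
      show "Ck_on k S (\<lambda>x. ?F (z x) b)" for b
        using Suc.IH[of "\<lambda>y. ?F y b"] Suc.prems(1) Ck_on_SucD[OF Suc.prems(2)] by simp
    qed
    fix x assume x: "x \<in> S"
    have DF: "(F has_derivative ?F (z x)) (at (z x))"
      by (rule Ck_on_Suc_has_derivative[OF Suc.prems(1) assms(5)[OF x]])
    have "((\<lambda>x. F (z x)) has_derivative (\<lambda>v. ?F (z x) (?z x v))) (at x)"
      using diff_chain_at[OF Ck_on_Suc_has_derivative[OF Suc.prems(2) x] DF] by (simp add: o_def)
    then show "((\<lambda>x. F (z x)) has_derivative (\<lambda>v. \<Sum>b\<in>Basis. (?z x v \<bullet> b) *\<^sub>R ?F (z x) b)) (at x)"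
      by (subst (asm) expand[OF has_derivative_bounded_linear[OF DF]])
  qed (rule assms(1))
qed

lemma Ck_on_Pair:
  assumes "open S" "Ck_on k S f" "Ck_on k S g" shows "Ck_on k S (\<lambda>x. (f x, g x))"
proof -
  have "Ck_on k S (\<lambda>x. (f x, 0) + (0, g x))"
    by (intro Ck_on_add assms(1)
        Ck_on_linear_compose[OF assms(1) bounded_linear_Pair[OF bounded_linear_ident bounded_linear_zero] assms(2)]
        Ck_on_linear_compose[OF assms(1) bounded_linear_Pair[OF bounded_linear_zero bounded_linear_ident] assms(3)])
  then show ?thesis by simp
qed

lemma Ck_on_fst: "open S \<Longrightarrow> Ck_on k S f \<Longrightarrow> Ck_on k S (\<lambda>x. fst (f x))"
  and Ck_on_snd: "open S \<Longrightarrow> Ck_on k S f \<Longrightarrow> Ck_on k S (\<lambda>x. snd (f x))"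
  by (rule Ck_on_linear_compose[OF _ bounded_linear_fst], simp, simp)
     (rule Ck_on_linear_compose[OF _ bounded_linear_snd])

section \<open>Smooth solutions of ordinary differential equations\<close>

text \<open>On a compact ball the derivatives in basis directions are bounded; the sum of the bounds
  controls the operator norm, and the mean value inequality applies since the ball is
  convex.\<close>

lemma Ck1_on_lipschitz:
  fixes F :: "'a::euclidean_space \<Rightarrow> 'b::real_normed_vector"
  assumes "open U" "Ck_on 1 U F" "z0 \<in> U"
  obtains r L where "r > 0" "cball z0 r \<subseteq> U" "L \<ge> 0"
    "\<And>x y. x \<in> cball z0 r \<Longrightarrow> y \<in> cball z0 r \<Longrightarrow> norm (F x - F y) \<le> L * norm (x - y)"
proof -
  obtain r where r: "r > 0" "cball z0 r \<subseteq> U" using assms open_contains_cball by blast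
  let ?F = "\<lambda>y. frechet_derivative F (at y)"
  have "\<exists>B. \<forall>x\<in>cball z0 r. norm (?F x b) \<le> B" for b
  proof -
    have "continuous_on U (\<lambda>x. ?F x b)" using assms(2) by (simp add: One_nat_def)
    then have "continuous_on (cball z0 r) (\<lambda>x. ?F x b)" using r(2) by (rule continuous_on_subset)
    then have "bounded ((\<lambda>x. ?F x b) ` cball z0 r)"
      by (intro compact_imp_bounded compact_continuous_image) auto
    then show ?thesis unfolding bounded_iff by auto
  qed
  then obtain B where B: "\<And>x b. x \<in> cball z0 r \<Longrightarrow> norm (?F x b) \<le> B b" by metis
  define L where "L = (\<Sum>b\<in>Basis. B b)"
  have B0: "B b \<ge> 0" for b using B[of z0 b] r(1) norm_ge_zero order_trans by (metis centre_in_cball less_imp_le)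
  have DF: "(F has_derivative ?F x) (at x)" if "x \<in> cball z0 r" for x
    using Ck_on_Suc_has_derivative[of 0 U F x] assms(2) that r(2) by (auto simp: One_nat_def)
  have "onorm (?F x) \<le> L" if x: "x \<in> cball z0 r" for x
  proof (rule onorm_bound)
    show "L \<ge> 0" unfolding L_def by (simp add: B0 sum_nonneg)
    fix h
    interpret bounded_linear "?F x" using DF[OF x] by (rule has_derivative_bounded_linear)
    have "?F x h = (\<Sum>b\<in>Basis. (h \<bullet> b) *\<^sub>R ?F x b)"
      by (subst euclidean_representation[of h, symmetric]) (simp only: sum scaleR)
    also have "norm \<dots> \<le> (\<Sum>b\<in>Basis. norm h * B b)"
      by (rule sum_norm_le) (auto intro!: mult_mono B x simp: Basis_le_norm)
    finally show "norm (?F x h) \<le> L * norm h" by (simp add: L_def sum_distrib_left mult.commute)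
  qed
  then have "norm (F x - F y) \<le> L * norm (x - y)" if "x \<in> cball z0 r" "y \<in> cball z0 r" for x y
    using differentiable_bound[of "cball z0 r" F ?F L x y] DF that has_derivative_at_withinI by blast
  moreover have "L \<ge> 0" unfolding L_def by (simp add: B0 sum_nonneg)
  ultimately show ?thesis using that r by blast
qed

text \<open>Banach's fixed point theorem on the space of all bounded continuous functions on the
  line. With \<open>G\<close> globally Lipschitz and bounded, the integral operator acts on the
  whole space and no invariant ball has to be found.\<close>

theorem picard_lipschitz:
  fixes G :: "'a::banach \<Rightarrow> 'a"
  assumes lip: "\<And>x y. norm (G x - G y) \<le> L * norm (x - y)" and L: "L \<ge> 0"
    and bd: "\<And>x. norm (G x) \<le> B"
  obtains d z where "d > 0" "z 0 = z0" "\<And>t. t \<in> {-d<..<d} \<Longrightarrow> (z has_vector_derivative G (z t)) (at t)"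
proof -
  \<comment> \<open>Two integrals over intervals of length at most \<open>2 * d\<close> give the
    contraction factor \<open>4 * d * L\<close>, which is then at most 1/2.\<close>
  define d where "d = 1 / (8 * (L + 1))"
  have d: "d > 0" "4 * d * L \<le> 1/2" using L by (auto simp: d_def field_simps)
  \<comment> \<open>Clamping the time keeps the iterates bounded on the whole line; on
    \<open>{-d..d}\<close> it changes nothing.\<close>
  define cl where "cl t = max (-d) (min d t)" for t
  have clm: "cl t \<in> {-d..d}" for t using d by (auto simp: cl_def)
  have cl_cont: "continuous_on S cl" for S unfolding cl_def by (intro continuous_intros)
  have Gcont: "continuous_on S (\<lambda>t. G (z t))" if "continuous_on S z" for S and z :: "real \<Rightarrow> 'a"
  proof -
    have "continuous_on UNIV G"
      by (rule lipschitz_on_continuous_on[of L]) (use lip L in \<open>auto simp: lipschitz_on_def dist_norm\<close>)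
    then show ?thesis using that continuous_on_compose2 by blast
  qed
  \<comment> \<open>An integral over \<open>{0..t}\<close> vanishes for negative \<open>t\<close>;
    the difference of two integrals starting at \<open>-d\<close> is the signed integral from
    0.\<close>
  define P where "P z t = z0 + integral {-d..cl t} (\<lambda>s. G (z s)) - integral {-d..0} (\<lambda>s. G (z s))"
    for z :: "real \<Rightarrow>\<^sub>C 'a" and t
  have z_int: "(\<lambda>s. G (apply_bcontfun z s)) integrable_on {a..b}" for z and a b :: real
    by (intro integrable_continuous_real Gcont) auto
  have B0: "B \<ge> 0" using bd[of 0] norm_ge_zero order_trans by blast
  have bnd: "norm (integral {-d..cl t} f) \<le> K * (2*d)" if "continuous_on UNIV f" "\<And>s. norm (f s) \<le> K" "K \<ge> 0"
    for K t and f :: "real \<Rightarrow> 'a"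
  proof -
    have "norm (integral {-d..cl t} f) \<le> K * (cl t - (-d))"
      using clm[of t] that by (intro integral_bound continuous_on_subset[OF that(1)]) auto
    also have "\<dots> \<le> K * (2*d)" using clm[of t] that by (intro mult_left_mono) auto
    finally show ?thesis .
  qed
  have cl0: "cl 0 = 0" using d by (auto simp: cl_def)
  have Pc: "P z \<in> bcontfun" for z
  proof (rule bcontfun_normI)
    have "continuous_on {-d..d} (\<lambda>u. integral {-d..u} (\<lambda>s. G (apply_bcontfun z s)))"
      by (rule indefinite_integral_continuous_1[OF z_int])
    then have "continuous_on UNIV (\<lambda>t. integral {-d..cl t} (\<lambda>s. G (apply_bcontfun z s)))"
      using continuous_on_compose2[OF _ cl_cont, of "{-d..d}"] clm by blast
    then show "continuous_on UNIV (P z)" unfolding P_def by (intro continuous_intros)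
    show "norm (P z t) \<le> norm z0 + B * (2*d) + B * (2*d)" for t
    proof -
      have i: "norm (integral {-d..cl u} (\<lambda>s. G (apply_bcontfun z s))) \<le> B * (2*d)" for u
        by (rule bnd) (auto intro!: Gcont bd B0)
      have "norm (a + b - c) \<le> norm a + X + Y" if "norm b \<le> X" "norm c \<le> Y" for a b c :: 'a and X Y
        using norm_triangle_ineq4[of "a + b" c] norm_triangle_ineq[of a b] that by linarith
      from this[OF i[of t] i[of 0, unfolded cl0]] show ?thesis unfolding P_def .
    qed
  qed
  define PP where "PP z = Bcontfun (P z)" for z
  have PP: "apply_bcontfun (PP z) = P z" for z unfolding PP_def by (simp add: Bcontfun_inverse Pc)
  have "dist (PP z) (PP w) \<le> 1/2 * dist z w" for z w
  proof (rule dist_bound)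
    fix t
    have *: "norm (G (z s) - G (w s)) \<le> L * dist z w" for s
    proof -
      have "norm (z s - w s) \<le> dist z w" using dist_bounded[of z s w] by (simp add: dist_norm)
      from mult_left_mono[OF this L] show ?thesis using lip[of "z s" "w s"] by linarith
    qed
    have i: "norm (integral {-d..cl u} (\<lambda>s. G (z s)) - integral {-d..cl u} (\<lambda>s. G (w s))) \<le> L * dist z w * (2*d)" for u
    proof -
      have "norm (integral {-d..cl u} (\<lambda>s. G (z s) - G (w s))) \<le> L * dist z w * (2*d)"
        by (rule bnd) (use * L in \<open>auto intro!: continuous_intros Gcont\<close>)
      then show ?thesis by (simp add: integral_diff z_int)
    qed
    have "norm ((a + b - c) - (a + b' - c')) \<le> X + Y" if "norm (b - b') \<le> X" "norm (c - c') \<le> Y"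
      for a b c b' c' :: 'a and X Y
    proof -
      have "(a + b - c) - (a + b' - c') = (b - b') - (c - c')" by simp
      then have "norm ((a + b - c) - (a + b' - c')) = norm ((b - b') - (c - c'))" by (rule arg_cong)
      then show ?thesis using norm_triangle_ineq4[of "b - b'" "c - c'"] that by linarith
    qed
    from this[OF i[of t] i[of 0, unfolded cl0]]
    have "dist (PP z t) (PP w t) \<le> L * dist z w * (2*d) + L * dist z w * (2*d)"
      unfolding PP P_def dist_norm[where 'a='a] .
    also have "\<dots> = 4 * d * L * dist z w" by (simp add: algebra_simps)
    also have "\<dots> \<le> 1/2 * dist z w" using d(2) by (intro mult_right_mono) auto
    finally show "dist (PP z t) (PP w t) \<le> 1/2 * dist z w" .
  qed
  then obtain z where z: "PP z = z" using banach_fix_type[of "1/2" PP] by auto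
  have zeq: "z t = z0 + integral {-d..cl t} (\<lambda>s. G (z s)) - integral {-d..0} (\<lambda>s. G (z s))" for t
    using PP[of z] z P_def by metis
  show ?thesis
  proof
    show "d > 0" by fact
    show "apply_bcontfun z 0 = z0" using zeq[of 0] cl0 by simp
    fix t assume t: "t \<in> {-d<..<d}"
    have "((\<lambda>u. integral {-d..u} (\<lambda>s. G (z s))) has_vector_derivative G (z t)) (at t within {-d..d})"
      by (rule integral_has_vector_derivative) (use t in \<open>auto intro!: Gcont\<close>)
    then have 1: "((\<lambda>u. integral {-d..u} (\<lambda>s. G (z s))) has_vector_derivative G (z t)) (at t)"
      using t at_within_Icc_at by (metis greaterThanLessThan_iff)
    have 2: "((\<lambda>u. z0 + integral {-d..u} (\<lambda>s. G (z s)) - integral {-d..0} (\<lambda>s. G (z s))) has_vector_derivative G (z t)) (at t)"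
      using 1 by (auto intro!: derivative_eq_intros)
    have eq: "z0 + integral {-d..u} (\<lambda>s. G (z s)) - integral {-d..0} (\<lambda>s. G (z s)) = z u" if "u \<in> {-d<..<d}" for u
    proof -
      have "cl u = u" using that by (auto simp: cl_def)
      then show ?thesis using zeq[of u] by metis
    qed
    show "(apply_bcontfun z has_vector_derivative G (z t)) (at t)"
      by (rule has_vector_derivative_transform_within_open[OF 2 open_greaterThanLessThan t eq])
  qed
qed

text \<open>Composing \<open>F\<close> with the nearest-point projection onto a small ball makes it
  globally Lipschitz and bounded, since the projection does not increase distances. For short times
  the solution stays in the ball, where the projection is the identity. Smoothness follows by
  bootstrapping: if \<open>z\<close> is of order k, so is its derivative
  \<open>F (z t)\<close>.\<close>

theorem smooth_ode_solution:
  fixes F :: "'a::euclidean_space \<Rightarrow> 'a"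
  assumes "open U" "smooth_on U F" "z0 \<in> U"
  obtains d z where "d > 0" "z 0 = z0" "smooth_on {-d<..<d} z"
    "\<And>t. t \<in> {-d<..<d} \<Longrightarrow> z t \<in> U \<and> (z has_vector_derivative F (z t)) (at t)"
proof -
  have "Ck_on 1 U F" using assms unfolding smooth_on_def by blast
  then obtain r L where r: "r > 0" "cball z0 r \<subseteq> U" "L \<ge> 0"
    and lip: "\<And>x y. x \<in> cball z0 r \<Longrightarrow> y \<in> cball z0 r \<Longrightarrow> norm (F x - F y) \<le> L * norm (x - y)"
    using Ck1_on_lipschitz assms(1,3) by metis
  define cp where "cp = closest_point (cball z0 r)"
  have cpm: "cp x \<in> cball z0 r" for x unfolding cp_def using r by (intro closest_point_in_set) auto
  have cpl: "norm (cp x - cp y) \<le> norm (x - y)" for x y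
    using closest_point_lipschitz[of "cball z0 r" x y] r unfolding cp_def dist_norm by auto
  have 1: "norm (F (cp x) - F (cp y)) \<le> L * norm (x - y)" for x y
    using lip[OF cpm cpm] mult_left_mono[OF cpl r(3)] order_trans by blast
  have 2: "norm (F (cp x)) \<le> norm (F z0) + L * r" for x
  proof -
    have "norm (F (cp x) - F z0) \<le> L * norm (cp x - z0)" using lip[OF cpm] r by simp
    also have "\<dots> \<le> L * r" using cpm[of x] r by (intro mult_left_mono) (auto simp: dist_norm norm_minus_commute)
    finally show ?thesis by (smt (verit) norm_triangle_sub)
  qed
  obtain d z where d: "d > 0" "z 0 = z0"
    and z: "\<And>t. t \<in> {-d<..<d} \<Longrightarrow> (z has_vector_derivative F (cp (z t))) (at t)"
    using picard_lipschitz[of "\<lambda>x. F (cp x)" L, OF 1 r(3) 2] by metis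
  have "isCont z 0" using z[of 0] d(1) has_vector_derivative_continuous by force
  then obtain e where e: "e > 0" "\<And>t. dist t 0 < e \<Longrightarrow> dist (z t) (z 0) < r"
    using r(1) unfolding continuous_at_eps_delta by metis
  define m where "m = min d e"
  have zin: "z t \<in> cball z0 r" if "t \<in> {-m<..<m}" for t
  proof -
    have "dist t 0 < e" using that by (auto simp: m_def dist_real_def)
    then show ?thesis using e(2)[of t] d(2) by (simp add: dist_commute)
  qed
  have zd: "(z has_vector_derivative F (z t)) (at t)" if "t \<in> {-m<..<m}" for t
  proof -
    have "cp (z t) = z t" unfolding cp_def using zin[OF that] by (rule closest_point_self)
    moreover have "t \<in> {-d<..<d}" using that by (auto simp: m_def)
    ultimately show ?thesis using z[of t] by simp
  qed
  have zU: "z t \<in> U" if "t \<in> {-m<..<m}" for t using zin[OF that] r(2) by blast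
  have "Ck_on k {-m<..<m} z" for k
  proof (induction k)
    case 0
    show ?case unfolding Ck_on.simps
      by (intro continuous_at_imp_continuous_on ballI) (rule has_vector_derivative_continuous[OF zd])
  next
    case (Suc k)
    have "Ck_on k U F" using assms(2) unfolding smooth_on_def by blast
    from Ck_on_compose[OF _ assms(1) this Suc zU]
    show ?case by (intro Ck_on_real_SucI[where f'="\<lambda>t. F (z t)"] zd open_greaterThanLessThan) auto
  qed
  then show ?thesis
    using that[of m z] d e zU zd unfolding smooth_on_def m_def by auto
qed

section \<open>Curvature of the split Fubini-Study metric\<close>

lemma sum_UNIV_Plus:
  "(\<Sum>a\<in>UNIV. f a) = (\<Sum>i\<in>UNIV. f (Inl i)) + (\<Sum>i\<in>UNIV. f (Inr i))"
  for f :: "'a::finite + 'b::finite \<Rightarrow> 'c::comm_monoid_add"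
  using sum.Plus[of "UNIV :: 'a set" "UNIV :: 'b set" f] by (simp add: UNIV_Plus_UNIV)

lemma if_mult_left: "(if P then a else 0) * c = (if P then a * c else (0::real))"
  and if_mult_right: "c * (if P then a else 0) = (if P then c * a else (0::real))"
  and if_minus: "- (if P then a else 0) = (if P then - a else (0::real))"
  by auto

lemma sum_if_const: "(\<Sum>i\<in>A. if P then f i else 0) = (if P then sum f A else (0::real))"
  by auto

lemmas delta_sums = if_mult_left if_mult_right if_minus sum_if_const sum.distrib sum_subtractf sum_negf

section \<open>The two halves of the coordinates\<close>

definition xpart :: "'n::finite coords \<Rightarrow> real^'n" where "xpart z = (\<chi> i. z $ Inl i)"
definition ypart :: "'n::finite coords \<Rightarrow> real^'n" where "ypart z = (\<chi> i. z $ Inr i)"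
definition join :: "real^'n \<Rightarrow> real^'n \<Rightarrow> 'n::finite coords" where
  "join u w = (\<chi> a. case a of Inl i \<Rightarrow> u $ i | Inr i \<Rightarrow> w $ i)"

lemma xpart_nth [simp]: "xpart z $ i = z $ Inl i" by (simp add: xpart_def)
lemma ypart_nth [simp]: "ypart z $ i = z $ Inr i" by (simp add: ypart_def)
lemma join_nth [simp]: "join u w $ Inl i = u $ i" "join u w $ Inr i = w $ i" by (simp_all add: join_def)
lemma xpart_join [simp]: "xpart (join u w) = u" by (simp add: vec_eq_iff)
lemma ypart_join [simp]: "ypart (join u w) = w" by (simp add: vec_eq_iff)

lemma coords_eqI: "xpart z = xpart w \<Longrightarrow> ypart z = ypart w \<Longrightarrow> z = w"
  unfolding vec_eq_iff xpart_nth ypart_nth by (metis sum.exhaust)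

lemma xpart_linear [simp]: "xpart (v + w) = xpart v + xpart w" "xpart (v - w) = xpart v - xpart w"
    "xpart (- v) = - xpart v" "xpart (c *\<^sub>R v) = c *\<^sub>R xpart v" "xpart 0 = 0"
  by (simp_all add: vec_eq_iff)

lemma ypart_linear [simp]: "ypart (v + w) = ypart v + ypart w" "ypart (v - w) = ypart v - ypart w"
    "ypart (- v) = - ypart v" "ypart (c *\<^sub>R v) = c *\<^sub>R ypart v" "ypart 0 = 0"
  by (simp_all add: vec_eq_iff)

section \<open>The metric, its inverse and its Christoffel symbols\<close>

lemma fs_metric_nth [simp]:
  "fs_metric z $ Inl i $ Inl j = - 2 * z $ Inr i * z $ Inr j"
  "fs_metric z $ Inl i $ Inr j = (if i = j then 1 else 0)"
  "fs_metric z $ Inr i $ Inl j = (if i = j then 1 else 0)"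
  "fs_metric z $ Inr i $ Inr j = 0"
  by (simp_all add: fs_metric_def)

lemma ip_fs_metric:
  "ip fs_metric z v w = xpart v \<bullet> ypart w + ypart v \<bullet> xpart w
     - 2 * (ypart z \<bullet> xpart v) * (ypart z \<bullet> xpart w)"
  unfolding ip_def sum_UNIV_Plus
  by (simp add: inner_vec_def delta_sums sum_distrib_left sum_distrib_right sum_product mult_ac)

definition fs_metric_inv :: "'n::finite coords \<Rightarrow> real^('n + 'n)^('n + 'n)" where
  "fs_metric_inv z = (\<chi> a b. case (a, b) of
       (Inl i, Inl j) \<Rightarrow> 0
     | (Inl i, Inr j) \<Rightarrow> if i = j then 1 else 0
     | (Inr i, Inl j) \<Rightarrow> if i = j then 1 else 0
     | (Inr i, Inr j) \<Rightarrow> 2 * z $ Inr i * z $ Inr j)"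

lemma fs_metric_inv_nth [simp]:
  "fs_metric_inv z $ Inl i $ Inl j = 0"
  "fs_metric_inv z $ Inl i $ Inr j = (if i = j then 1 else 0)"
  "fs_metric_inv z $ Inr i $ Inl j = (if i = j then 1 else 0)"
  "fs_metric_inv z $ Inr i $ Inr j = 2 * z $ Inr i * z $ Inr j"
  by (simp_all add: fs_metric_inv_def)

lemma matrix_eqI_Plus:
  fixes A B :: "real^('n::finite + 'n)^('n + 'n)"
  assumes "\<And>i j. A $ Inl i $ Inl j = B $ Inl i $ Inl j" "\<And>i j. A $ Inl i $ Inr j = B $ Inl i $ Inr j"
    "\<And>i j. A $ Inr i $ Inl j = B $ Inr i $ Inl j" "\<And>i j. A $ Inr i $ Inr j = B $ Inr i $ Inr j"
  shows "A = B"
  unfolding vec_eq_iff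
proof (intro allI)
  fix a b show "A $ a $ b = B $ a $ b" by (cases a; cases b) (simp_all add: assms)
qed

lemma fs_metric_mult_inv: "fs_metric z ** fs_metric_inv z = mat 1"
  and fs_metric_inv_mult: "fs_metric_inv z ** fs_metric z = mat 1"
  by (rule matrix_eqI_Plus; simp add: matrix_matrix_mult_def mat_def sum_UNIV_Plus delta_sums)+

lemma matrix_inv_eqI:
  fixes A B :: "real^'n^'n"
  assumes "A ** B = mat 1" shows "matrix_inv A = B"
proof -
  have BA: "B ** A = mat 1" using assms by (simp add: matrix_left_right_inverse)
  then have "A ** matrix_inv A = mat 1"
    using assms unfolding matrix_inv_def by (metis (mono_tags, lifting) someI_ex)
  then have "B ** A ** matrix_inv A = B" by (simp add: matrix_mul_assoc[symmetric] matrix_mul_rid)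
  then show ?thesis by (simp add: BA matrix_mul_lid)
qed

lemma matrix_inv_fs_metric: "matrix_inv (fs_metric z) = fs_metric_inv z"
  by (rule matrix_inv_eqI[OF fs_metric_mult_inv])

lemma partial_eq: "(f has_derivative D) (at x) \<Longrightarrow> partial i f x = D (axis i 1)"
  unfolding partial_def using frechet_derivative_at by metis

lemma has_derivative_nth: "((\<lambda>z. z $ a) has_derivative (\<lambda>v. v $ a)) (at z)"
  by (rule bounded_linear_imp_has_derivative[OF bounded_linear_vec_nth])

lemma partial_const [simp]: "partial a (\<lambda>z. c) z = 0"
  by (subst partial_eq[of _ "\<lambda>_. 0"]) auto

lemma partial_quadratic:
  "partial a (\<lambda>z. - (2 * z $ i * z $ j)) z = - 2 * (axis a 1 $ i * z $ j + z $ i * axis a 1 $ j)"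
  by (subst partial_eq[of _ "\<lambda>v. - 2 * (v $ i * z $ j + z $ i * v $ j)"])
    (auto intro!: derivative_eq_intros has_derivative_nth simp: algebra_simps)

text \<open>The metric depends on the \<open>Inr\<close> coordinates alone, so every coefficient is
  zero or a polynomial of degree one or three in these.\<close>

definition fs_christoffel :: "'n::finite coords \<Rightarrow> 'n + 'n \<Rightarrow> 'n + 'n \<Rightarrow> 'n + 'n \<Rightarrow> real" where
  "fs_christoffel z c a b = (case (c, a, b) of
      (Inl k, Inl i, Inl j) \<Rightarrow> z $ Inr i * (if j = k then 1 else 0) + z $ Inr j * (if i = k then 1 else 0)
    | (Inr k, Inl i, Inl j) \<Rightarrow> 4 * z $ Inr i * z $ Inr j * z $ Inr k
    | (Inr k, Inl i, Inr j) \<Rightarrow> - (if i = j then 1 else 0) * z $ Inr k - (if j = k then 1 else 0) * z $ Inr i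
    | (Inr k, Inr i, Inl j) \<Rightarrow> - (if i = j then 1 else 0) * z $ Inr k - (if i = k then 1 else 0) * z $ Inr j
    | _ \<Rightarrow> 0)"

lemma christoffel_fs: "christoffel fs_metric z c a b = fs_christoffel z c a b"
  unfolding christoffel_def matrix_inv_fs_metric sum_UNIV_Plus
  by (cases a; cases b; cases c)
    (simp_all add: fs_christoffel_def partial_quadratic axis_def delta_sums distrib_left right_diff_distrib)

definition fs_christoffel_deriv :: "'n::finite coords \<Rightarrow> 'n + 'n \<Rightarrow> 'n + 'n \<Rightarrow> 'n + 'n \<Rightarrow> 'n + 'n \<Rightarrow> real" where
  "fs_christoffel_deriv z d c a b = (case (d, c, a, b) of
      (Inr l, Inl k, Inl i, Inl j) \<Rightarrow>
        (if i = l then 1 else 0) * (if j = k then 1 else 0) + (if j = l then 1 else 0) * (if i = k then 1 else 0)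
    | (Inr l, Inr k, Inl i, Inl j) \<Rightarrow> 4 * ((if i = l then 1 else 0) * z $ Inr j * z $ Inr k
        + (if j = l then 1 else 0) * z $ Inr i * z $ Inr k + (if k = l then 1 else 0) * z $ Inr i * z $ Inr j)
    | (Inr l, Inr k, Inl i, Inr j) \<Rightarrow>
        - (if i = j then 1 else 0) * (if k = l then 1 else 0) - (if j = k then 1 else 0) * (if i = l then 1 else 0)
    | (Inr l, Inr k, Inr i, Inl j) \<Rightarrow>
        - (if i = j then 1 else 0) * (if k = l then 1 else 0) - (if i = k then 1 else 0) * (if j = l then 1 else 0)
    | _ \<Rightarrow> 0)"

lemma partial_nth:
  "partial a (\<lambda>z. z $ i) z = axis a 1 $ i"
  "partial a (\<lambda>z. - z $ i) z = - axis a 1 $ i"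
  "partial a (\<lambda>z. 2 * z $ i) z = 2 * axis a 1 $ i"
  "partial a (\<lambda>z. - (2 * z $ i)) z = - (2 * axis a 1 $ i)"
  "partial a (\<lambda>z. z $ i + z $ j) z = axis a 1 $ i + axis a 1 $ j"
  "partial a (\<lambda>z. - z $ i - z $ j) z = - axis a 1 $ i - axis a 1 $ j"
  by (rule partial_eq; auto intro!: derivative_eq_intros has_derivative_nth)+

lemma partial_cubic:
  "partial a (\<lambda>z. r * z $ i * z $ j * z $ k) z =
     r * (axis a 1 $ i * z $ j * z $ k + axis a 1 $ j * z $ i * z $ k + axis a 1 $ k * z $ i * z $ j)"
  by (subst partial_eq[of _ "\<lambda>v. r * (v $ i * z $ j * z $ k + v $ j * z $ i * z $ k + v $ k * z $ i * z $ j)"])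
    (auto intro!: derivative_eq_intros has_derivative_nth simp: algebra_simps)

lemma partial_fs_christoffel:
  "partial d (\<lambda>z. fs_christoffel z c a b) z = fs_christoffel_deriv z d c a b"
  by (cases a; cases b; cases c; cases d)
    (simp_all add: fs_christoffel_def fs_christoffel_deriv_def partial_nth partial_cubic axis_def)

text \<open>This trace is the logarithmic derivative of the volume density, and \<open>det g\<close>
  is constant in these coordinates. With its differentiated form it removes two of the four terms of
  the Ricci tensor.\<close>

lemma fs_christoffel_trace: "(\<Sum>a\<in>UNIV. fs_christoffel z a a b) = 0"
  by (cases b) (simp_all add: sum_UNIV_Plus fs_christoffel_def delta_sums)

lemma fs_christoffel_deriv_trace: "(\<Sum>a\<in>UNIV. fs_christoffel_deriv z d a a b) = 0"
  by (cases b; cases d) (simp_all add: sum_UNIV_Plus fs_christoffel_deriv_def delta_sums)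

text \<open>The Einstein property. What remains of the Ricci tensor is the divergence of the
  Christoffel symbols and one quadratic term, compared block by block with \<open>g\<close>.\<close>

lemma Ric_fs_metric: "Ric fs_metric z = - (real CARD('n) + 1) *\<^sub>R fs_metric z" for z :: "'n::finite coords"
proof -
  have "Ric fs_metric z $ a $ b = (\<Sum>c\<in>UNIV. fs_christoffel_deriv z c c a b)
      - (\<Sum>c\<in>UNIV. fs_christoffel_deriv z a c c b)
      + (\<Sum>p\<in>UNIV. (\<Sum>c\<in>UNIV. fs_christoffel z c c p) * fs_christoffel z p a b)
      - (\<Sum>c\<in>UNIV. \<Sum>p\<in>UNIV. fs_christoffel z c a p * fs_christoffel z p c b)" for a b
    unfolding Ric_def curvature_def christoffel_fs partial_fs_christoffel
    by (simp add: sum.distrib sum_subtractf sum_distrib_right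
        sum.swap[of "\<lambda>c p. fs_christoffel z c c p * fs_christoffel z p a b"])
  then have *: "Ric fs_metric z $ a $ b = (\<Sum>c\<in>UNIV. fs_christoffel_deriv z c c a b)
      - (\<Sum>c\<in>UNIV. \<Sum>p\<in>UNIV. fs_christoffel z c a p * fs_christoffel z p c b)" for a b
    by (simp add: fs_christoffel_trace fs_christoffel_deriv_trace)
  show ?thesis
    by (rule matrix_eqI_Plus)
      (simp_all add: * sum_UNIV_Plus fs_christoffel_deriv_def fs_christoffel_def delta_sums
        distrib_left distrib_right left_diff_distrib right_diff_distrib)
qed

section \<open>The conformal circle equation\<close>

text \<open>The scalar curvature is left unevaluated and the factor may vary with the point: only
  proportionality to \<open>g\<close> enters the tractor computation.\<close>

lemma Schouten_fs_metric:
  obtains k where "\<And>z :: 'n::finite coords. Schouten fs_metric z = k z *\<^sub>R fs_metric z"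
proof
  show "Schouten fs_metric z = (1 / (real CARD('n + 'n) - 2) * (- (real CARD('n) + 1)
      - Scal fs_metric z / (2 * (real CARD('n + 'n) - 1)))) *\<^sub>R fs_metric z" for z :: "'n coords"
    unfolding Schouten_def Ric_fs_metric scaleR_left_diff_distrib[symmetric] scaleR_scaleR ..
qed

lemma Schouten_sharp_fs_metric:
  assumes "Schouten fs_metric z = k *\<^sub>R fs_metric z"
  shows "Schouten_sharp fs_metric z v = k *\<^sub>R v"
proof -
  have "Schouten_sharp fs_metric z v = k *\<^sub>R (fs_metric_inv z *v (fs_metric z *v v))"
    unfolding Schouten_sharp_def assms matrix_inv_fs_metric scaleR_matrix_vector_assoc[symmetric]
    by (rule matrix_vector_mult_scaleR)
  then show ?thesis by (simp add: matrix_vector_mul_assoc fs_metric_inv_mult)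
qed

text \<open>The Christoffel symbols as an index-free bilinear map: the covariant derivative of
  \<open>w\<close> along a curve with velocity \<open>v\<close> is
  \<open>w' + Gam z v w\<close>.\<close>

definition Gam :: "'n::finite coords \<Rightarrow> 'n coords \<Rightarrow> 'n coords \<Rightarrow> 'n coords" where
  "Gam z v w = (let y = ypart z; s = y \<bullet> xpart v; r = y \<bullet> xpart w in
     join (s *\<^sub>R xpart w + r *\<^sub>R xpart v)
       ((4 * s * r - xpart v \<bullet> ypart w - ypart v \<bullet> xpart w) *\<^sub>R y - s *\<^sub>R ypart w - r *\<^sub>R ypart v))"

lemma Gam_zero [simp]: "Gam z v 0 = 0"
  by (simp add: Gam_def Let_def coords_eqI)

lemma Gam_scale: "Gam z v (c *\<^sub>R w) = c *\<^sub>R Gam z v w"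
  by (rule coords_eqI) (simp_all add: Gam_def Let_def algebra_simps)

lemma Gam_add: "Gam z v (w + w') = Gam z v w + Gam z v w'"
  by (rule coords_eqI) (simp_all add: Gam_def Let_def algebra_simps)

lemma cov_deriv_fs_metric:
  "cov_deriv fs_metric \<gamma> \<mu> t = velocity \<mu> t + Gam (\<gamma> t) (velocity \<gamma> t) (\<mu> t)"
proof -
  have "(\<chi> k. \<Sum>i\<in>UNIV. \<Sum>j\<in>UNIV. fs_christoffel z k i j * v $ i * w $ j) = Gam z v w" for z v w :: "'n::finite coords"
  proof (rule coords_eqI; rule vec_eq_iff[THEN iffD2]; intro allI)
    fix k
    show "xpart (\<chi> k. \<Sum>i\<in>UNIV. \<Sum>j\<in>UNIV. fs_christoffel z k i j * v $ i * w $ j) $ k = xpart (Gam z v w) $ k"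
      by (simp add: sum_UNIV_Plus fs_christoffel_def Gam_def Let_def delta_sums inner_vec_def
        sum_distrib_left sum_distrib_right distrib_left distrib_right mult_ac)
    show "ypart (\<chi> k. \<Sum>i\<in>UNIV. \<Sum>j\<in>UNIV. fs_christoffel z k i j * v $ i * w $ j) $ k = ypart (Gam z v w) $ k"
      by (simp add: sum_UNIV_Plus fs_christoffel_def Gam_def Let_def delta_sums inner_vec_def sum_product
        sum_distrib_left sum_distrib_right distrib_left distrib_right left_diff_distrib right_diff_distrib mult_ac)
        (subst sum.swap, simp add: mult_ac)
  qed
  then show ?thesis unfolding cov_deriv_def christoffel_fs by simp
qed

lemma bounded_linear_xpart: "bounded_linear xpart" and bounded_linear_ypart: "bounded_linear ypart"
  by (auto intro!: linear_conv_bounded_linear[THEN iffD1] linearI)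

text \<open>Metric compatibility of the Levi-Civita connection: \<open>DV\<close> and
  \<open>DW\<close> are the covariant derivatives of \<open>V\<close> and \<open>W\<close> along the
  curve.\<close>

lemma has_vector_derivative_ip_fs_metric:
  assumes x: "(x has_vector_derivative v) (at t)"
    and V: "(V has_vector_derivative DV - Gam (x t) v (V t)) (at t)"
    and W: "(W has_vector_derivative DW - Gam (x t) v (W t)) (at t)"
  shows "((\<lambda>s. ip fs_metric (x s) (V s) (W s)) has_real_derivative
     ip fs_metric (x t) DV (W t) + ip fs_metric (x t) (V t) DW) (at t)"
proof -
  note lin = bounded_linear.has_vector_derivative[OF bounded_linear_xpart]
    bounded_linear.has_vector_derivative[OF bounded_linear_ypart]
  note inn = bounded_bilinear.has_vector_derivative[OF bounded_bilinear_inner]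
  note inns = inn[OF lin(1)[OF V] lin(2)[OF W]] inn[OF lin(2)[OF V] lin(1)[OF W]]
    inn[OF lin(2)[OF x] lin(1)[OF V]] inn[OF lin(2)[OF x] lin(1)[OF W]]
  note D = inns[folded has_real_derivative_iff_has_vector_derivative]
  show ?thesis unfolding ip_fs_metric
    by (rule DERIV_cong[OF DERIV_diff[OF DERIV_add[OF D(1,2)] DERIV_mult[OF DERIV_cmult[OF D(3)] D(4)]]])
      (simp add: Gam_def Let_def inner_add_left inner_add_right inner_diff_left inner_diff_right
        inner_commute algebra_simps)
qed

text \<open>The row vector \<open>?y\<close> records the linear relation and annihilates the matrix
  from the left. Its last entry is -1, so it is nonzero and the matrix is singular.\<close>

lemma wedge4_eq_0:
  assumes "v4 = c1 *\<^sub>R v1 + c2 *\<^sub>R v2"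
  shows "wedge4 v1 v2 v3 v4 = (\<lambda>b. 0)"
proof
  fix b
  let ?M = "(\<chi> i j. (vector [v1, v2, v3, v4] :: 'a^4) $ i \<bullet> b $ j) :: real^4^4"
  let ?y = "vector [c1, c2, 0, -1] :: real^4"
  have v4: "(vector [a, a', a'', a'''] :: 'b::zero^4) $ 1 = a" "(vector [a, a', a'', a'''] :: 'b^4) $ 2 = a'"
    "(vector [a, a', a'', a'''] :: 'b^4) $ 3 = a''" "(vector [a, a', a'', a'''] :: 'b^4) $ 4 = a'''"
    for a a' a'' a''' by (simp_all add: vector_def)
  have y: "?y v* ?M = 0"
    unfolding vec_eq_iff vector_matrix_mult_def
    by (simp add: sum_4 v4 assms inner_add_left)
  show "wedge4 v1 v2 v3 v4 b = 0"
  proof (rule ccontr)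
    assume "wedge4 v1 v2 v3 v4 b \<noteq> 0"
    then have "invertible ?M" unfolding wedge4_def by (simp add: invertible_det_nz)
    then obtain B where "?M ** B = mat 1" unfolding invertible_def by blast
    then have "?y = (?y v* ?M) v* B" by (simp add: vector_matrix_mul_assoc)
    then have "?y = 0" unfolding y by simp
    then have "?y $ 4 = 0" by simp
    then show False by (simp add: v4)
  qed
qed

lemma ip_fs_metric_linear:
  "ip fs_metric z v (w + w') = ip fs_metric z v w + ip fs_metric z v w'"
  "ip fs_metric z v (c *\<^sub>R w) = c * ip fs_metric z v w"
  "ip fs_metric z (c *\<^sub>R v) w = c * ip fs_metric z v w"
  "ip fs_metric z (v + v') w = ip fs_metric z v w + ip fs_metric z v' w"
  "ip fs_metric z v w = ip fs_metric z w v"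
  "ip fs_metric z v 0 = 0" "ip fs_metric z 0 v = 0"
  by (simp_all add: ip_fs_metric inner_add_left inner_add_right inner_commute algebra_simps)

lemma velocity_eqI:
  assumes "open T" "t \<in> T" "\<And>s. s \<in> T \<Longrightarrow> f s = g s" "(g has_vector_derivative D) (at t)"
  shows "velocity f t = D"
  using has_vector_derivative_transform_within_open[OF assms(4,1,2)] assms(3)
  by (simp add: vector_derivative_at)

text \<open>Here \<open>A\<close> and \<open>J\<close> are the covariant derivatives of
  \<open>v\<close> and \<open>A\<close>. With \<open>r = 1/u\<close> one has
  \<open>r' = - r g(v,A) / g(v,v)\<close>. In the middle slot of the last tractor the equation
  replaces \<open>r J\<close> by a multiple of \<open>A\<close> that cancels \<open>3 r' A\<close>,
  and the bottom slot cancels for the same reason. What remains is a combination of the first two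
  tractors, \<open>X\<close> supplying any top slot.\<close>

lemma conformal_circle_onI:
  fixes x :: "real \<Rightarrow> 'n::finite coords"
  assumes T: "open T" and x: "smooth_on T x"
    and v: "\<And>t. t \<in> T \<Longrightarrow> (x has_vector_derivative v t) (at t)"
    and A: "\<And>t. t \<in> T \<Longrightarrow> (v has_vector_derivative A t - Gam (x t) (v t) (v t)) (at t)"
    and J: "\<And>t. t \<in> T \<Longrightarrow> (A has_vector_derivative J t - Gam (x t) (v t) (A t)) (at t)"
    and G: "\<And>t. t \<in> T \<Longrightarrow> ip fs_metric (x t) (v t) (v t) \<noteq> 0"
    and circle: "\<And>t. t \<in> T \<Longrightarrow> \<exists>l. ip fs_metric (x t) (v t) (v t) *\<^sub>R J t
       = (3 * ip fs_metric (x t) (v t) (A t)) *\<^sub>R A t + l *\<^sub>R v t"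
  shows "conformal_circle_on fs_metric T x"
proof -
  obtain k where k: "\<And>z :: 'n coords. Schouten fs_metric z = k z *\<^sub>R fs_metric z"
    using Schouten_fs_metric by blast
  note sharp = Schouten_sharp_fs_metric[OF k]
  have ipP: "ip (Schouten fs_metric) z a b = k z * ip fs_metric z a b" for z a b
    unfolding ip_def k by (simp add: sum_distrib_left mult.assoc)
  have vel: "velocity x t = v t" if "t \<in> T" for t using v[OF that] by (rule vector_derivative_at)
  define g where "g t = ip fs_metric (x t) (v t) (v t)" for t
  define b where "b t = ip fs_metric (x t) (v t) (A t)" for t
  define b' where "b' t = ip fs_metric (x t) (A t) (A t) + ip fs_metric (x t) (v t) (J t)" for t
  have g': "(g has_real_derivative 2 * b t) (at t)" if "t \<in> T" for t
    using has_vector_derivative_ip_fs_metric[OF v[OF that] A[OF that] A[OF that]]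
    unfolding g_def b_def by (simp add: ip_fs_metric_linear(5)[of _ "A t"])
  have b': "(b has_real_derivative b' t) (at t)" if "t \<in> T" for t
    using has_vector_derivative_ip_fs_metric[OF v[OF that] A[OF that] J[OF that]]
    unfolding b_def b'_def .
  have g0: "g t \<noteq> 0" if "t \<in> T" for t using G[OF that] by (simp add: g_def)
  define r where "r t = 1 / sqrt \<bar>g t\<bar>" for t
  define r1 where "r1 t = - r t * b t / g t" for t
  have r0: "r t \<noteq> 0" if "t \<in> T" for t using g0[OF that] by (simp add: r_def)
  have r': "(r has_real_derivative r1 t) (at t)" if t: "t \<in> T" for t
  proof -
    have s: "sqrt \<bar>g t\<bar> * sqrt \<bar>g t\<bar> = \<bar>g t\<bar>" by simp
    have a: "((\<lambda>s. \<bar>g s\<bar>) has_real_derivative sgn (g t) * (2 * b t)) (at t)"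
    proof -
      \<comment> \<open>Writing the absolute value as the root of a square treats both signs of
        \<open>g\<close> together.\<close>
      have "((\<lambda>s. sqrt (g s * g s)) has_real_derivative
          inverse (sqrt (g t * g t)) / 2 * (2 * b t * g t + 2 * b t * g t)) (at t)"
        by (rule DERIV_chain2[OF DERIV_real_sqrt DERIV_mult[OF g'[OF t] g'[OF t]]])
          (use g0[OF t] in \<open>auto simp: zero_less_mult_iff linorder_neq_iff\<close>)
      then show ?thesis
        unfolding real_sqrt_abs2
        by (rule DERIV_cong) (use g0[OF t] in \<open>simp add: sgn_if abs_if field_simps\<close>)
    qed
    have "((\<lambda>s. sqrt \<bar>g s\<bar>) has_real_derivative inverse (sqrt \<bar>g t\<bar>) / 2 * (sgn (g t) * (2 * b t))) (at t)"
      by (rule DERIV_chain2[OF DERIV_real_sqrt a]) (use g0[OF t] in simp)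
    from DERIV_divide[OF DERIV_const[of 1] this] g0[OF t]
    have "(r has_real_derivative - (inverse (sqrt \<bar>g t\<bar>) / 2 * (sgn (g t) * (2 * b t))) / (sqrt \<bar>g t\<bar> * sqrt \<bar>g t\<bar>)) (at t)"
      unfolding r_def[abs_def] by simp
    then show ?thesis
      by (rule DERIV_cong) (use g0[OF t] in \<open>auto simp: s r1_def r_def sgn_if abs_if field_simps\<close>)
  qed
  define r2 where "r2 t = (- (r1 t * b t + r t * b' t) * g t + r t * b t * (2 * b t)) / (g t * g t)" for t
  have r1': "(r1 has_real_derivative r2 t) (at t)" if t: "t \<in> T" for t
    unfolding r1_def[abs_def]
    by (rule DERIV_cong[OF DERIV_divide[OF DERIV_mult[OF DERIV_minus[OF r'[OF t]] b'[OF t]] g'[OF t] g0[OF t]]])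
      (simp add: r2_def algebra_simps r1_def)
  note hvd = has_real_derivative_iff_has_vector_derivative[THEN iffD1]
  have X: "tractor_X fs_metric x t = (r t, 0, 0)" if "t \<in> T" for t
    unfolding tractor_X_def vel[OF that] r_def g_def ..
  have U: "tractor_U fs_metric x t = (r1 t, r t *\<^sub>R v t, 0)" if t: "t \<in> T" for t
  proof -
    have 1: "velocity (\<lambda>s. fst (tractor_X fs_metric x s)) t = r1 t"
      by (rule velocity_eqI[OF T t _ hvd[OF r'[OF t]]]) (simp add: X)
    have 2: "(\<lambda>s. fst (snd (tractor_X fs_metric x s))) = (\<lambda>s. 0)" "(\<lambda>s. snd (snd (tractor_X fs_metric x s))) = (\<lambda>s. 0)"
      by (auto simp: tractor_X_def)
    show ?thesis unfolding tractor_U_def tractor_deriv_def Let_def cov_deriv_fs_metric 1 2 ipP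
      by (simp add: vel t X ip_fs_metric_linear)
  qed
  \<comment> \<open>The top slot of \<open>A\<close> reaches the next middle slot only as a
    coefficient of the velocity, so its value is not computed.\<close>
  define al where "al t = fst (tractor_A fs_metric x t)" for t
  have A2: "tractor_A fs_metric x t = (al t, r t *\<^sub>R A t + (2 * r1 t) *\<^sub>R v t, - r t * g t)" if t: "t \<in> T" for t
  proof -
    have 1: "velocity (\<lambda>s. snd (snd (tractor_U fs_metric x s))) t = 0"
      by (rule velocity_eqI[OF T t]) (auto simp: U)
    have 2: "velocity (\<lambda>s. fst (snd (tractor_U fs_metric x s))) t
        = r t *\<^sub>R (A t - Gam (x t) (v t) (v t)) + r1 t *\<^sub>R v t"
      by (rule velocity_eqI[OF T t _ has_vector_derivative_scaleR[OF r'[OF t] A[OF t]]]) (simp add: U)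
    show ?thesis unfolding al_def
      unfolding tractor_A_def tractor_deriv_def Let_def cov_deriv_fs_metric 1 2
      by (simp add: vel t U ip_fs_metric_linear g_def Gam_scale) (simp add: vec_eq_iff algebra_simps)
  qed
  have "wedge4 (tractor_X fs_metric x t) (tractor_U fs_metric x t) (tractor_A fs_metric x t)
          (tractor_deriv fs_metric x (tractor_A fs_metric x) t) = (\<lambda>b. 0)" if t: "t \<in> T" for t
  proof -
    have 1: "velocity (\<lambda>s. snd (snd (tractor_A fs_metric x s))) t = - r1 t * g t - r t * (2 * b t)"
      by (rule velocity_eqI[OF T t _ hvd[OF DERIV_cong[OF DERIV_mult[OF DERIV_minus[OF r'[OF t]] g'[OF t]]]]])
        (simp_all add: A2)
    have 2: "velocity (\<lambda>s. fst (snd (tractor_A fs_metric x s))) t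
        = (r t *\<^sub>R (J t - Gam (x t) (v t) (A t)) + r1 t *\<^sub>R A t)
          + ((2 * r1 t) *\<^sub>R (A t - Gam (x t) (v t) (v t)) + (2 * r2 t) *\<^sub>R v t)"
      by (rule velocity_eqI[OF T t _ has_vector_derivative_add[OF
          has_vector_derivative_scaleR[OF r'[OF t] J[OF t]]
          has_vector_derivative_scaleR[OF DERIV_cmult[OF r1'[OF t]] A[OF t]]]]) (simp add: A2)
    obtain l where l: "g t *\<^sub>R J t = (3 * b t) *\<^sub>R A t + l *\<^sub>R v t"
      using circle[OF t] unfolding g_def b_def by blast
    have J': "J t = (3 * b t / g t) *\<^sub>R A t + (l / g t) *\<^sub>R v t"
    proof -
      have "J t = (1 / g t) *\<^sub>R (g t *\<^sub>R J t)" using g0[OF t] by simp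
      then show ?thesis unfolding l by (simp add: scaleR_add_right)
    qed
    define be where "be = fst (tractor_deriv fs_metric x (tractor_A fs_metric x) t)"
    \<comment> \<open>All multiples of the velocity are collected: from the equation, from the
      second derivative of \<open>r\<close>, from the top slot of \<open>A\<close> and from the
      Schouten tensor.\<close>
    define ka where "ka = r t * (l / g t) + 2 * r2 t + al t + - r t * g t * k (x t)"
    have "snd (tractor_deriv fs_metric x (tractor_A fs_metric x) t) = (ka *\<^sub>R v t, 0)"
      unfolding tractor_deriv_def Let_def cov_deriv_fs_metric 1 2 sharp J'
      apply (simp add: vel t A2 ip_fs_metric_linear(1-4) g_def[symmetric] b_def[symmetric] Gam_add Gam_scale ka_def)
      apply (rule conjI)
       apply (use g0[OF t] in \<open>simp add: r1_def vec_eq_iff algebra_simps\<close>)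
      apply (use g0[OF t] in \<open>simp add: r1_def algebra_simps\<close>)
      done
    then have D: "tractor_deriv fs_metric x (tractor_A fs_metric x) t = (be, ka *\<^sub>R v t, 0)"
      unfolding be_def by (metis prod.collapse)
    have "(be, ka *\<^sub>R v t, 0) = ((be - ka / r t * r1 t) / r t) *\<^sub>R (r t, 0, 0)
        + (ka / r t) *\<^sub>R (r1 t, r t *\<^sub>R v t, 0)"
      using r0[OF t] by simp
    then show ?thesis unfolding D X[OF t] U[OF t] by (rule wedge4_eq_0)
  qed
  then show ?thesis unfolding conformal_circle_on_def using x G vel by simp
qed

section \<open>The embedding into rank-one projections\<close>

definition outer :: "real^'m::finite \<Rightarrow> real^'m \<Rightarrow> real^'m^'m" where
  "outer a b = (\<chi> i j. a $ i * b $ j)"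

lemma outer_nth [simp]: "outer a b $ i $ j = a $ i * b $ j" by (simp add: outer_def)

lemma outer_linear:
  "outer (a + b) c = outer a c + outer b c" "outer a (b + c) = outer a b + outer a c"
  "outer (a - b) c = outer a c - outer b c" "outer a (b - c) = outer a b - outer a c"
  "outer (r *\<^sub>R a) c = r *\<^sub>R outer a c" "outer a (r *\<^sub>R c) = r *\<^sub>R outer a c"
  "outer 0 a = 0" "outer a 0 = 0" "outer (- a) c = - outer a c" "outer a (- c) = - outer a c"
  by (simp_all add: vec_eq_iff algebra_simps)

lemma outer_mult: "outer a b ** outer c d = (b \<bullet> c) *\<^sub>R outer a d"
  and mult_outer: "A ** outer a b = outer (A *v a) b"
  and outer_mult_right: "outer a b ** A = outer a (b v* A)"
  and outer_vec: "outer a b *v c = (b \<bullet> c) *\<^sub>R a"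
  and vec_outer: "c v* outer a b = (c \<bullet> a) *\<^sub>R b"
  by (simp_all add: vec_eq_iff matrix_matrix_mult_def matrix_vector_mult_def vector_matrix_mult_def inner_vec_def
      sum_distrib_left sum_distrib_right mult_ac)

lemma trace_outer: "trace (outer a b) = a \<bullet> b"
  by (simp add: trace_def inner_vec_def)

lemma trace_scaleR: "trace (c *\<^sub>R A) = c * trace A" for A :: "real^'m^'m"
  by (simp add: trace_def sum_distrib_left)

lemma bounded_bilinear_outer: "bounded_bilinear outer"
  unfolding bilinear_conv_bounded_bilinear[symmetric] bilinear_def
  by (auto intro!: linearI simp: outer_linear)

lemma matrix_scaleR_left: "(k *\<^sub>R A) ** B = k *\<^sub>R (A ** B)"
  and matrix_scaleR_right: "A ** (k *\<^sub>R B) = k *\<^sub>R (A ** B)" for A :: "real^'m^'m"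
  by (simp_all add: vec_eq_iff matrix_matrix_mult_def sum_distrib_left mult_ac)

lemma matrix_add_rdistrib: "(A + B) ** C = A ** C + B ** C" for A :: "real^'m^'m"
  by (simp add: vec_eq_iff matrix_matrix_mult_def algebra_simps sum.distrib)

lemma matrix_diff_left: "(A - B) ** C = A ** C - B ** C"
  and matrix_diff_right: "C ** (A - B) = C ** A - C ** B" for A :: "real^'m^'m"
  by (simp_all add: vec_eq_iff matrix_matrix_mult_def algebra_simps sum_subtractf)

lemmas matrix_algebra = matrix_add_ldistrib matrix_add_rdistrib matrix_scaleR_left matrix_scaleR_right
  matrix_diff_left matrix_diff_right

section \<open>Column and row vectors of the embedding\<close>

lemma sum_UNIV_option: "(\<Sum>a\<in>UNIV. f a) = f None + (\<Sum>i\<in>UNIV. f (Some i))"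
  for f :: "'n::finite option \<Rightarrow> 'c::comm_monoid_add"
  unfolding UNIV_option_conv by (simp add: sum.reindex)

definition emb :: "real \<Rightarrow> real^'n \<Rightarrow> real^('n::finite option)" where
  "emb r u = (\<chi> a. case a of None \<Rightarrow> r | Some i \<Rightarrow> u $ i)"

lemma emb_nth [simp]: "emb r u $ None = r" "emb r u $ Some i = u $ i" by (simp_all add: emb_def)

lemma vec_option_eqI: "a $ None = b $ None \<Longrightarrow> (\<And>i. a $ Some i = b $ Some i) \<Longrightarrow> a = b"
  unfolding vec_eq_iff by (metis option.exhaust)

lemma emb_linear:
  "emb r u + emb s w = emb (r + s) (u + w)" "emb r u - emb s w = emb (r - s) (u - w)"
  "k *\<^sub>R emb r u = emb (k * r) (k *\<^sub>R u)" "- emb r u = emb (- r) (- u)" "emb 0 0 = 0"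
  by (auto intro!: vec_option_eqI)

lemma inner_emb [simp]: "emb r u \<bullet> emb s w = r * s + u \<bullet> w"
  by (simp add: inner_vec_def sum_UNIV_option)

lemma has_vector_derivative_emb:
  assumes "(f has_real_derivative f') (at t)" "(g has_vector_derivative g') (at t)"
  shows "((\<lambda>s. emb (f s) (g s)) has_vector_derivative emb f' g') (at t)"
proof -
  have l: "bounded_linear (\<lambda>r. emb r (0::real^'n))" "bounded_linear (\<lambda>u::real^'n. emb 0 u)"
    by (auto intro!: linear_conv_bounded_linear[THEN iffD1] linearI simp: emb_linear)
  have "((\<lambda>s. emb (f s) 0 + emb 0 (g s)) has_vector_derivative emb f' 0 + emb 0 g') (at t)"
    using assms unfolding has_real_derivative_iff_has_vector_derivative
    by (intro has_vector_derivative_add bounded_linear.has_vector_derivative[OF l(1)]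
        bounded_linear.has_vector_derivative[OF l(2)])
  then show ?thesis by (simp add: emb_linear)
qed

text \<open>\<open>pvec\<close> is the \<open>None\<close> column of
  \<open>lower_mat z ** upper_mat z\<close>, and \<open>qvec\<close> below is the
  \<open>None\<close> row of its inverse.\<close>

definition pvec :: "'n::finite coords \<Rightarrow> real^('n option)" where
  "pvec z = emb 1 (xpart z)"
definition qvec :: "'n::finite coords \<Rightarrow> real^('n option)" where
  "qvec z = emb (1 + xpart z \<bullet> ypart z) (- ypart z)"
definition Phi :: "'n::finite coords \<Rightarrow> 'n mat_K" where
  "Phi z = outer (pvec z) (qvec z)"
text \<open>\<open>xi\<close> and \<open>eta\<close> are the derivatives of \<open>pvec\<close> and
  \<open>qvec\<close> along \<open>v\<close>, shifted by opposite multiples of \<open>pvec\<close>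
  and \<open>qvec\<close>. The shifts cancel in \<open>dPhi\<close> and give the relations in
  \<open>frame_inner\<close>.\<close>

definition xi :: "'n::finite coords \<Rightarrow> 'n coords \<Rightarrow> real^('n option)" where
  "xi z v = emb (ypart z \<bullet> xpart v) (xpart v + (ypart z \<bullet> xpart v) *\<^sub>R xpart z)"
definition eta :: "'n::finite coords \<Rightarrow> 'n coords \<Rightarrow> real^('n option)" where
  "eta z v = (let w = ypart v - (ypart z \<bullet> xpart v) *\<^sub>R ypart z in emb (xpart z \<bullet> w) (- w))"
definition dPhi :: "'n::finite coords \<Rightarrow> 'n coords \<Rightarrow> 'n mat_K" where
  "dPhi z v = outer (xi z v) (qvec z) + outer (pvec z) (eta z v)"

lemma frame_inner [simp]:
  "qvec z \<bullet> pvec z = 1" "qvec z \<bullet> xi z v = 0" "eta z v \<bullet> pvec z = 0"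
  by (simp_all add: pvec_def qvec_def xi_def eta_def Let_def inner_add_left inner_add_right inner_diff_left inner_diff_right
      inner_commute algebra_simps)

text \<open>The pairing of \<open>eta\<close> with \<open>xi\<close>. Its symmetric part is the
  metric up to a factor; its antisymmetric part is the form \<open>\<omega>\<close> up to a
  factor.\<close>

definition bet :: "'n::finite coords \<Rightarrow> 'n coords \<Rightarrow> 'n coords \<Rightarrow> real" where
  "bet z v w = (ypart z \<bullet> xpart v) * (ypart z \<bullet> xpart w) - ypart v \<bullet> xpart w"

lemma eta_xi: "eta z v \<bullet> xi z w = bet z v w"
  by (simp add: xi_def eta_def bet_def Let_def inner_add_left inner_add_right inner_diff_left inner_diff_right
      inner_commute algebra_simps)

lemma ip_bet: "ip fs_metric z v w = - (bet z v w + bet z w v)"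
  by (simp add: ip_fs_metric bet_def inner_commute)

text \<open>A trace formula in \<open>Phi\<close> and \<open>dPhi\<close> alone exhibits
  \<open>bet\<close> as a conjugation invariant.\<close>

lemma trace_Phi_dPhi: "trace (Phi z ** (dPhi z v ** dPhi z w)) = bet z v w"
  by (simp add: Phi_def dPhi_def matrix_algebra outer_mult eta_xi trace_add trace_scaleR trace_outer inner_commute[of "pvec z"])

text \<open>An explicit left inverse of \<open>dPhi z\<close>. It makes tangent vectors that are
  known only through their matrices depend continuously on parameters.\<close>

definition recov :: "'n::finite coords \<Rightarrow> 'n mat_K \<Rightarrow> 'n coords" where
  "recov z N = join (\<chi> i. (N *v pvec z) $ Some i - (N *v pvec z) $ None * z $ Inl i) (\<chi> j. - N $ None $ Some j)"

lemma recov_dPhi: "recov z (dPhi z v) = v"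
proof -
  have "dPhi z v *v pvec z = xi z v"
    by (simp add: dPhi_def matrix_vector_mult_add_rdistrib outer_vec)
  moreover have "dPhi z v $ None $ Some j = - v $ Inr j" for j
    by (simp add: dPhi_def xi_def eta_def Let_def pvec_def qvec_def)
  ultimately show ?thesis
    by (intro coords_eqI) (simp_all add: recov_def vec_eq_iff xi_def algebra_simps)
qed

lemma dPhi_inject: "dPhi z v = dPhi z w \<longleftrightarrow> v = w"
  by (metis recov_dPhi)

text \<open>Since the \<open>None\<close> entry of \<open>pvec\<close> is 1, the \<open>None\<close>
  row of the projection is \<open>qvec\<close>, which shows \<open>ypart\<close>; the image of the
  projection is the line of \<open>pvec\<close>, normalized by that entry.\<close>

lemma Phi_inject: "Phi z = Phi w \<Longrightarrow> z = w"
proof -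
  assume e: "Phi z = Phi w"
  have y: "ypart z = ypart w"
    unfolding vec_eq_iff
  proof
    fix i
    have "Phi z $ None $ Some i = Phi w $ None $ Some i" using e by simp
    then show "ypart z $ i = ypart w $ i" by (simp add: Phi_def pvec_def qvec_def)
  qed
  have c: "Phi z $ a $ b = Phi w $ a $ b" for a b using e by simp
  have "pvec z = Phi z *v pvec z" by (simp add: Phi_def outer_vec)
  also have "\<dots> = (qvec w \<bullet> pvec z) *\<^sub>R pvec w" unfolding e by (simp add: Phi_def outer_vec)
  finally have p: "pvec z = (qvec w \<bullet> pvec z) *\<^sub>R pvec w" .
  then have "pvec z $ None = ((qvec w \<bullet> pvec z) *\<^sub>R pvec w) $ None" by simp
  then have "qvec w \<bullet> pvec z = 1" by (simp add: pvec_def)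
  with p have "pvec z = pvec w" by simp
  then have "pvec z $ Some i = pvec w $ Some i" for i by simp
  then have "xpart z = xpart w" by (simp add: pvec_def vec_eq_iff)
  then show "z = w" using y by (rule coords_eqI)
qed

definition dpvec :: "'n::finite coords \<Rightarrow> real^('n option)" where "dpvec v = emb 0 (xpart v)"
definition dqvec :: "'n::finite coords \<Rightarrow> 'n coords \<Rightarrow> real^('n option)" where
  "dqvec z v = emb (xpart v \<bullet> ypart z + xpart z \<bullet> ypart v) (- ypart v)"

lemma dPhi_eq: "dPhi z v = outer (dpvec v) (qvec z) + outer (pvec z) (dqvec z v)"
proof -
  let ?s = "ypart z \<bullet> xpart v"
  have "xi z v = dpvec v + ?s *\<^sub>R pvec z"
    by (simp add: xi_def dpvec_def pvec_def emb_linear)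
  moreover have "eta z v = dqvec z v - ?s *\<^sub>R qvec z"
    by (rule vec_option_eqI)
      (simp_all add: eta_def dqvec_def qvec_def Let_def inner_diff_right inner_commute algebra_simps)
  ultimately show ?thesis by (simp add: dPhi_def outer_linear)
qed

section \<open>First and second derivatives of the embedding along curves\<close>

lemma has_vector_derivative_inner:
  fixes f g :: "real \<Rightarrow> 'a::real_inner"
  assumes "(f has_vector_derivative f') (at t)" "(g has_vector_derivative g') (at t)"
  shows "((\<lambda>s. f s \<bullet> g s) has_real_derivative f t \<bullet> g' + f' \<bullet> g t) (at t)"
  unfolding has_real_derivative_iff_has_vector_derivative
  by (rule bounded_bilinear.has_vector_derivative[OF bounded_bilinear_inner assms])

lemmas parts_has_vector_derivative = bounded_linear.has_vector_derivative[OF bounded_linear_xpart]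
  bounded_linear.has_vector_derivative[OF bounded_linear_ypart]

lemma pvec_has_vector_derivative:
  assumes "(x has_vector_derivative v) (at t)"
  shows "((\<lambda>s. pvec (x s)) has_vector_derivative dpvec v) (at t)"
  unfolding pvec_def dpvec_def
  by (intro has_vector_derivative_emb DERIV_const parts_has_vector_derivative assms)

lemma dpvec_has_vector_derivative:
  assumes "(x has_vector_derivative v) (at t)"
  shows "((\<lambda>s. dpvec (x s)) has_vector_derivative dpvec v) (at t)"
  unfolding dpvec_def
  by (intro has_vector_derivative_emb DERIV_const parts_has_vector_derivative assms)

lemma qvec_has_vector_derivative:
  assumes "(x has_vector_derivative v) (at t)"
  shows "((\<lambda>s. qvec (x s)) has_vector_derivative dqvec (x t) v) (at t)"
proof -
  have "((\<lambda>s. emb (1 + xpart (x s) \<bullet> ypart (x s)) (- ypart (x s))) has_vector_derivative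
    emb (0 + (xpart (x t) \<bullet> ypart v + xpart v \<bullet> ypart (x t))) (- ypart v)) (at t)"
    by (intro has_vector_derivative_emb DERIV_const DERIV_add has_vector_derivative_inner
        has_vector_derivative_minus parts_has_vector_derivative assms)
  then show ?thesis by (simp add: qvec_def dqvec_def add.commute)
qed

lemma dqvec_has_vector_derivative:
  assumes "(x has_vector_derivative v t) (at t)" "(v has_vector_derivative a) (at t)"
  shows "((\<lambda>s. dqvec (x s) (v s)) has_vector_derivative
    dqvec (x t) a + emb (2 * (xpart (v t) \<bullet> ypart (v t))) 0) (at t)"
proof -
  have "((\<lambda>s. emb (xpart (v s) \<bullet> ypart (x s) + xpart (x s) \<bullet> ypart (v s)) (- ypart (v s))) has_vector_derivative
    emb ((xpart (v t) \<bullet> ypart (v t) + xpart a \<bullet> ypart (x t)) + (xpart (x t) \<bullet> ypart a + xpart (v t) \<bullet> ypart (v t)))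
      (- ypart a)) (at t)"
    by (intro has_vector_derivative_emb DERIV_const DERIV_add has_vector_derivative_inner
        has_vector_derivative_minus parts_has_vector_derivative assms)
  then show ?thesis by (simp add: dqvec_def emb_linear algebra_simps)
qed

lemma Phi_has_vector_derivative:
  assumes "(x has_vector_derivative v) (at t)"
  shows "((\<lambda>s. Phi (x s)) has_vector_derivative dPhi (x t) v) (at t)"
  using bounded_bilinear.has_vector_derivative[OF bounded_bilinear_outer
      pvec_has_vector_derivative[OF assms] qvec_has_vector_derivative[OF assms]]
  by (simp add: Phi_def dPhi_eq add.commute)

text \<open>The flat second derivative along a curve. The \<open>emb\<close> term is the cross term
  in the second derivative of \<open>xpart z \<bullet> ypart z\<close>.\<close>

definition d2Phi :: "'n::finite coords \<Rightarrow> 'n coords \<Rightarrow> 'n coords \<Rightarrow> 'n mat_K" where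
  "d2Phi z v a = outer (dpvec a) (qvec z) + 2 *\<^sub>R outer (dpvec v) (dqvec z v)
     + outer (pvec z) (dqvec z a + emb (2 * (xpart v \<bullet> ypart v)) 0)"

lemma dPhi_has_vector_derivative:
  assumes "(x has_vector_derivative v t) (at t)" "(v has_vector_derivative a) (at t)"
  shows "((\<lambda>s. dPhi (x s) (v s)) has_vector_derivative d2Phi (x t) (v t) a) (at t)"
proof -
  note B = bounded_bilinear.has_vector_derivative[OF bounded_bilinear_outer]
  show ?thesis unfolding dPhi_eq
    by (rule has_vector_derivative_eq_rhs[OF has_vector_derivative_add[OF
        B[OF dpvec_has_vector_derivative[OF assms(2)] qvec_has_vector_derivative[OF assms(1)]]
        B[OF pvec_has_vector_derivative[OF assms(1)] dqvec_has_vector_derivative[OF assms]]]])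
      (simp add: d2Phi_def scaleR_2)
qed

text \<open>For a projection \<open>M\<close> this is \<open>M Z (1 - M) + (1 - M) Z M\<close>, the
  component of \<open>Z\<close> tangent to the manifold of projections.\<close>

definition tproj :: "real^'m^'m \<Rightarrow> real^'m^'m \<Rightarrow> real^'m::finite^'m" where
  "tproj M Z = M ** Z + Z ** M - 2 *\<^sub>R (M ** (Z ** M))"

lemma Gam_diag:
  "xpart (Gam z v v) = (2 * (ypart z \<bullet> xpart v)) *\<^sub>R xpart v"
  "ypart (Gam z v v) = (4 * (ypart z \<bullet> xpart v)^2 - 2 * (xpart v \<bullet> ypart v)) *\<^sub>R ypart z
     - (2 * (ypart z \<bullet> xpart v)) *\<^sub>R ypart v"
  by (simp_all add: Gam_def Let_def vec_eq_iff algebra_simps inner_commute power2_eq_square)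

lemma tproj_outer: "tproj (outer p q) (outer a b) =
   (q \<bullet> a) *\<^sub>R outer p b + (b \<bullet> p) *\<^sub>R outer a q - (2 * (q \<bullet> a) * (b \<bullet> p)) *\<^sub>R outer p q"
  by (simp add: tproj_def outer_mult matrix_algebra)

lemma tproj_linear: "tproj M (Y + Z) = tproj M Y + tproj M Z" "tproj M (c *\<^sub>R Z) = c *\<^sub>R tproj M Z"
  by (simp_all add: tproj_def matrix_algebra algebra_simps)

text \<open>The symmetric space is embedded as rank-one projections; its Levi-Civita connection is the tangential
  part of the flat one.\<close>

lemma tproj_d2Phi: "tproj (Phi z) (d2Phi z v a) = dPhi z (a + Gam z v v)"
proof -
  let ?s = "ypart z \<bullet> xpart v"
  have 1: "qvec z \<bullet> dpvec w = - (ypart z \<bullet> xpart w)" "dqvec z w \<bullet> pvec z = ypart z \<bullet> xpart w" for w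
    by (simp_all add: pvec_def qvec_def dpvec_def dqvec_def inner_commute)
  have 2: "emb r 0 \<bullet> pvec z = r" for r by (simp add: pvec_def)
  have 3: "dpvec (a + Gam z v v) = dpvec a + (2 * ?s) *\<^sub>R dpvec v"
    by (rule vec_option_eqI) (simp_all add: dpvec_def Gam_diag)
  have 4: "dqvec z (a + Gam z v v) = dqvec z a + emb (2 * (xpart v \<bullet> ypart v)) 0 - (2 * ?s) *\<^sub>R dqvec z v
      + (4 * ?s * ?s - 2 * (xpart v \<bullet> ypart v)) *\<^sub>R qvec z"
    by (rule vec_option_eqI) (simp_all add: dqvec_def qvec_def Gam_diag inner_add_left inner_add_right
      inner_diff_left inner_diff_right inner_commute power2_eq_square algebra_simps)
  show ?thesis
    unfolding d2Phi_def Phi_def tproj_linear tproj_outer dPhi_eq 3 4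
    by (simp add: 1 2 inner_add_left outer_linear) (simp add: vec_eq_iff algebra_simps)
qed

lemma conj_mult:
  fixes h h' :: "real^'m^'m"
  assumes "h' ** h = mat 1"
  shows "(h ** M ** h') ** (h ** Z ** h') = h ** (M ** Z) ** h'"
proof -
  have "(h ** M ** h') ** (h ** Z ** h') = h ** M ** (h' ** h) ** Z ** h'"
    by (simp add: matrix_mul_assoc)
  then show ?thesis by (simp add: assms matrix_mul_assoc)
qed

lemma bounded_linear_conj: "bounded_linear (\<lambda>Z. h ** Z ** h')" for h h' :: "real^'m^'m"
  by (auto intro!: linear_conv_bounded_linear[THEN iffD1] linearI simp: matrix_algebra)

lemma tproj_conj:
  fixes h h' :: "real^'m^'m"
  assumes "h' ** h = mat 1"
  shows "tproj (h ** M ** h') (h ** Z ** h') = h ** tproj M Z ** h'"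
  unfolding tproj_def conj_mult[OF assms] by (simp add: matrix_algebra)

lemma bet_conj:
  fixes h h' :: "'n::finite mat_K"
  assumes h: "h' ** h = mat 1" and "Phi x = h ** Phi w ** h'"
    "dPhi x v = h ** dPhi w u ** h'" "dPhi x v' = h ** dPhi w u' ** h'"
  shows "bet x v v' = bet w u u'"
proof -
  have "trace (h ** A ** h') = trace A" for A
    by (subst trace_mul_sym) (simp add: matrix_mul_assoc h)
  then show ?thesis unfolding trace_Phi_dPhi[symmetric] assms conj_mult[OF h] by blast
qed

text \<open>Differentiating the relation between the projections once gives the first claim.
  Differentiating again and taking tangential parts, which commutes with conjugation, gives the
  second: covariant acceleration transforms like velocity.\<close>

lemma jet_transform:
  fixes x w :: "real \<Rightarrow> 'n::finite coords"
  assumes S: "open S" "t \<in> S" and h: "h' ** h = mat 1"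
    and eq: "\<And>s. s \<in> S \<Longrightarrow> Phi (x s) = h ** Phi (w s) ** h'"
    and x: "\<And>s. s \<in> S \<Longrightarrow> (x has_vector_derivative v s) (at s)" "(v has_vector_derivative a) (at t)"
    and w: "\<And>s. s \<in> S \<Longrightarrow> (w has_vector_derivative u s) (at s)" "(u has_vector_derivative b) (at t)"
  shows "dPhi (x t) (v t) = h ** dPhi (w t) (u t) ** h'"
    and "dPhi (x t) (a + Gam (x t) (v t) (v t)) = h ** dPhi (w t) (b + Gam (w t) (u t) (u t)) ** h'"
proof -
  note L = bounded_linear.has_vector_derivative[OF bounded_linear_conj]
  have 1: "dPhi (x s) (v s) = h ** dPhi (w s) (u s) ** h'" if s: "s \<in> S" for s
  proof -
    have "((\<lambda>s. Phi (x s)) has_vector_derivative h ** dPhi (w s) (u s) ** h') (at s)"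
      by (rule has_vector_derivative_transform_within_open[OF
            L[OF Phi_has_vector_derivative[OF w(1)[OF s]]] S(1) s]) (simp add: eq)
    then show ?thesis
      using Phi_has_vector_derivative[OF x(1)[OF s]] vector_derivative_unique_at by blast
  qed
  show "dPhi (x t) (v t) = h ** dPhi (w t) (u t) ** h'" by (rule 1[OF S(2)])
  have "((\<lambda>s. dPhi (x s) (v s)) has_vector_derivative h ** d2Phi (w t) (u t) b ** h') (at t)"
    by (rule has_vector_derivative_transform_within_open[OF
          L[OF dPhi_has_vector_derivative[OF w(1)[OF S(2)] w(2)]] S]) (simp add: 1)
  then have "d2Phi (x t) (v t) a = h ** d2Phi (w t) (u t) b ** h'"
    using dPhi_has_vector_derivative[OF x(1)[OF S(2)] x(2)] vector_derivative_unique_at by blast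
  then show "dPhi (x t) (a + Gam (x t) (v t) (v t)) = h ** dPhi (w t) (b + Gam (w t) (u t) (u t)) ** h'"
    unfolding tproj_d2Phi[symmetric] eq[OF S(2)] by (simp add: tproj_conj[OF h])
qed

section \<open>The action of \<open>K\<close>\<close>

lemma K_grp_inv:
  assumes "h \<in> K_grp"
  shows "h ** matrix_inv h = mat 1" "matrix_inv h ** h = mat 1" "matrix_inv h \<in> K_grp"
proof -
  have "invertible h" using assms by (simp add: K_grp_def invertible_det_nz)
  then obtain B where "h ** B = mat 1" unfolding invertible_def by blast
  then show 1: "h ** matrix_inv h = mat 1" using matrix_inv_eqI by metis
  then show "matrix_inv h ** h = mat 1" by (simp add: matrix_left_right_inverse)
  have "det (h ** matrix_inv h) = 1" unfolding 1 by simp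
  then show "matrix_inv h \<in> K_grp" using assms by (simp add: K_grp_def det_mul)
qed

lemma K_grp_mult: "g \<in> K_grp \<Longrightarrow> h \<in> K_grp \<Longrightarrow> g ** h \<in> K_grp"
  by (simp add: K_grp_def det_mul)

lemma matrix_inv_mult_K:
  assumes "g \<in> K_grp" "h \<in> K_grp"
  shows "matrix_inv (g ** h) = matrix_inv h ** matrix_inv g"
proof (rule matrix_inv_eqI)
  have "g ** h ** (matrix_inv h ** matrix_inv g) = g ** (h ** matrix_inv h) ** matrix_inv g"
    by (simp add: matrix_mul_assoc)
  then show "g ** h ** (matrix_inv h ** matrix_inv g) = mat 1" by (simp add: K_grp_inv assms)
qed

text \<open>Points \<open>g H\<close> are identified with the rank-one projections \<open>g E g\<^sup>-\<^sup>1\<close>, \<open>E\<close> being \<open>base_proj\<close>.\<close>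

definition base_proj :: "'n::finite mat_K" where "base_proj = outer (emb 1 0) (emb 1 0)"

text \<open>Commuting with the projection means preserving its image and its kernel, that is, being
  block diagonal. So \<open>H\<close> is the stabilizer of \<open>base_proj\<close> under
  conjugation.\<close>

lemma H_grp_iff: "A \<in> H_grp \<longleftrightarrow> A \<in> K_grp \<and> A ** base_proj = base_proj ** A"
proof -
  have "(A *v emb 1 0) $ i = A $ i $ None" "(emb 1 0 v* A) $ i = A $ None $ i" for i
    by (simp_all add: matrix_vector_mult_def vector_matrix_mult_def sum_UNIV_option)
  then have c: "A ** base_proj = base_proj ** A \<longleftrightarrow>
      (\<forall>i j. A $ i $ None * emb 1 0 $ j = emb 1 0 $ i * A $ None $ j)"
    unfolding base_proj_def mult_outer outer_mult_right by (simp add: vec_eq_iff)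
  have "A ** base_proj = base_proj ** A \<longleftrightarrow> (\<forall>i. A $ None $ Some i = 0 \<and> A $ Some i $ None = 0)"
    unfolding c split_option_all by auto
  then show ?thesis by (auto simp: H_grp_def)
qed

lemma H_grp_mult: "A \<in> H_grp \<Longrightarrow> B \<in> H_grp \<Longrightarrow> A ** B \<in> H_grp"
  unfolding H_grp_iff by (metis K_grp_mult matrix_mul_assoc)

lemma H_grp_inv: "A \<in> H_grp \<Longrightarrow> matrix_inv A \<in> H_grp"
proof -
  assume "A \<in> H_grp"
  then have A: "A \<in> K_grp" and c: "A ** base_proj = base_proj ** A" by (simp_all add: H_grp_iff)
  note i = K_grp_inv[OF A]
  have "matrix_inv A ** base_proj = matrix_inv A ** (base_proj ** A) ** matrix_inv A"
    by (simp add: matrix_mul_assoc[symmetric] i)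
  also have "\<dots> = base_proj ** matrix_inv A"
    unfolding c[symmetric] by (simp add: matrix_mul_assoc i)
  finally show ?thesis using i(3) by (simp add: H_grp_iff)
qed

lemma act_act: "act g (act h p) = act (g ** h) p"
  by (auto simp: act_def image_image matrix_mul_assoc)

lemma act_base_point_eq_iff:
  assumes g: "g \<in> K_grp" and g': "g' \<in> K_grp"
  shows "act g base_point = act g' base_point \<longleftrightarrow>
     g ** base_proj ** matrix_inv g = g' ** base_proj ** matrix_inv g'"
proof
  assume eq: "act g base_point = act g' base_point"
  have "mat 1 \<in> H_grp" by (simp add: H_grp_iff K_grp_def)
  then have "g' \<in> act g' base_point" unfolding act_def base_point_def by force
  then obtain A where A: "g' = g ** A" "A \<in> H_grp" using eq unfolding act_def base_point_def by auto
  then have AK: "A \<in> K_grp" "A ** base_proj = base_proj ** A" by (simp_all add: H_grp_iff)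
  have "g' ** base_proj ** matrix_inv g' = g ** (A ** base_proj) ** matrix_inv A ** matrix_inv g"
    unfolding A(1) matrix_inv_mult_K[OF g AK(1)] by (simp add: matrix_mul_assoc)
  also have "\<dots> = g ** base_proj ** (A ** matrix_inv A) ** matrix_inv g"
    unfolding AK(2) by (simp add: matrix_mul_assoc)
  finally show "g ** base_proj ** matrix_inv g = g' ** base_proj ** matrix_inv g'"
    by (simp add: K_grp_inv[OF AK(1)])
next
  note i = K_grp_inv[OF g] and i' = K_grp_inv[OF g']
  assume eq: "g ** base_proj ** matrix_inv g = g' ** base_proj ** matrix_inv g'"
  define B where "B = matrix_inv g ** g'"
  have "B ** base_proj = matrix_inv g ** (g' ** base_proj ** matrix_inv g') ** g'"
    using i' by (simp add: B_def matrix_mul_assoc[symmetric])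
  also have "\<dots> = base_proj ** B"
    unfolding eq[symmetric] using i by (simp add: B_def matrix_mul_assoc)
  finally have BH: "B \<in> H_grp"
    unfolding H_grp_iff using K_grp_mult[OF i(3) g'] by (simp add: B_def)
  have g'B: "g' = g ** B" using i by (simp add: B_def matrix_mul_assoc)
  have BB: "B ** matrix_inv B = mat 1" using BH K_grp_inv by (auto simp: H_grp_iff)
  show "act g base_point = act g' base_point"
  proof (intro equalityI subsetI)
    fix C assume "C \<in> act g base_point"
    then obtain A where A: "C = g ** A" "A \<in> H_grp" unfolding act_def base_point_def by auto
    then have "C = g' ** (matrix_inv B ** A)" unfolding g'B
      by (metis BB matrix_mul_assoc matrix_mul_lid)
    then show "C \<in> act g' base_point" unfolding act_def base_point_def
      using H_grp_mult[OF H_grp_inv[OF BH] A(2)] by blast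
  next
    fix C assume "C \<in> act g' base_point"
    then obtain A where A: "C = g' ** A" "A \<in> H_grp" unfolding act_def base_point_def by auto
    then have "C = g ** (B ** A)" unfolding g'B by (simp add: matrix_mul_assoc)
    then show "C \<in> act g base_point" unfolding act_def base_point_def
      using H_grp_mult[OF BH A(2)] by blast
  qed
qed

text \<open>The matrix arises from the identity by adding to the \<open>None\<close> row a
  combination of the other rows.\<close>

lemma det_upper_mat: "det (upper_mat z) = 1" for z :: "'n::finite coords"
proof -
  let ?I = "mat 1 :: 'n mat_K"
  have r: "row j ?I = axis j 1" for j by (simp add: row_def mat_def axis_def vec_eq_iff)
  have "emb 0 (ypart z) = (\<Sum>j\<in>UNIV. (z $ Inr j) *s row (Some j) ?I)"
    by (rule vec_option_eqI) (simp_all add: r axis_def delta_sums)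
  also have "\<dots> \<in> vec.span {row j ?I | j. j \<noteq> None}"
    by (intro vec.span_sum vec.span_scale vec.span_base) auto
  finally have "det (\<chi> k. if k = None then row None ?I + emb 0 (ypart z) else row k ?I) = det ?I"
    by (rule det_row_span)
  moreover have "(\<chi> k. if k = None then row None ?I + emb 0 (ypart z) else row k ?I) = upper_mat z"
    unfolding vec_eq_iff
    by (auto simp: upper_mat_def r axis_def split: option.splits)
  ultimately show ?thesis by simp
qed

lemma det_lower_mat: "det (lower_mat z) = 1"
proof -
  have "lower_mat z = transpose (upper_mat (join (ypart z) (xpart z)))"
    by (auto simp: vec_eq_iff transpose_def lower_mat_def upper_mat_def split: option.splits)
  then show ?thesis by (simp add: det_transpose det_upper_mat)
qed

lemma expo_mat_K: "lower_mat z ** upper_mat z \<in> K_grp"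
  by (simp add: K_grp_def det_mul det_lower_mat det_upper_mat)

lemma expo_mat_nth [simp]:
  "lower_mat z $ None $ None = 1" "lower_mat z $ None $ Some j = 0"
  "lower_mat z $ Some i $ None = z $ Inl i" "lower_mat z $ Some i $ Some j = (if i = j then 1 else 0)"
  "upper_mat z $ None $ None = 1" "upper_mat z $ None $ Some j = z $ Inr j"
  "upper_mat z $ Some i $ None = 0" "upper_mat z $ Some i $ Some j = (if i = j then 1 else 0)"
  by (simp_all add: lower_mat_def upper_mat_def)

lemma expo_mat_proj:
  "(lower_mat z ** upper_mat z) ** base_proj ** matrix_inv (lower_mat z ** upper_mat z) = Phi z"
proof -
  let ?g = "lower_mat z ** upper_mat z"
  have u: "upper_mat z *v emb 1 0 = emb 1 0"
    by (rule vec_option_eqI) (simp_all add: matrix_vector_mult_def sum_UNIV_option)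
  have l: "lower_mat z *v emb 1 0 = pvec z"
    by (rule vec_option_eqI) (simp_all add: matrix_vector_mult_def sum_UNIV_option pvec_def)
  have 1: "?g *v emb 1 0 = pvec z"
    unfolding matrix_vector_mul_assoc[symmetric] u l ..
  have l': "qvec z v* lower_mat z = emb 1 (- ypart z)"
    by (rule vec_option_eqI)
      (simp_all add: vector_matrix_mult_def sum_UNIV_option qvec_def inner_vec_def delta_sums
        mult.commute)
  have u': "emb 1 (- ypart z) v* upper_mat z = emb 1 0"
    by (rule vec_option_eqI) (simp_all add: vector_matrix_mult_def sum_UNIV_option delta_sums)
  have 2: "qvec z v* ?g = emb 1 0"
    unfolding vector_matrix_mul_assoc[symmetric] l' u' ..
  have "emb 1 0 v* matrix_inv ?g = qvec z"
    unfolding 2[symmetric] vector_matrix_mul_assoc K_grp_inv(1)[OF expo_mat_K] by simp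
  then show ?thesis unfolding base_proj_def mult_outer outer_mult_right 1 by (simp add: Phi_def)
qed

lemma act_expo_eq_iff:
  assumes g: "g \<in> K_grp" and g': "g' \<in> K_grp"
  shows "act g (expo_coords z) = act g' (expo_coords z') \<longleftrightarrow>
     g ** Phi z ** matrix_inv g = g' ** Phi z' ** matrix_inv g'"
  unfolding expo_coords_def act_act
    act_base_point_eq_iff[OF K_grp_mult[OF g expo_mat_K] K_grp_mult[OF g' expo_mat_K]]
    matrix_inv_mult_K[OF g expo_mat_K] matrix_inv_mult_K[OF g' expo_mat_K]
  by (simp add: expo_mat_proj[symmetric] matrix_mul_assoc)

lemma act_expo_transition:
  assumes k: "k \<in> K_grp" and k': "k' \<in> K_grp"
  shows "act k (expo_coords z) = act k' (expo_coords z') \<longleftrightarrow>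
     Phi z = (matrix_inv k ** k') ** Phi z' ** matrix_inv (matrix_inv k ** k')"
proof -
  note i = K_grp_inv[OF k] K_grp_inv[OF k']
  have inv: "matrix_inv (matrix_inv k ** k') = matrix_inv k' ** k"
  proof (rule matrix_inv_eqI)
    have "matrix_inv k ** k' ** (matrix_inv k' ** k) = matrix_inv k ** (k' ** matrix_inv k') ** k"
      by (simp add: matrix_mul_assoc)
    then show "matrix_inv k ** k' ** (matrix_inv k' ** k) = mat 1" by (simp add: i)
  qed
  have 1: "matrix_inv k ** (k ** Phi z ** matrix_inv k) ** k = Phi z"
    by (simp add: matrix_mul_assoc i) (simp add: matrix_mul_assoc[symmetric] i)
  have 2: "k ** (matrix_inv k ** Z ** k) ** matrix_inv k = Z" for Z
    by (simp add: matrix_mul_assoc i) (simp add: matrix_mul_assoc[symmetric] i)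
  have 3: "matrix_inv k ** k' ** Phi z' ** (matrix_inv k' ** k)
      = matrix_inv k ** (k' ** Phi z' ** matrix_inv k') ** k"
    by (simp add: matrix_mul_assoc)
  show ?thesis unfolding act_expo_eq_iff[OF assms] inv 3 using 1 2 by metis
qed

definition chart_act :: "'n::finite mat_K \<Rightarrow> 'n coords \<Rightarrow> 'n coords" where
  "chart_act h z = (let m = h *v pvec z in
     join (\<chi> i. m $ Some i / m $ None) (\<chi> j. - (m $ None) * (qvec z v* matrix_inv h) $ Some j))"

text \<open>\<open>chart_act\<close> rescales \<open>h *v pvec z\<close> to have \<open>None\<close>
  entry 1, possible exactly where that entry is nonzero, and rescales the row vector inversely. The
  \<open>None\<close> entry of the row is then forced by the pairing being 1.\<close>

lemma Phi_chart_act: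
  assumes h: "matrix_inv h ** h = mat 1" and m: "(h *v pvec z) $ None \<noteq> 0"
  shows "Phi (chart_act h z) = h ** Phi z ** matrix_inv h"
proof -
  define m where "m = h *v pvec z"
  define q where "q = qvec z v* matrix_inv h"
  have "q \<bullet> m = qvec z \<bullet> ((matrix_inv h ** h) *v pvec z)"
    unfolding q_def m_def dot_lmul_matrix matrix_vector_mul_assoc ..
  then have qm: "q \<bullet> m = 1" by (simp add: h)
  have m0: "m $ None \<noteq> 0" using m by (simp add: m_def)
  have x: "chart_act h z $ Inl i = m $ Some i / m $ None" for i
    by (simp add: chart_act_def m_def[symmetric] Let_def)
  have y: "chart_act h z $ Inr i = - (m $ None) * q $ Some i" for i
    by (simp add: chart_act_def m_def[symmetric] q_def[symmetric] Let_def)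
  have p: "pvec (chart_act h z) = (1 / m $ None) *\<^sub>R m"
    using m0 by (intro vec_option_eqI) (simp_all add: pvec_def x)
  have "xpart (chart_act h z) \<bullet> ypart (chart_act h z) = - (\<Sum>i\<in>UNIV. q $ Some i * m $ Some i)"
    using m0 by (simp add: inner_vec_def x y sum_negf[symmetric] mult.commute)
  also have "\<dots> = q $ None * m $ None - 1"
    using qm by (simp add: inner_vec_def sum_UNIV_option)
  finally have "qvec (chart_act h z) = (m $ None) *\<^sub>R q"
    by (intro vec_option_eqI) (simp_all add: qvec_def y)
  with p m0 show ?thesis
    unfolding Phi_def mult_outer outer_mult_right by (simp add: outer_linear m_def[symmetric] q_def[symmetric])
qed

lemma Ck_on_coordsI:
  fixes f :: "'a::euclidean_space \<Rightarrow> 'n::finite coords"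
  assumes "open S" "\<And>i. Ck_on k S (\<lambda>s. f s $ Inl i)" "\<And>i. Ck_on k S (\<lambda>s. f s $ Inr i)"
  shows "Ck_on k S f"
  by (rule Ck_on_vec[OF assms(1)]) (metis assms(2,3) sum.exhaust)

lemma Ck_on_matrix_vector: "open S \<Longrightarrow> Ck_on k S f \<Longrightarrow> Ck_on k S (\<lambda>s. A *v f s)"
  for A :: "real^'m::finite^'m"
  by (rule Ck_on_linear_compose) (auto intro!: linear_conv_bounded_linear[THEN iffD1])

lemma Ck_on_vector_matrix: "open S \<Longrightarrow> Ck_on k S f \<Longrightarrow> Ck_on k S (\<lambda>s. f s v* A)"
  for A :: "real^'m::finite^'m"
  using Ck_on_matrix_vector[of S k f "transpose A"] by simp

lemma Ck_on_option_vecI: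
  fixes f :: "'a::euclidean_space \<Rightarrow> real^('n::finite option)"
  assumes "open S" "Ck_on k S (\<lambda>s. f s $ None)" "\<And>i. Ck_on k S (\<lambda>s. f s $ Some i)"
  shows "Ck_on k S f"
  by (rule Ck_on_vec[OF assms(1)]) (metis assms(2,3) option.exhaust)

lemma Ck_on_pvec:
  assumes S: "open S" and z: "Ck_on k S z" shows "Ck_on k S (\<lambda>s. pvec (z s))"
  by (rule Ck_on_option_vecI[OF S])
    (use Ck_on_nth[OF S Ck_on_linear_compose[OF S bounded_linear_xpart z]] in
      \<open>auto simp: pvec_def intro: Ck_on_const S\<close>)

lemma Ck_on_emb:
  assumes "open S" "Ck_on k S f" "Ck_on k S g" shows "Ck_on k S (\<lambda>s. emb (f s) (g s))"
  by (rule Ck_on_option_vecI[OF assms(1)]) (simp_all add: assms Ck_on_nth)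

lemma Ck_on_qvec:
  assumes S: "open S" and z: "Ck_on k S z" shows "Ck_on k S (\<lambda>s. qvec (z s))"
  unfolding qvec_def
  by (intro Ck_on_emb Ck_on_intros S Ck_on_linear_compose[OF S bounded_linear_xpart z]
      Ck_on_linear_compose[OF S bounded_linear_ypart z])

lemma Ck_on_chart_act:
  assumes S: "open S" and z: "Ck_on k S z" and m: "\<And>s. s \<in> S \<Longrightarrow> (h *v pvec (z s)) $ None \<noteq> 0"
  shows "Ck_on k S (\<lambda>s. chart_act h (z s))"
proof (rule Ck_on_coordsI[OF S])
  have P: "Ck_on k S (\<lambda>s. (h *v pvec (z s)) $ a)" for a
    by (intro Ck_on_nth S Ck_on_matrix_vector Ck_on_pvec z)
  have Q: "Ck_on k S (\<lambda>s. (qvec (z s) v* matrix_inv h) $ a)" for a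
    by (intro Ck_on_nth S Ck_on_vector_matrix Ck_on_qvec z)
  show "Ck_on k S (\<lambda>s. chart_act h (z s) $ Inl i)" "Ck_on k S (\<lambda>s. chart_act h (z s) $ Inr i)" for i
    by (auto simp: chart_act_def Let_def intro!: Ck_on_intros S P Q m)
qed

lemma smooth_on_chart_act:
  assumes "open S" "smooth_on S z" "\<And>s. s \<in> S \<Longrightarrow> (h *v pvec (z s)) $ None \<noteq> 0"
  shows "smooth_on S (\<lambda>s. chart_act h (z s))"
  using assms Ck_on_chart_act unfolding smooth_on_def by blast

section \<open>Existence of conformal circles\<close>

lemma Ck_on_xpart: "open S \<Longrightarrow> Ck_on k S f \<Longrightarrow> Ck_on k S (\<lambda>s. xpart (f s))"
  and Ck_on_ypart: "open S \<Longrightarrow> Ck_on k S f \<Longrightarrow> Ck_on k S (\<lambda>s. ypart (f s))"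
  by (rule Ck_on_linear_compose[OF _ bounded_linear_xpart], simp, simp)
     (rule Ck_on_linear_compose[OF _ bounded_linear_ypart])

lemma Ck_on_join:
  assumes "open S" "Ck_on k S f" "Ck_on k S g" shows "Ck_on k S (\<lambda>s. join (f s) (g s))"
  by (rule Ck_on_coordsI[OF assms(1)]) (simp_all add: Ck_on_nth assms)

lemma Ck_on_Gam:
  assumes "open S" "Ck_on k S x" "Ck_on k S v" "Ck_on k S w"
  shows "Ck_on k S (\<lambda>s. Gam (x s) (v s) (w s))"
  unfolding Gam_def Let_def
  by (intro Ck_on_join Ck_on_intros Ck_on_xpart Ck_on_ypart assms)

lemma Ck_on_ip_fs_metric:
  assumes "open S" "Ck_on k S x" "Ck_on k S v" "Ck_on k S w"
  shows "Ck_on k S (\<lambda>s. ip fs_metric (x s) (v s) (w s))"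
  unfolding ip_fs_metric
  by (intro Ck_on_intros Ck_on_xpart Ck_on_ypart assms)

lemma Gam_linear_left: "Gam z (v + v') w = Gam z v w + Gam z v' w" "Gam z (c *\<^sub>R v) w = c *\<^sub>R Gam z v w"
  by (rule coords_eqI; simp add: Gam_def Let_def algebra_simps)+

lemma Ck_on_ident: "open S \<Longrightarrow> Ck_on k S (\<lambda>x. x)"
  by (rule Ck_on_linear[OF _ bounded_linear_ident])

text \<open>The equation is a smooth first-order system for position, velocity and covariant
  acceleration on the non-null jets. Taking the free multiple of \<open>v\<close> to be zero fixes a
  parametrization.\<close>

theorem conformal_circle_through:
  fixes x0 v0 a0 :: "'n::finite coords"
  assumes "ip fs_metric x0 v0 v0 \<noteq> 0"
  obtains d x where "d > 0" "conformal_circle_on fs_metric {-d<..<d} x" "x 0 = x0" "velocity x 0 = v0"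
    "velocity (velocity x) 0 = a0"
proof -
  define U where "U = {z :: 'n coords \<times> 'n coords \<times> 'n coords. ip fs_metric (fst z) (fst (snd z)) (fst (snd z)) \<noteq> 0}"
  define F where "F z = (let x = fst z; v = fst (snd z); A = snd (snd z) in
      (v, A - Gam x v v, (3 * ip fs_metric x v A / ip fs_metric x v v) *\<^sub>R A - Gam x v A))"
    for z :: "'n coords \<times> 'n coords \<times> 'n coords"
  note comps = Ck_on_fst Ck_on_snd Ck_on_ident
  have "continuous_on UNIV (\<lambda>z :: 'n coords \<times> 'n coords \<times> 'n coords. ip fs_metric (fst z) (fst (snd z)) (fst (snd z)))"
  proof -
    have "Ck_on 0 UNIV (\<lambda>z :: 'n coords \<times> 'n coords \<times> 'n coords. ip fs_metric (fst z) (fst (snd z)) (fst (snd z)))"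
      by (intro Ck_on_ip_fs_metric comps open_UNIV)
    then show ?thesis by simp
  qed
  then have U: "open U" unfolding U_def
    by (intro open_Collect_neq continuous_on_const)
  have "smooth_on U F" unfolding smooth_on_def F_def Let_def
    by (intro allI Ck_on_Pair Ck_on_diff Ck_on_scaleR Ck_on_divide Ck_on_mult Ck_on_const Ck_on_Gam
        Ck_on_ip_fs_metric comps U) (simp add: U_def)
  \<comment> \<open>The third component is the covariant acceleration, so \<open>Gam\<close> is
    added to obtain the prescribed second derivative \<open>a0\<close> in coordinates.\<close>
  moreover have "(x0, v0, a0 + Gam x0 v0 v0) \<in> U" using assms by (simp add: U_def)
  ultimately obtain d z where d: "d > 0" and z0: "z 0 = (x0, v0, a0 + Gam x0 v0 v0)"
    and smooth: "smooth_on {-d<..<d} z"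
    and z: "\<And>t. t \<in> {-d<..<d} \<Longrightarrow> z t \<in> U \<and> (z has_vector_derivative F (z t)) (at t)"
    using smooth_ode_solution[OF U] by metis
  define x v A where "x t = fst (z t)" and "v t = fst (snd (z t))" and "A t = snd (snd (z t))" for t
  let ?J = "\<lambda>t. (3 * ip fs_metric (x t) (v t) (A t) / ip fs_metric (x t) (v t) (v t)) *\<^sub>R A t"
  have dx: "(x has_vector_derivative v t) (at t)"
    and dv: "(v has_vector_derivative A t - Gam (x t) (v t) (v t)) (at t)"
    and dA: "(A has_vector_derivative ?J t - Gam (x t) (v t) (A t)) (at t)"
    and G: "ip fs_metric (x t) (v t) (v t) \<noteq> 0"
    if t: "t \<in> {-d<..<d}" for t
  proof -
    have D: "(z has_vector_derivative F (z t)) (at t)" using z[OF t] by blast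
    note D1 = bounded_linear.has_vector_derivative[OF bounded_linear_fst D]
    note D2 = bounded_linear.has_vector_derivative[OF bounded_linear_snd D]
    note D3 = bounded_linear.has_vector_derivative[OF bounded_linear_fst D2]
      bounded_linear.has_vector_derivative[OF bounded_linear_snd D2]
    show "(x has_vector_derivative v t) (at t)"
      using D1 unfolding x_def[abs_def] v_def F_def Let_def by simp
    show "(v has_vector_derivative A t - Gam (x t) (v t) (v t)) (at t)"
      using D3(1) unfolding x_def v_def[abs_def] A_def F_def Let_def by simp
    show "(A has_vector_derivative ?J t - Gam (x t) (v t) (A t)) (at t)"
      using D3(2) unfolding x_def v_def A_def[abs_def] F_def Let_def by simp
    show "ip fs_metric (x t) (v t) (v t) \<noteq> 0" using z[OF t] by (simp add: U_def x_def v_def)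
  qed
  have sx: "smooth_on {-d<..<d} x"
    using smooth unfolding smooth_on_def x_def[abs_def] by (intro allI Ck_on_fst) auto
  have "conformal_circle_on fs_metric {-d<..<d} x"
    by (rule conformal_circle_onI[OF open_greaterThanLessThan sx dx dv dA G])
      (use G in \<open>auto intro!: exI[of _ 0]\<close>)
  moreover have v: "velocity x t = v t" if "t \<in> {-d<..<d}" for t
    using dx[OF that] by (rule vector_derivative_at)
  moreover have "velocity (velocity x) 0 = a0"
  proof -
    have "velocity (velocity x) 0 = A 0 - Gam (x 0) (v 0) (v 0)"
      by (rule velocity_eqI[OF open_greaterThanLessThan _ v dv]) (use d in auto)
    then show ?thesis by (simp add: A_def x_def v_def z0)
  qed
  ultimately show ?thesis using that d by (auto simp: x_def v_def z0)
qed

lemma smooth_on_2jet: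
  assumes "smooth_on T x" "open T" "t \<in> T"
  shows "(x has_vector_derivative velocity x t) (at t)"
    "(velocity x has_vector_derivative velocity (velocity x) t) (at t)"
  using assms smooth_on_has_vector_derivative smooth_on_velocity by blast+

lemma jets2I:
  assumes "(I, \<gamma>) \<in> F" "open T" "t \<in> T" "T \<subseteq> I" "smooth_on T x"
    "\<And>s. s \<in> T \<Longrightarrow> \<gamma> s = act k (expo_coords (x s))"
  shows "(x t, velocity x t, velocity (velocity x) t) \<in> jets2 k F"
  unfolding jets2_def
  by (rule CollectI, rule exI[of _ x], rule exI[of _ t], rule conjI[OF refl],
      rule exI[of _ I], rule exI[of _ \<gamma>], rule exI[of _ T]) (simp add: assms)

lemma conformal_circlesI:
  assumes "open_interval I" "k \<in> K_grp" "conformal_circle_on fs_metric I x"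
    "\<And>s. s \<in> I \<Longrightarrow> \<gamma> s = act k (expo_coords (x s))"
  shows "(I, \<gamma>) \<in> conformal_circles"
proof -
  have "\<exists>k\<in>K_grp. \<exists>T x. open T \<and> t0 \<in> T \<and> T \<subseteq> I \<and>
     conformal_circle_on fs_metric T x \<and> (\<forall>t\<in>T. \<gamma> t = act k (expo_coords (x t)))" if "t0 \<in> I" for t0
    by (rule bexI[OF _ assms(2)], rule exI[of _ I], rule exI[of _ x])
      (use assms that in \<open>simp add: open_interval_def\<close>)
  then show ?thesis unfolding conformal_circles_def using assms(1) by simp
qed

text \<open>Circles may be given in different charts, but conjugation preserves \<open>bet\<close>
  and hence non-nullity. Conversely every non-null jet is the initial value of a solution of the
  third-order equation.\<close>

lemma jets2_conformal_circles:
  fixes k :: "'n::finite mat_K"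
  assumes k: "k \<in> K_grp"
  shows "jets2 k conformal_circles = {(x, v, a). ip fs_metric x v v \<noteq> 0}"
proof (intro equalityI subsetI)
  fix j assume "j \<in> jets2 k conformal_circles"
  then obtain x t I \<gamma> T where j: "j = (x t, velocity x t, velocity (velocity x) t)"
    and C: "(I, \<gamma>) \<in> conformal_circles" and T: "open T" "t \<in> T" "T \<subseteq> I"
    and x: "smooth_on T x" and \<gamma>: "\<And>s. s \<in> T \<Longrightarrow> \<gamma> s = act k (expo_coords (x s))"
    unfolding jets2_def by blast
  have "\<forall>t0\<in>I. \<exists>k\<in>K_grp. \<exists>T x. open T \<and> t0 \<in> T \<and> T \<subseteq> I \<and>
        conformal_circle_on fs_metric T x \<and> (\<forall>t\<in>T. \<gamma> t = act k (expo_coords (x t)))"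
    using C unfolding conformal_circles_def by simp
  from bspec[OF this subsetD[OF T(3,2)]]
  obtain k' T' y where k': "k' \<in> K_grp" and T': "open T'" "t \<in> T'" and y: "conformal_circle_on fs_metric T' y"
    and \<gamma>': "\<And>s. s \<in> T' \<Longrightarrow> \<gamma> s = act k' (expo_coords (y s))"
    by blast
  have ys: "smooth_on T' y" and g: "ip fs_metric (y t) (velocity y t) (velocity y t) \<noteq> 0"
    using y T' unfolding conformal_circle_on_def by auto
  let ?h = "matrix_inv k ** k'" and ?S = "T \<inter> T'"
  have h: "?h \<in> K_grp" by (intro K_grp_mult K_grp_inv k k')
  have eq: "Phi (x s) = ?h ** Phi (y s) ** matrix_inv ?h" if "s \<in> ?S" for s
    using act_expo_transition[OF k k', of "x s" "y s"] \<gamma>[of s] \<gamma>'[of s] that by simp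
  have d: "dPhi (x t) (velocity x t) = ?h ** dPhi (y t) (velocity y t) ** matrix_inv ?h"
    by (rule jet_transform(1)[of ?S, OF _ _ K_grp_inv(2)[OF h] eq])
      (use T T' smooth_on_2jet[OF x] smooth_on_2jet[OF ys] in auto)
  have "bet (x t) (velocity x t) (velocity x t) = bet (y t) (velocity y t) (velocity y t)"
    by (rule bet_conj[OF K_grp_inv(2)[OF h] eq d d]) (use T T' in auto)
  then show "j \<in> {(x, v, a). ip fs_metric x v v \<noteq> 0}" using g by (simp add: j ip_bet)
next
  fix j :: "'n coords \<times> 'n coords \<times> 'n coords"
  assume "j \<in> {(x, v, a). ip fs_metric x v v \<noteq> 0}"
  then obtain x0 v0 a0 where j: "j = (x0, v0, a0)" and g: "ip fs_metric x0 v0 v0 \<noteq> 0" by auto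
  obtain d x where d: "d > 0" and x: "conformal_circle_on fs_metric {-d<..<d} x" "x 0 = x0" "velocity x 0 = v0"
    "velocity (velocity x) 0 = a0"
    using conformal_circle_through[OF g] by metis
  let ?I = "{-d<..<d}"
  have "open_interval ?I" unfolding open_interval_def using d by auto
  then have F: "(?I, \<lambda>s. act k (expo_coords (x s))) \<in> conformal_circles"
    using k x(1) by (intro conformal_circlesI[of ?I k x]) auto
  have sx: "smooth_on ?I x" using x(1) unfolding conformal_circle_on_def by blast
  have "0 \<in> ?I" using d by simp
  from jets2I[OF F open_greaterThanLessThan this order_refl sx refl]
  show "j \<in> jets2 k conformal_circles" unfolding j x(2,3,4) .
qed

section \<open>The family of curves\<close>

definition curve_d1 :: "'n::finite \<Rightarrow> 'n \<Rightarrow> real \<Rightarrow> real \<Rightarrow> 'n coords" where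
  "curve_d1 i1 i2 c t = join (- (1 / (2 * c^3)) *\<^sub>R axis i1 1 + (1 / (2 * c^3 * t^2)) *\<^sub>R axis i2 1)
     (- (1 / t^2) *\<^sub>R axis i1 1 + axis i2 1)"

text \<open>\<open>curve_d2\<close> and \<open>curve_d3\<close> are the first and second covariant derivatives of \<open>curve_d1\<close> along
  the curve.\<close>

definition curve_d2 :: "'n::finite \<Rightarrow> 'n \<Rightarrow> real \<Rightarrow> real \<Rightarrow> 'n coords" where
  "curve_d2 i1 i2 c t = join (- (1 / (c^3 * t^3)) *\<^sub>R axis i2 1)
     ((2 / t^3 - 2 / (c^3 * t^3)) *\<^sub>R axis i1 1 - (2 / (c^3 * t)) *\<^sub>R axis i2 1)"

definition curve_d3 :: "'n::finite \<Rightarrow> 'n \<Rightarrow> real \<Rightarrow> real \<Rightarrow> 'n coords" where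
  "curve_d3 i1 i2 c t = - (1 / (c^3 * t^2)) *\<^sub>R curve_d1 i1 i2 c t - (3 / t) *\<^sub>R curve_d2 i1 i2 c t"

lemma circle_curve_join: "i1 \<noteq> i2 \<Longrightarrow> circle_curve i1 i2 c t =
   join (((2 * c^2 - t) / (2 * c^3)) *\<^sub>R axis i1 1 + (- 1 / (2 * c^3 * t)) *\<^sub>R axis i2 1)
     ((1 / t) *\<^sub>R axis i1 1 + t *\<^sub>R axis i2 1)"
  by (rule coords_eqI) (simp_all add: vec_eq_iff circle_curve_def axis_def)

lemma axis_inner: "i1 \<noteq> i2 \<Longrightarrow> axis i1 1 \<bullet> (axis i2 1 :: real^'n::finite) = 0"
  "axis i 1 \<bullet> (axis i 1 :: real^'n) = 1"
  by (simp_all add: inner_axis_axis)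

lemma join_has_vector_derivative:
  fixes f g :: "real \<Rightarrow> real^'n::finite"
  assumes "(f has_vector_derivative f') (at t)" "(g has_vector_derivative g') (at t)"
  shows "((\<lambda>s. join (f s) (g s)) has_vector_derivative join f' g') (at t)"
proof -
  have l: "bounded_linear (\<lambda>r. join r (0::real^'n))" "bounded_linear (\<lambda>u::real^'n. join 0 u)"
    by (auto intro!: linear_conv_bounded_linear[THEN iffD1] linearI coords_eqI)
  have "((\<lambda>s. join (f s) 0 + join 0 (g s)) has_vector_derivative join f' 0 + join 0 g') (at t)"
    using assms by (intro has_vector_derivative_add bounded_linear.has_vector_derivative[OF l(1)]
        bounded_linear.has_vector_derivative[OF l(2)])
  moreover have "join a 0 + join 0 b = join a b" for a b :: "real^'n" by (rule coords_eqI) simp_all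
  ultimately show ?thesis by simp
qed

context
  fixes i1 i2 :: "'n::finite" and c :: real
  assumes i12: "i1 \<noteq> i2" and c: "c > 0"
begin

lemma axis_sum_has_vector_derivative:
  assumes "(f has_real_derivative f') (at t)" "(g has_real_derivative g') (at t)"
  shows "((\<lambda>s. f s *\<^sub>R axis i1 1 + g s *\<^sub>R axis i2 (1::real)) has_vector_derivative
    f' *\<^sub>R axis i1 1 + g' *\<^sub>R axis i2 1) (at t)"
  using has_vector_derivative_scaleR[OF assms(1) has_vector_derivative_const]
    has_vector_derivative_scaleR[OF assms(2) has_vector_derivative_const]
  by (intro has_vector_derivative_add) simp_all

lemma circle_curve_parts:
  "xpart (circle_curve i1 i2 c t) = ((2 * c^2 - t) / (2 * c^3)) *\<^sub>R axis i1 1 + (- 1 / (2 * c^3 * t)) *\<^sub>R axis i2 1"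
  "ypart (circle_curve i1 i2 c t) = (1 / t) *\<^sub>R axis i1 1 + t *\<^sub>R axis i2 1"
  by (simp_all add: circle_curve_join[OF i12])

lemma circle_curve_has_vector_derivative:
  assumes t: "t \<noteq> 0"
  shows "(circle_curve i1 i2 c has_vector_derivative curve_d1 i1 i2 c t) (at t)"
proof -
  have "((\<lambda>t. (2 * c^2 - t) / (2 * c^3)) has_real_derivative - (1 / (2 * c^3))) (at t)"
    "((\<lambda>t. - 1 / (2 * c^3 * t)) has_real_derivative 1 / (2 * c^3 * t^2)) (at t)"
    "((\<lambda>t. 1 / t) has_real_derivative - (1 / t^2)) (at t)"
    "((\<lambda>t. t) has_real_derivative 1) (at t)"
    using t c by (auto intro!: derivative_eq_intros simp: field_simps power2_eq_square power3_eq_cube)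
  from join_has_vector_derivative[OF axis_sum_has_vector_derivative[OF this(1,2)]
      axis_sum_has_vector_derivative[OF this(3,4)]]
  show ?thesis unfolding circle_curve_join[OF i12, abs_def] curve_d1_def by simp
qed

lemma curve_d_parts:
  "xpart (curve_d1 i1 i2 c t) = - (1 / (2 * c^3)) *\<^sub>R axis i1 1 + (1 / (2 * c^3 * t^2)) *\<^sub>R axis i2 1"
  "ypart (curve_d1 i1 i2 c t) = - (1 / t^2) *\<^sub>R axis i1 1 + axis i2 1"
  "xpart (curve_d2 i1 i2 c t) = - (1 / (c^3 * t^3)) *\<^sub>R axis i2 1"
  "ypart (curve_d2 i1 i2 c t) = (2 / t^3 - 2 / (c^3 * t^3)) *\<^sub>R axis i1 1 - (2 / (c^3 * t)) *\<^sub>R axis i2 1"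
  by (simp_all add: curve_d1_def curve_d2_def)

lemma curve_inner:
  assumes t: "t \<noteq> 0"
  shows "ypart (circle_curve i1 i2 c t) \<bullet> xpart (curve_d1 i1 i2 c t) = 0"
    "ypart (circle_curve i1 i2 c t) \<bullet> xpart (curve_d2 i1 i2 c t) = - (1 / (c^3 * t^2))"
    "xpart (curve_d1 i1 i2 c t) \<bullet> ypart (curve_d1 i1 i2 c t) = 1 / (c^3 * t^2)"
    "ypart (curve_d1 i1 i2 c t) \<bullet> xpart (curve_d1 i1 i2 c t) = 1 / (c^3 * t^2)"
    "xpart (curve_d1 i1 i2 c t) \<bullet> ypart (curve_d2 i1 i2 c t) = - (1 / (c^3 * t^3))"
    "ypart (curve_d2 i1 i2 c t) \<bullet> xpart (curve_d1 i1 i2 c t) = - (1 / (c^3 * t^3))"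
    "ypart (curve_d1 i1 i2 c t) \<bullet> xpart (curve_d2 i1 i2 c t) = - (1 / (c^3 * t^3))"
    "ypart (curve_d2 i1 i2 c t) \<bullet> xpart (curve_d2 i1 i2 c t) = 2 / (c^6 * t^4)"
  unfolding curve_d_parts circle_curve_parts using t c
  by (simp_all add: inner_add_left inner_add_right inner_diff_left inner_diff_right axis_inner i12 i12[symmetric])
    (simp_all add: field_simps eval_nat_numeral)

text \<open>The equal mixed values say that \<open>\<omega>(v,a) = 0\<close> on the family. The
  determinant divided by the cube of the first value is \<open>c^3 - 1\<close>, the source of the
  formula for \<open>c\<close>.\<close>

lemma curve_bet:
  assumes t: "t \<noteq> 0"
  shows "bet (circle_curve i1 i2 c t) (curve_d1 i1 i2 c t) (curve_d1 i1 i2 c t) = - (1 / (c^3 * t^2))"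
    "bet (circle_curve i1 i2 c t) (curve_d1 i1 i2 c t) (curve_d2 i1 i2 c t) = 1 / (c^3 * t^3)"
    "bet (circle_curve i1 i2 c t) (curve_d2 i1 i2 c t) (curve_d1 i1 i2 c t) = 1 / (c^3 * t^3)"
    "bet (circle_curve i1 i2 c t) (curve_d2 i1 i2 c t) (curve_d2 i1 i2 c t) = - (1 / (c^6 * t^4))"
  unfolding bet_def curve_inner[OF t] using t c by (simp_all add: field_simps eval_nat_numeral)

lemma curve_Gam:
  assumes t: "t \<noteq> 0"
  shows "Gam (circle_curve i1 i2 c t) (curve_d1 i1 i2 c t) (curve_d1 i1 i2 c t) =
      join 0 (- (2 / (c^3 * t^3)) *\<^sub>R axis i1 1 - (2 / (c^3 * t)) *\<^sub>R axis i2 1)"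
    "Gam (circle_curve i1 i2 c t) (curve_d1 i1 i2 c t) (curve_d2 i1 i2 c t) =
      join ((1 / (2 * c^6 * t^2)) *\<^sub>R axis i1 1 - (1 / (2 * c^6 * t^4)) *\<^sub>R axis i2 1)
        ((1 / (c^3 * t^4)) *\<^sub>R axis i1 1 + (3 / (c^3 * t^2)) *\<^sub>R axis i2 1)"
  unfolding Gam_def Let_def curve_inner[OF t] unfolding curve_d_parts circle_curve_parts using t c
  by (intro coords_eqI; simp add: vec_eq_iff; simp add: field_simps eval_nat_numeral)+

lemma curve_d1_has_vector_derivative:
  assumes t: "t \<noteq> 0"
  shows "(curve_d1 i1 i2 c has_vector_derivative curve_d2 i1 i2 c t
     - Gam (circle_curve i1 i2 c t) (curve_d1 i1 i2 c t) (curve_d1 i1 i2 c t)) (at t)"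
proof -
  have "((\<lambda>t. - (1 / (2 * c^3))) has_real_derivative 0) (at t)"
    "((\<lambda>t. 1 / (2 * c^3 * t^2)) has_real_derivative - (1 / (c^3 * t^3))) (at t)"
    "((\<lambda>t. - (1 / t^2)) has_real_derivative 2 / t^3) (at t)"
    "((\<lambda>t. 1) has_real_derivative 0) (at t)"
    using t c by (auto intro!: derivative_eq_intros simp: field_simps power2_eq_square power3_eq_cube)
  from join_has_vector_derivative[OF axis_sum_has_vector_derivative[OF this(1,2)]
      axis_sum_has_vector_derivative[OF this(3,4)]]
  have "(curve_d1 i1 i2 c has_vector_derivative
     join (- (1 / (c^3 * t^3)) *\<^sub>R axis i2 1) ((2 / t^3) *\<^sub>R axis i1 1)) (at t)"
    unfolding curve_d1_def[abs_def] by simp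
  then show ?thesis
    by (rule has_vector_derivative_eq_rhs)
      (rule coords_eqI; simp add: curve_Gam[OF t] curve_d2_def; simp add: vec_eq_iff algebra_simps)
qed

text \<open>This is the circle equation in the given parameter: the coefficient \<open>-3/t\<close>
  in \<open>curve_d3\<close> is \<open>3 g(v,a) / g(v,v)\<close>.\<close>

lemma curve_d2_has_vector_derivative:
  assumes t: "t \<noteq> 0"
  shows "(curve_d2 i1 i2 c has_vector_derivative curve_d3 i1 i2 c t
     - Gam (circle_curve i1 i2 c t) (curve_d1 i1 i2 c t) (curve_d2 i1 i2 c t)) (at t)"
proof -
  have D: "((\<lambda>t. 0) has_real_derivative 0) (at t)"
    "((\<lambda>t. - (1 / (c^3 * t^3))) has_real_derivative 3 / (c^3 * t^4)) (at t)"
    "((\<lambda>t. 2 / t^3 - 2 / (c^3 * t^3)) has_real_derivative 6 / (c^3 * t^4) - 6 / t^4) (at t)"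
    "((\<lambda>t. - (2 / (c^3 * t))) has_real_derivative 2 / (c^3 * t^2)) (at t)"
    using t c by (auto intro!: derivative_eq_intros simp: field_simps eval_nat_numeral)
  from join_has_vector_derivative[OF axis_sum_has_vector_derivative[OF D(1,2)]
      axis_sum_has_vector_derivative[OF D(3,4)]]
  have "(curve_d2 i1 i2 c has_vector_derivative join ((3 / (c^3 * t^4)) *\<^sub>R axis i2 1)
     ((6 / (c^3 * t^4) - 6 / t^4) *\<^sub>R axis i1 1 + (2 / (c^3 * t^2)) *\<^sub>R axis i2 1)) (at t)"
    unfolding curve_d2_def[abs_def] by simp
  then show ?thesis
    by (rule has_vector_derivative_eq_rhs)
      (rule coords_eqI; simp add: curve_Gam[OF t] curve_d3_def curve_d_parts; simp add: vec_eq_iff;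
        use t c in \<open>simp add: field_simps eval_nat_numeral\<close>)
qed

end

section \<open>Reparametrized members of the family\<close>

lemma smooth_on_real_derivative:
  fixes \<phi> :: "real \<Rightarrow> real"
  assumes "open T" "smooth_on T \<phi>" "s \<in> T"
  shows "(\<phi> has_real_derivative velocity \<phi> s) (at s)" "(velocity \<phi> has_real_derivative velocity (velocity \<phi>) s) (at s)"
    "(velocity (velocity \<phi>) has_real_derivative velocity (velocity (velocity \<phi>)) s) (at s)"
    "deriv \<phi> s = velocity \<phi> s"
proof -
  note V = smooth_on_velocity[OF assms(1)]
  have D: "(f has_real_derivative velocity f s) (at s)" if "smooth_on T f" for f :: "real \<Rightarrow> real"
    unfolding has_real_derivative_iff_has_vector_derivative
    by (rule smooth_on_has_vector_derivative[OF that assms(3)])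
  show 1: "(\<phi> has_real_derivative velocity \<phi> s) (at s)" by (rule D[OF assms(2)])
  show "(velocity \<phi> has_real_derivative velocity (velocity \<phi>) s) (at s)" by (rule D[OF V[OF assms(2)]])
  show "(velocity (velocity \<phi>) has_real_derivative velocity (velocity (velocity \<phi>)) s) (at s)"
    by (rule D[OF V[OF V[OF assms(2)]]])
  show "deriv \<phi> s = velocity \<phi> s" using 1 by (rule DERIV_imp_deriv)
qed

lemma has_vector_derivative_compose:
  assumes "(\<phi> has_real_derivative r) (at s)" "(f has_vector_derivative f') (at (\<phi> s))"
  shows "((\<lambda>s. f (\<phi> s)) has_vector_derivative r *\<^sub>R f') (at s)"
  using vector_diff_chain_at[OF assms(1)[unfolded has_real_derivative_iff_has_vector_derivative] assms(2)]
  by (simp add: o_def)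

lemma K_orbitI:
  assumes "open_interval I" "k \<in> K_grp" "c > 0" "smooth_on I \<phi>" "\<And>t. t \<in> I \<Longrightarrow> \<phi> t \<noteq> 0 \<and> deriv \<phi> t \<noteq> 0"
    "\<And>t. t \<in> I \<Longrightarrow> \<gamma> t = act k (expo_coords (cs c (\<phi> t)))"
  shows "(I, \<gamma>) \<in> K_orbit cs"
proof -
  have "\<exists>k\<in>K_grp. \<exists>c>0. \<exists>\<phi>. smooth_on I \<phi> \<and> (\<forall>t\<in>I. \<phi> t \<noteq> 0 \<and> deriv \<phi> t \<noteq> 0) \<and>
        (\<forall>t\<in>I. \<gamma> t = act k (expo_coords (cs c (\<phi> t))))"
    by (rule bexI[OF _ assms(2)], rule exI[of _ c], rule conjI[OF assms(3)], rule exI[of _ \<phi>])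
      (simp add: assms)
  then show ?thesis unfolding K_orbit_def using assms(1) by simp
qed

lemma K_orbitE:
  assumes "(I, \<gamma>) \<in> K_orbit cs"
  obtains k c \<phi> where "open_interval I" "k \<in> K_grp" "c > 0" "smooth_on I \<phi>" "\<And>t. t \<in> I \<Longrightarrow> \<phi> t \<noteq> 0"
    "\<And>t. t \<in> I \<Longrightarrow> deriv \<phi> t \<noteq> 0" "\<And>t. t \<in> I \<Longrightarrow> \<gamma> t = act k (expo_coords (cs c (\<phi> t)))"
proof -
  have "open_interval I" "\<exists>k\<in>K_grp. \<exists>c>0. \<exists>\<phi>. smooth_on I \<phi> \<and> (\<forall>t\<in>I. \<phi> t \<noteq> 0 \<and> deriv \<phi> t \<noteq> 0) \<and>
        (\<forall>t\<in>I. \<gamma> t = act k (expo_coords (cs c (\<phi> t))))"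
    using assms unfolding K_orbit_def by simp_all
  then show ?thesis using that by (elim bexE exE conjE) simp
qed

context
  fixes i1 i2 :: "'n::finite" and c :: real
  assumes i12: "i1 \<noteq> i2" and c: "c > 0"
begin

lemma smooth_on_circle_curve:
  assumes "open T" "smooth_on T \<phi>" "\<And>s. s \<in> T \<Longrightarrow> \<phi> s \<noteq> 0"
  shows "smooth_on T (\<lambda>s. circle_curve i1 i2 c (\<phi> s))"
  unfolding smooth_on_def circle_curve_join[OF i12]
proof
  fix k
  have "Ck_on k T \<phi>" using assms(2) unfolding smooth_on_def by blast
  then show "Ck_on k T (\<lambda>s. join
       (((2 * c^2 - \<phi> s) / (2 * c^3)) *\<^sub>R axis i1 1 + (- 1 / (2 * c^3 * \<phi> s)) *\<^sub>R axis i2 1)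
       ((1 / \<phi> s) *\<^sub>R axis i1 1 + \<phi> s *\<^sub>R axis i2 1))"
    by (intro Ck_on_join Ck_on_add Ck_on_scaleR Ck_on_divide Ck_on_diff Ck_on_mult Ck_on_const assms(1))
      (use assms(3) c in auto)
qed

lemma circle_curve_compose_derivative:
  assumes "\<phi> s \<noteq> 0" "(\<phi> has_real_derivative f1) (at s)"
  shows "((\<lambda>s. circle_curve i1 i2 c (\<phi> s)) has_vector_derivative f1 *\<^sub>R curve_d1 i1 i2 c (\<phi> s)) (at s)"
  by (rule has_vector_derivative_compose[OF assms(2) circle_curve_has_vector_derivative[OF i12 c assms(1)]])

lemma curve_d1_compose_derivative:
  fixes f1 f2 :: "real \<Rightarrow> real"
  assumes p: "\<phi> s \<noteq> 0" "(\<phi> has_real_derivative f1 s) (at s)" "(f1 has_real_derivative f2 s) (at s)"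
  defines "V \<equiv> \<lambda>s. f1 s *\<^sub>R curve_d1 i1 i2 c (\<phi> s)"
    and "A \<equiv> \<lambda>s. (f1 s)^2 *\<^sub>R curve_d2 i1 i2 c (\<phi> s) + f2 s *\<^sub>R curve_d1 i1 i2 c (\<phi> s)"
  shows "(V has_vector_derivative A s - Gam (circle_curve i1 i2 c (\<phi> s)) (V s) (V s)) (at s)"
  unfolding V_def A_def
  by (rule has_vector_derivative_eq_rhs[OF has_vector_derivative_scaleR[OF p(3)
        has_vector_derivative_compose[OF p(2) curve_d1_has_vector_derivative[OF i12 c p(1)]]]])
    (simp add: Gam_scale Gam_linear_left vec_eq_iff algebra_simps power2_eq_square)

text \<open>The third-order chain rule, with covariant derivatives of the curve in place of ordinary
  ones.\<close>

lemma curve_d2_compose_derivative: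
  fixes f1 f2 f3 :: "real \<Rightarrow> real"
  assumes p: "\<phi> s \<noteq> 0" "(\<phi> has_real_derivative f1 s) (at s)" "(f1 has_real_derivative f2 s) (at s)"
    "(f2 has_real_derivative f3 s) (at s)"
  defines "V \<equiv> \<lambda>s. f1 s *\<^sub>R curve_d1 i1 i2 c (\<phi> s)"
    and "A \<equiv> \<lambda>s. (f1 s)^2 *\<^sub>R curve_d2 i1 i2 c (\<phi> s) + f2 s *\<^sub>R curve_d1 i1 i2 c (\<phi> s)"
    and "J \<equiv> \<lambda>s. (f1 s)^3 *\<^sub>R curve_d3 i1 i2 c (\<phi> s) + (3 * f1 s * f2 s) *\<^sub>R curve_d2 i1 i2 c (\<phi> s)
       + f3 s *\<^sub>R curve_d1 i1 i2 c (\<phi> s)"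
  shows "(A has_vector_derivative J s - Gam (circle_curve i1 i2 c (\<phi> s)) (V s) (A s)) (at s)"
proof -
  have sq: "((\<lambda>s. (f1 s)^2) has_real_derivative 2 * f1 s * f2 s) (at s)"
    using p(3) by (auto intro!: derivative_eq_intros)
  show ?thesis unfolding V_def A_def J_def
    by (rule has_vector_derivative_eq_rhs[OF has_vector_derivative_add[OF
        has_vector_derivative_scaleR[OF sq
          has_vector_derivative_compose[OF p(2) curve_d2_has_vector_derivative[OF i12 c p(1)]]]
        has_vector_derivative_scaleR[OF p(4)
          has_vector_derivative_compose[OF p(2) curve_d1_has_vector_derivative[OF i12 c p(1)]]]]])
      (simp add: Gam_scale Gam_add Gam_linear_left vec_eq_iff algebra_simps power2_eq_square power3_eq_cube)
qed

lemma circle_curve_conformal_circle: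
  assumes T: "open T" and \<phi>: "smooth_on T \<phi>" "\<And>s. s \<in> T \<Longrightarrow> \<phi> s \<noteq> 0" "\<And>s. s \<in> T \<Longrightarrow> deriv \<phi> s \<noteq> 0"
  shows "conformal_circle_on fs_metric T (\<lambda>s. circle_curve i1 i2 c (\<phi> s))"
proof -
  note D = smooth_on_real_derivative[OF T \<phi>(1)]
  let ?f1 = "velocity \<phi>" and ?f2 = "velocity (velocity \<phi>)" and ?f3 = "velocity (velocity (velocity \<phi>))"
  let ?d1 = "\<lambda>s. curve_d1 i1 i2 c (\<phi> s)" and ?d2 = "\<lambda>s. curve_d2 i1 i2 c (\<phi> s)"
  have f1: "?f1 s \<noteq> 0" if "s \<in> T" for s using \<phi>(3)[OF that] D(4)[OF that] by simp
  have g: "ip fs_metric (circle_curve i1 i2 c (\<phi> s)) (?d1 s) (?d1 s) = 2 / (c^3 * (\<phi> s)^2)"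
    "ip fs_metric (circle_curve i1 i2 c (\<phi> s)) (?d1 s) (?d2 s) = - 2 / (c^3 * (\<phi> s)^3)" if "s \<in> T" for s
    using curve_bet[OF i12 c \<phi>(2)[OF that]] by (simp_all add: ip_bet)
  show ?thesis
  proof (rule conformal_circle_onI[OF T smooth_on_circle_curve[OF T \<phi>(1,2)]
        circle_curve_compose_derivative[OF \<phi>(2) D(1)]
        curve_d1_compose_derivative[where \<phi>=\<phi> and ?f1.0="?f1" and ?f2.0="?f2", OF \<phi>(2) D(1,2)]
        curve_d2_compose_derivative[where \<phi>=\<phi> and ?f1.0="?f1" and ?f2.0="?f2" and ?f3.0="?f3", OF \<phi>(2) D(1,2,3)]])
    fix s assume s: "s \<in> T"
    have p: "\<phi> s \<noteq> 0" using \<phi>(2)[OF s] .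
    show "ip fs_metric (circle_curve i1 i2 c (\<phi> s)) (?f1 s *\<^sub>R ?d1 s) (?f1 s *\<^sub>R ?d1 s) \<noteq> 0"
      using f1[OF s] p c by (simp add: ip_fs_metric_linear(1-4) g[OF s])
    show "\<exists>l. ip fs_metric (circle_curve i1 i2 c (\<phi> s)) (?f1 s *\<^sub>R ?d1 s) (?f1 s *\<^sub>R ?d1 s) *\<^sub>R
          ((?f1 s)^3 *\<^sub>R curve_d3 i1 i2 c (\<phi> s) + (3 * ?f1 s * ?f2 s) *\<^sub>R ?d2 s + ?f3 s *\<^sub>R ?d1 s)
        = (3 * ip fs_metric (circle_curve i1 i2 c (\<phi> s)) (?f1 s *\<^sub>R ?d1 s) ((?f1 s)^2 *\<^sub>R ?d2 s + ?f2 s *\<^sub>R ?d1 s)) *\<^sub>R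
          ((?f1 s)^2 *\<^sub>R ?d2 s + ?f2 s *\<^sub>R ?d1 s) + l *\<^sub>R (?f1 s *\<^sub>R ?d1 s)"
    proof -
      define r where "r = 1 / (c^3 * (\<phi> s)^2)"
      define q where "q = 1 / \<phi> s"
      define a where "a = ?f1 s"
      define b where "b = ?f2 s"
      define e where "e = ?f3 s"
      have g': "ip fs_metric (circle_curve i1 i2 c (\<phi> s)) (?d1 s) (?d1 s) = 2 * r"
        "ip fs_metric (circle_curve i1 i2 c (\<phi> s)) (?d1 s) (?d2 s) = - 2 * r * q"
        unfolding g[OF s] using p c by (simp_all add: r_def q_def field_simps eval_nat_numeral)
      have d3: "curve_d3 i1 i2 c (\<phi> s) = - r *\<^sub>R ?d1 s - (3 * q) *\<^sub>R ?d2 s"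
        by (simp add: curve_d3_def r_def q_def)
      have a0: "a \<noteq> 0" using f1[OF s] by (simp add: a_def)
      show ?thesis
        unfolding ip_fs_metric_linear(1-4) g' d3 a_def[symmetric] b_def[symmetric] e_def[symmetric]
        \<comment> \<open>The coefficients of \<open>curve_d2\<close> agree on both sides; the
          witness is the difference of the coefficients of \<open>curve_d1\<close> divided by
          \<open>a\<close>.\<close>
        by (rule exI[of _ "- 2 * r * r * a^4 + 2 * r * a * e + 6 * r * q * a^2 * b - 6 * r * b^2"])
          (simp add: vec_eq_iff algebra_simps eval_nat_numeral)
    qed
  qed
qed

end

lemma K_orbit_subset:
  assumes "i1 \<noteq> i2"
  shows "K_orbit (circle_curve i1 i2) \<subseteq> conformal_circles"
proof
  fix F assume "F \<in> K_orbit (circle_curve i1 i2)"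
  then obtain I \<gamma> where F: "F = (I, \<gamma>)" "(I, \<gamma>) \<in> K_orbit (circle_curve i1 i2)" by (cases F) auto
  from F(2) show "F \<in> conformal_circles" unfolding F(1)
  proof (rule K_orbitE)
    fix k c \<phi>
    assume a: "open_interval I" "k \<in> K_grp" "c > 0" "smooth_on I \<phi>" "\<And>t. t \<in> I \<Longrightarrow> \<phi> t \<noteq> 0"
      "\<And>t. t \<in> I \<Longrightarrow> deriv \<phi> t \<noteq> 0" "\<And>t. t \<in> I \<Longrightarrow> \<gamma> t = act k (expo_coords (circle_curve i1 i2 c (\<phi> t)))"
    have "open I" using a(1) by (simp add: open_interval_def)
    from circle_curve_conformal_circle[OF assms a(3) this a(4,5,6)]
    show "(I, \<gamma>) \<in> conformal_circles" by (rule conformal_circlesI[OF a(1,2) _ a(7)])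
  qed
qed

text \<open>\<open>f1\<close> and \<open>f2\<close> are the first two derivatives of the parameter change.\<close>

definition orbit_jets :: "'n::finite \<Rightarrow> 'n \<Rightarrow> ('n coords \<times> 'n coords \<times> 'n coords) set" where
  "orbit_jets i1 i2 = {(x, v, a). \<exists>h\<in>K_grp. \<exists>c t f1 f2. c > 0 \<and> t \<noteq> 0 \<and> f1 \<noteq> 0 \<and>
     Phi x = h ** Phi (circle_curve i1 i2 c t) ** matrix_inv h \<and>
     dPhi x v = h ** dPhi (circle_curve i1 i2 c t) (f1 *\<^sub>R curve_d1 i1 i2 c t) ** matrix_inv h \<and>
     dPhi x (a + Gam x v v) = h ** dPhi (circle_curve i1 i2 c t)
       (f1^2 *\<^sub>R curve_d2 i1 i2 c t + f2 *\<^sub>R curve_d1 i1 i2 c t) ** matrix_inv h}"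

text \<open>The \<open>None\<close> row of \<open>Phi x\<close> is \<open>qvec x\<close>, which is
  not zero; on the right that row carries the factor \<open>(h *v pvec z) $ None\<close>. A
  conjugate that is again in the chart thus keeps this entry away from zero.\<close>

lemma Phi_conj_nonzero:
  fixes x z :: "'n::finite coords"
  assumes "Phi x = h ** Phi z ** h'"
  shows "(h *v pvec z) $ None \<noteq> 0"
proof
  assume 0: "(h *v pvec z) $ None = 0"
  have e: "outer (pvec x) (qvec x) = outer (h *v pvec z) (qvec z v* h')"
    using assms unfolding Phi_def mult_outer outer_mult_right .
  have "qvec x $ i = outer (pvec x) (qvec x) $ None $ i" for i by (simp add: pvec_def)
  then have "qvec x $ i = 0" for i unfolding e by (simp add: 0)
  then have "qvec x = 0" by (simp add: vec_eq_iff)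
  then show False using frame_inner(1)[of x] by simp
qed

text \<open>Seen in the chart of \<open>k\<close>, a translate by \<open>k'\<close> is conjugation
  by \<open>k^-1 k'\<close>, and a parameter change acts through its first two derivatives.
  Conversely a translate by \<open>k ** h\<close> of a quadratically reparametrized curve realizes
  the prescribed data.\<close>

lemma jets2_K_orbit:
  assumes i12: "i1 \<noteq> i2" and k: "k \<in> K_grp"
  shows "jets2 k (K_orbit (circle_curve i1 i2)) = orbit_jets i1 i2"
proof (intro equalityI subsetI)
  fix j assume "j \<in> jets2 k (K_orbit (circle_curve i1 i2))"
  then obtain x t I \<gamma> T where j: "j = (x t, velocity x t, velocity (velocity x) t)"
    and C: "(I, \<gamma>) \<in> K_orbit (circle_curve i1 i2)" and T: "open T" "t \<in> T" "T \<subseteq> I"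
    and x: "smooth_on T x" and \<gamma>: "\<And>s. s \<in> T \<Longrightarrow> \<gamma> s = act k (expo_coords (x s))"
    unfolding jets2_def by blast
  from C show "j \<in> orbit_jets i1 i2"
  proof (rule K_orbitE)
    fix k' c \<phi>
    assume a: "open_interval I" "k' \<in> K_grp" and c: "c > 0" and \<phi>: "smooth_on I \<phi>" "\<And>t. t \<in> I \<Longrightarrow> \<phi> t \<noteq> 0"
      "\<And>t. t \<in> I \<Longrightarrow> deriv \<phi> t \<noteq> 0" and \<gamma>': "\<And>t. t \<in> I \<Longrightarrow> \<gamma> t = act k' (expo_coords (circle_curve i1 i2 c (\<phi> t)))"
    have I: "open I" "t \<in> I" using a(1) T by (auto simp: open_interval_def)
    let ?h = "matrix_inv k ** k'"
    have h: "?h \<in> K_grp" by (intro K_grp_mult K_grp_inv k a)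
    have eq: "Phi (x s) = ?h ** Phi (circle_curve i1 i2 c (\<phi> s)) ** matrix_inv ?h" if "s \<in> T" for s
      using act_expo_transition[OF k a(2), of "x s" "circle_curve i1 i2 c (\<phi> s)"] \<gamma>[OF that] \<gamma>'[of s] that T
      by auto
    note D = smooth_on_real_derivative[OF I(1) \<phi>(1)]
    have w1: "((\<lambda>s. circle_curve i1 i2 c (\<phi> s)) has_vector_derivative
        velocity \<phi> s *\<^sub>R curve_d1 i1 i2 c (\<phi> s)) (at s)" if "s \<in> T" for s
      using that T(3) by (intro circle_curve_compose_derivative i12 c \<phi>(2) D(1)) auto
    note w2 = curve_d1_compose_derivative[where \<phi>=\<phi> and ?f1.0="velocity \<phi>" and ?f2.0="velocity (velocity \<phi>)",
        OF i12 c \<phi>(2) D(1,2), OF I(2) I(2) I(2)]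
    note tr = jet_transform[OF T(1,2) K_grp_inv(2)[OF h] eq smooth_on_2jet(1)[OF x T(1)] smooth_on_2jet(2)[OF x T(1,2)] w1 w2]
    have "velocity \<phi> t \<noteq> 0" using \<phi>(3)[OF I(2)] D(4)[OF I(2)] by simp
    with tr eq[OF T(2)] h c \<phi>(2)[OF I(2)] show "j \<in> orbit_jets i1 i2"
      unfolding j orbit_jets_def by (simp del: split_paired_Ex) (rule bexI[OF _ h], rule exI[of _ c], rule conjI[OF c],
        rule exI[of _ "\<phi> t"], simp, rule exI[of _ "velocity \<phi> t"], simp, rule exI[of _ "velocity (velocity \<phi>) t"], simp)
  qed
next
  fix j assume "j \<in> orbit_jets i1 i2"
  then obtain x v a h c t f1 f2 where j: "j = (x, v, a)" and h: "h \<in> K_grp" and c: "c > 0" and t: "t \<noteq> 0" and f1: "f1 \<noteq> 0"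
    and e0: "Phi x = h ** Phi (circle_curve i1 i2 c t) ** matrix_inv h"
    and e1: "dPhi x v = h ** dPhi (circle_curve i1 i2 c t) (f1 *\<^sub>R curve_d1 i1 i2 c t) ** matrix_inv h"
    and e2: "dPhi x (a + Gam x v v) = h ** dPhi (circle_curve i1 i2 c t)
       (f1^2 *\<^sub>R curve_d2 i1 i2 c t + f2 *\<^sub>R curve_d1 i1 i2 c t) ** matrix_inv h"
    unfolding orbit_jets_def by auto
  \<comment> \<open>The Taylor polynomial with value \<open>t\<close> and derivatives
    \<open>f1\<close>, \<open>f2\<close> at 0.\<close>
  define \<phi> where "\<phi> s = t + f1 * s + f2 / 2 * s^2" for s
  define S0 where "S0 = {s. \<phi> s \<noteq> 0} \<inter> {s. f1 + f2 * s \<noteq> 0}"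
  define w where "w s = circle_curve i1 i2 c (\<phi> s)" for s
  \<comment> \<open>The times at which the parameter change is regular and the translated curve is
    still in the chart.\<close>
  define S where "S = S0 \<inter> (\<lambda>s. (h *v pvec (w s)) $ None) -` (- {0})"
  have \<phi>s: "smooth_on UNIV \<phi>" unfolding smooth_on_def \<phi>_def
    by (intro allI Ck_on_add Ck_on_mult Ck_on_const Ck_on_power Ck_on_ident open_UNIV)
  have d\<phi>: "(\<phi> has_real_derivative f1 + f2 * s) (at s)" "((\<lambda>s. f1 + f2 * s) has_real_derivative f2) (at s)" for s
    unfolding \<phi>_def by (auto intro!: derivative_eq_intros)
  have S0: "open S0" unfolding S0_def \<phi>_def
    by (intro open_Int open_Collect_neq continuous_intros)
  have ws: "smooth_on S0 w" unfolding w_def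
    by (rule smooth_on_circle_curve[OF i12 c S0 smooth_on_subset[OF \<phi>s]]) (auto simp: S0_def)
  have "Ck_on 0 S0 w" using ws unfolding smooth_on_def by blast
  then have "Ck_on 0 S0 (\<lambda>s. (h *v pvec (w s)) $ None)"
    by (intro Ck_on_nth Ck_on_matrix_vector S0 Ck_on_pvec)
  then have "continuous_on S0 (\<lambda>s. (h *v pvec (w s)) $ None)" by simp
  then have S: "open S" unfolding S_def by (rule continuous_open_preimage[OF _ S0]) auto
  have S_D: "\<phi> s \<noteq> 0" "f1 + f2 * s \<noteq> 0" "(h *v pvec (w s)) $ None \<noteq> 0" if "s \<in> S" for s
    using that by (auto simp: S_def S0_def)
  have w0: "w 0 = circle_curve i1 i2 c t" by (simp add: w_def \<phi>_def)
  have "0 \<in> S" using t f1 Phi_conj_nonzero[OF e0] by (simp add: S_def S0_def w0) (simp add: \<phi>_def)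
  then obtain d where d: "d > 0" "ball 0 d \<subseteq> S" using S open_contains_ball by blast
  let ?I = "{-d<..<d}"
  have I: "?I \<subseteq> S" "0 \<in> ?I" using d by (auto simp: ball_eq_greaterThanLessThan)
  define X where "X s = chart_act h (w s)" for s
  have XP: "Phi (X s) = h ** Phi (w s) ** matrix_inv h" if "s \<in> ?I" for s
    unfolding X_def using S_D(3)[OF subsetD[OF I(1) that]] by (rule Phi_chart_act[OF K_grp_inv(2)[OF h]])
  have kh: "k ** h \<in> K_grp" by (rule K_grp_mult[OF k h])
  have kkh: "matrix_inv k ** (k ** h) = h" by (simp add: matrix_mul_assoc K_grp_inv[OF k])
  have "open_interval ?I" using d(1) by (auto simp: open_interval_def)
  moreover have "\<phi> s \<noteq> 0 \<and> deriv \<phi> s \<noteq> 0" if "s \<in> ?I" for s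
    unfolding DERIV_imp_deriv[OF d\<phi>(1)] using S_D(1,2)[OF subsetD[OF I(1) that]] by blast
  ultimately have F: "(?I, \<lambda>s. act (k ** h) (expo_coords (w s))) \<in> K_orbit (circle_curve i1 i2)"
    unfolding w_def by (rule K_orbitI[OF _ kh c smooth_on_subset[OF \<phi>s subset_UNIV] _ refl])
  have "S \<subseteq> S0" by (auto simp: S_def)
  then have Xs: "smooth_on ?I X" unfolding X_def
    by (intro smooth_on_chart_act smooth_on_subset[OF ws] S_D(3)) (use I in auto)
  have "act (k ** h) (expo_coords (w s)) = act k (expo_coords (X s))" if "s \<in> ?I" for s
    using act_expo_transition[OF k kh, of "X s" "w s"] XP[OF that] by (simp add: kkh)
  from jets2I[OF F open_greaterThanLessThan I(2) order_refl Xs this]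
  have jX: "(X 0, velocity X 0, velocity (velocity X) 0) \<in> jets2 k (K_orbit (circle_curve i1 i2))" .
  have X0: "X 0 = x" by (rule Phi_inject) (simp add: XP[OF I(2)] e0 w0)
  have w1: "(w has_vector_derivative (f1 + f2 * s) *\<^sub>R curve_d1 i1 i2 c (\<phi> s)) (at s)" if "s \<in> ?I" for s
    unfolding w_def[abs_def] using S_D(1) I that by (intro circle_curve_compose_derivative i12 c d\<phi>(1)) auto
  have p0: "\<phi> 0 = t" by (simp add: \<phi>_def)
  have w2: "((\<lambda>s. (f1 + f2 * s) *\<^sub>R curve_d1 i1 i2 c (\<phi> s)) has_vector_derivative
      (f1^2 *\<^sub>R curve_d2 i1 i2 c t + f2 *\<^sub>R curve_d1 i1 i2 c t)
      - Gam (circle_curve i1 i2 c t) (f1 *\<^sub>R curve_d1 i1 i2 c t) (f1 *\<^sub>R curve_d1 i1 i2 c t)) (at 0)"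
    using curve_d1_compose_derivative[where \<phi>=\<phi> and ?f1.0="\<lambda>s. f1 + f2 * s" and ?f2.0="\<lambda>s. f2" and s=0, OF i12 c _ d\<phi>] t
    by (simp add: p0)
  note tr = jet_transform[OF open_greaterThanLessThan I(2) K_grp_inv(2)[OF h] XP smooth_on_2jet(1)[OF Xs open_greaterThanLessThan]
      smooth_on_2jet(2)[OF Xs open_greaterThanLessThan I(2)] w1 w2]
  have v: "velocity X 0 = v" using tr(1) by (simp add: X0 p0 w0 e1[symmetric] dPhi_inject)
  have "velocity (velocity X) 0 = a" using tr(2) by (simp add: X0 v p0 w0 e2[symmetric] dPhi_inject)
  with jX X0 v show "j \<in> jets2 k (K_orbit (circle_curve i1 i2))" unfolding j by simp
qed

section \<open>Jets of the orbit\<close>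

lemma submanifold_open: "open W \<Longrightarrow> submanifold DIM('a) W" for W :: "'a::euclidean_space set"
  unfolding submanifold_def by (intro conjI ballI exI[of _ W]) auto

lemma submanifold_hypersurface:
  fixes f :: "'a::euclidean_space \<Rightarrow> real"
  assumes W: "open W" and f: "smooth_on W f"
    and reg: "\<And>q. q \<in> W \<Longrightarrow> \<exists>v. frechet_derivative f (at q) v \<noteq> 0"
  shows "submanifold (DIM('a) - 1) {q \<in> W. f q = 0}"
proof -
  have D: "DIM('a) - (DIM('a) - 1) = 1" by (simp add: Suc_leI)
  have indep: "\<forall>i<1. c i = (0::real)"
    if q: "q \<in> W" and 0: "\<forall>v. (\<Sum>i<1::nat. c i * frechet_derivative f (at q) v) = 0" for q c
  proof -
    obtain v where "frechet_derivative f (at q) v \<noteq> 0" using reg[OF q] by blast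
    with 0[rule_format, of v] show ?thesis by simp
  qed
  have main: "open W \<and> p \<in> W \<and> (\<forall>i<1::nat. smooth_on W f) \<and>
        (\<forall>q\<in>W. \<forall>c :: nat \<Rightarrow> real. (\<forall>v. (\<Sum>i<1. c i * frechet_derivative f (at q) v) = 0)
           \<longrightarrow> (\<forall>i<1. c i = 0)) \<and>
        {q \<in> W. f q = 0} \<inter> W = {q \<in> W. \<forall>i<1::nat. f q = 0}" if "p \<in> {q \<in> W. f q = 0}" for p
  proof (intro conjI ballI allI impI W f)
    show "p \<in> W" using that by simp
    show "{q \<in> W. f q = 0} \<inter> W = {q \<in> W. \<forall>i<1::nat. f q = 0}" by auto
  qed (use indep in blast)
  show ?thesis unfolding submanifold_def D
    by (intro conjI ballI, simp, rule exI[of _ W], rule exI[of _ "\<lambda>_. f"], erule main)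
qed

section \<open>The invariant hypersurface of 2-jets\<close>

type_synonym 'n jet = "'n coords \<times> 'n coords \<times> 'n coords"

definition jx :: "'n::finite jet \<Rightarrow> 'n coords" where "jx z = fst z"
definition jv :: "'n::finite jet \<Rightarrow> 'n coords" where "jv z = fst (snd z)"
text \<open>The covariant acceleration replaces the coordinate one, since it is what conjugation
  transforms like a tangent vector.\<close>

definition jA :: "'n::finite jet \<Rightarrow> 'n coords" where "jA z = snd (snd z) + Gam (fst z) (fst (snd z)) (fst (snd z))"

lemma Ck_on_jet:
  assumes "open W"
  shows "Ck_on k W jx" "Ck_on k W jv" "Ck_on k W jA"
  unfolding jx_def[abs_def] jv_def[abs_def] jA_def[abs_def]
  by (intro Ck_on_add Ck_on_Gam Ck_on_fst Ck_on_snd Ck_on_ident assms)+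

lemma Ck_on_bet:
  assumes "open S" "Ck_on k S x" "Ck_on k S v" "Ck_on k S w"
  shows "Ck_on k S (\<lambda>s. bet (x s) (v s) (w s))"
  unfolding bet_def by (intro Ck_on_intros Ck_on_xpart Ck_on_ypart assms)

lemma bet_linear:
  "bet z (v + v') w = bet z v w + bet z v' w" "bet z v (w + w') = bet z v w + bet z v w'"
  "bet z (c *\<^sub>R v) w = c * bet z v w" "bet z v (c *\<^sub>R w) = c * bet z v w"
  by (simp_all add: bet_def inner_add_left inner_add_right algebra_simps)

text \<open>The para-Kaehler form on velocity and covariant acceleration: the vanishing of this single invariant is
  what cuts the jets of the family out of all jets.\<close>

definition kform :: "'n::finite jet \<Rightarrow> real" where
  "kform z = bet (jx z) (jv z) (jA z) - bet (jx z) (jA z) (jv z)"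

lemma smooth_on_kform: "open W \<Longrightarrow> smooth_on W kform"
  unfolding smooth_on_def kform_def[abs_def]
  by (intro allI Ck_on_diff Ck_on_bet Ck_on_jet)

lemma kform_regular:
  fixes z :: "'a::finite jet"
  assumes "bet (jx z) (jv z) (jv z) \<noteq> 0"
  shows "\<exists>w. frechet_derivative kform (at z) w \<noteq> 0"
proof -
  let ?v = "jv z"
  \<comment> \<open>The function is affine in the acceleration; in this direction its slope is the
    Euclidean square norm of the velocity, positive since \<open>?v\<close> is nonzero.\<close>
  define b where "b = join (- ypart ?v) (xpart ?v)"
  define w :: "'a jet" where "w = (0, 0, b)"
  have "Ck_on (Suc 0) UNIV (kform :: 'a jet \<Rightarrow> real)" using smooth_on_kform[OF open_UNIV] unfolding smooth_on_def by blast
  then have D: "(kform has_derivative frechet_derivative kform (at z)) (at z)"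
    by (rule Ck_on_Suc_has_derivative) simp
  have line: "kform (z + s *\<^sub>R w) = kform z + s * (ypart ?v \<bullet> ypart ?v + xpart ?v \<bullet> xpart ?v)" for s
    by (cases z) (simp add: kform_def jx_def jv_def jA_def w_def b_def bet_def inner_add_left inner_add_right
        inner_commute algebra_simps)
  have "((\<lambda>s. z + s *\<^sub>R w) has_vector_derivative w) (at 0)"
    by (auto intro!: derivative_eq_intros)
  then have "((\<lambda>s. kform (z + s *\<^sub>R w)) has_vector_derivative frechet_derivative kform (at z) w) (at 0)"
    using vector_derivative_diff_chain_within[of "\<lambda>s. z + s *\<^sub>R w" w 0 UNIV kform "frechet_derivative kform (at z)"] D
    by (simp add: o_def has_derivative_at_withinI)
  moreover have "((\<lambda>s. kform (z + s *\<^sub>R w)) has_vector_derivative (ypart ?v \<bullet> ypart ?v + xpart ?v \<bullet> xpart ?v)) (at 0)"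
    unfolding line by (auto intro!: derivative_eq_intros)
  ultimately have "frechet_derivative kform (at z) w = ypart ?v \<bullet> ypart ?v + xpart ?v \<bullet> xpart ?v"
    using vector_derivative_unique_at by blast
  moreover have "\<not> (ypart ?v = 0 \<and> xpart ?v = 0)"
    using assms by (auto simp: bet_def)
  then have "ypart ?v \<bullet> ypart ?v + xpart ?v \<bullet> xpart ?v \<noteq> 0"
    by (metis add_nonneg_eq_0_iff inner_eq_zero_iff inner_ge_zero)
  ultimately show ?thesis by metis
qed

lemma open_bet_nonzero: "open {z :: 'n::finite jet. bet (jx z) (jv z) (jv z) \<noteq> 0}"
proof -
  have "Ck_on 0 UNIV (\<lambda>z :: 'n jet. bet (jx z) (jv z) (jv z))"
    by (intro Ck_on_bet Ck_on_jet open_UNIV)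
  then show ?thesis by (intro open_Collect_neq continuous_on_const) simp
qed

lemma kform_submanifold:
  assumes "open W" "\<And>z. z \<in> W \<Longrightarrow> bet (jx z) (jv z) (jv z) \<noteq> 0"
  shows "submanifold (DIM('n::finite jet) - 1) {z \<in> W. kform (z :: 'n jet) = 0}"
  using submanifold_hypersurface[OF assms(1) smooth_on_kform[OF assms(1)] kform_regular[OF assms(2)]] .

lemma orbit_jetsI:
  assumes "h \<in> K_grp" "c > 0" "t \<noteq> 0" "f1 \<noteq> 0"
     "Phi (jx z) = h ** Phi (circle_curve i1 i2 c t) ** matrix_inv h"
     "dPhi (jx z) (jv z) = h ** dPhi (circle_curve i1 i2 c t) (f1 *\<^sub>R curve_d1 i1 i2 c t) ** matrix_inv h"
     "dPhi (jx z) (jA z) = h ** dPhi (circle_curve i1 i2 c t)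
       (f1^2 *\<^sub>R curve_d2 i1 i2 c t + f2 *\<^sub>R curve_d1 i1 i2 c t) ** matrix_inv h"
   shows "z \<in> orbit_jets i1 i2"
proof -
  obtain x v a where z: "z = (x, v, a)" by (cases z)
  show ?thesis using assms(5-7) unfolding z orbit_jets_def jx_def jv_def jA_def
    by (simp del: split_paired_Ex) (rule bexI[OF _ assms(1)], rule exI[of _ c], rule conjI[OF assms(2)], rule exI[of _ t],
      rule conjI[OF assms(3)], rule exI[of _ f1], rule conjI[OF assms(4)], simp, rule exI[of _ f2], simp)
qed

lemma orbit_jetsE:
  assumes "z \<in> orbit_jets i1 i2"
  obtains h c t f1 f2 where "h \<in> K_grp" "c > 0" "t \<noteq> 0" "f1 \<noteq> 0"
     "Phi (jx z) = h ** Phi (circle_curve i1 i2 c t) ** matrix_inv h"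
     "dPhi (jx z) (jv z) = h ** dPhi (circle_curve i1 i2 c t) (f1 *\<^sub>R curve_d1 i1 i2 c t) ** matrix_inv h"
     "dPhi (jx z) (jA z) = h ** dPhi (circle_curve i1 i2 c t)
       (f1^2 *\<^sub>R curve_d2 i1 i2 c t + f2 *\<^sub>R curve_d1 i1 i2 c t) ** matrix_inv h"
  using assms that unfolding orbit_jets_def jx_def jv_def jA_def by auto

lemma orbit_jets_kform:
  assumes i12: "i1 \<noteq> i2" and z: "z \<in> orbit_jets i1 i2"
  shows "bet (jx z) (jv z) (jv z) \<noteq> 0" "kform z = 0"
proof -
  from z obtain h c t f1 f2 where h: "h \<in> K_grp" and c: "c > 0" and t: "t \<noteq> 0" "f1 \<noteq> 0"
    and e: "Phi (jx z) = h ** Phi (circle_curve i1 i2 c t) ** matrix_inv h"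
     "dPhi (jx z) (jv z) = h ** dPhi (circle_curve i1 i2 c t) (f1 *\<^sub>R curve_d1 i1 i2 c t) ** matrix_inv h"
     "dPhi (jx z) (jA z) = h ** dPhi (circle_curve i1 i2 c t)
       (f1^2 *\<^sub>R curve_d2 i1 i2 c t + f2 *\<^sub>R curve_d1 i1 i2 c t) ** matrix_inv h"
    by (rule orbit_jetsE)
  note B = bet_conj[OF K_grp_inv(2)[OF h] e(1)] and b = curve_bet[OF i12 c t(1)]
  show "bet (jx z) (jv z) (jv z) \<noteq> 0" unfolding B[OF e(2,2)] using t c by (simp add: bet_linear b)
  show "kform z = 0" unfolding kform_def B[OF e(2,3)] B[OF e(3,2)] using t c by (simp add: bet_linear b algebra_simps)
qed

text \<open>A rank-one projection determines its column and row vectors up to reciprocal factors;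
  \<open>\<mu>\<close> is that factor, read off at the \<open>None\<close> entry.\<close>

lemma Phi_conj_frame:
  fixes x z :: "'n::finite coords"
  assumes "Phi x = h ** Phi z ** h'"
  defines "\<mu> \<equiv> (h *v pvec z) $ None"
  shows "\<mu> \<noteq> 0" "h *v pvec z = \<mu> *\<^sub>R pvec x" "qvec z v* h' = (1 / \<mu>) *\<^sub>R qvec x"
proof -
  let ?m = "h *v pvec z" and ?n = "qvec z v* h'"
  show 0: "\<mu> \<noteq> 0" unfolding \<mu>_def by (rule Phi_conj_nonzero[OF assms(1)])
  have e: "outer (pvec x) (qvec x) = outer ?m ?n"
    using assms(1) unfolding Phi_def mult_outer outer_mult_right .
  have "qvec x $ i = outer (pvec x) (qvec x) $ None $ i" for i by (simp add: pvec_def)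
  then have "qvec x $ i = \<mu> * ?n $ i" for i unfolding e by (simp add: \<mu>_def)
  then have q: "qvec x = \<mu> *\<^sub>R ?n" by (simp add: vec_eq_iff)
  then show "?n = (1 / \<mu>) *\<^sub>R qvec x" using 0 by simp
  have "pvec x = outer (pvec x) (qvec x) *v pvec x" by (simp add: outer_vec)
  then have p: "pvec x = (?n \<bullet> pvec x) *\<^sub>R ?m" unfolding e outer_vec .
  then have "pvec x $ None = ((?n \<bullet> pvec x) *\<^sub>R ?m) $ None" by simp
  then have "(?n \<bullet> pvec x) * \<mu> = 1" by (simp add: pvec_def \<mu>_def)
  then have "\<mu> *\<^sub>R ((?n \<bullet> pvec x) *\<^sub>R ?m) = ?m" by (simp add: mult.commute)
  then show "?m = \<mu> *\<^sub>R pvec x" using p by metis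
qed

lemma xi_eta_surj:
  assumes "qvec x \<bullet> \<xi> = 0" "\<eta> \<bullet> pvec x = 0"
  obtains v where "xi x v = \<xi>" "eta x v = \<eta>"
proof -
  define s where "s = \<xi> $ None"
  define v where "v = join ((\<chi> i. \<xi> $ Some i) - s *\<^sub>R xpart x) (s *\<^sub>R ypart x - (\<chi> i. \<eta> $ Some i))"
  have xi': "\<xi> = emb s (\<chi> i. \<xi> $ Some i)" by (rule vec_option_eqI) (simp_all add: s_def)
  have eta': "\<eta> = emb (\<eta> $ None) (\<chi> i. \<eta> $ Some i)" by (rule vec_option_eqI) simp_all
  have 1: "ypart x \<bullet> (\<chi> i. \<xi> $ Some i) = (1 + xpart x \<bullet> ypart x) * s"
    using assms(1) by (subst (asm) xi') (simp add: qvec_def)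
  then have s: "ypart x \<bullet> xpart v = s" by (simp add: v_def inner_diff_right inner_commute algebra_simps)
  have 2: "\<eta> $ None = - ((\<chi> i. \<eta> $ Some i) \<bullet> xpart x)"
    using assms(2) by (subst (asm) eta') (simp add: pvec_def)
  have "xi x v = \<xi>" by (rule vec_option_eqI) (simp_all add: xi_def s, simp_all add: s_def v_def)
  moreover have "eta x v = \<eta>"
    by (rule vec_option_eqI) (simp_all add: eta_def Let_def s, simp_all add: v_def 2 inner_commute)
  ultimately show ?thesis using that by blast
qed

text \<open>Conjugation preserves the relations \<open>q \<bullet> \<xi> = 0\<close> and
  \<open>\<eta> \<bullet> p = 0\<close>, and by \<open>xi_eta_surj\<close> every such pair comes
  from a tangent vector.\<close>

lemma dPhi_conj_surj:
  fixes x z :: "'n::finite coords"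
  assumes e: "Phi x = h ** Phi z ** h'" and h: "h' ** h = mat 1"
  obtains v where "dPhi x v = h ** dPhi z u ** h'"
proof -
  define \<mu> where "\<mu> = (h *v pvec z) $ None"
  note f = Phi_conj_frame[OF e, folded \<mu>_def]
  have qp: "(a v* h') \<bullet> (h *v b) = a \<bullet> b" for a b
    by (simp add: dot_lmul_matrix matrix_vector_mul_assoc h)
  have q: "qvec x = \<mu> *\<^sub>R (qvec z v* h')" using f(1) by (simp add: f(3))
  have p: "pvec x = (1 / \<mu>) *\<^sub>R (h *v pvec z)" using f(1) by (simp add: f(2))
  obtain v where v: "xi x v = (1 / \<mu>) *\<^sub>R (h *v xi z u)" "eta x v = \<mu> *\<^sub>R (eta z u v* h')"
    by (rule xi_eta_surj[of x "(1 / \<mu>) *\<^sub>R (h *v xi z u)" "\<mu> *\<^sub>R (eta z u v* h')"])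
      (simp_all add: q p qp)
  have "dPhi x v = h ** dPhi z u ** h'"
    unfolding dPhi_def v q p using f(1)
    by (simp add: matrix_algebra mult_outer outer_mult_right outer_linear)
  then show ?thesis by (rule that)
qed

section \<open>Jets with equal invariants\<close>

text \<open>The coefficients \<open>d, -b, -b, a\<close> over \<open>a * d - b^2\<close> form the
  inverse of the Gram matrix. If both frames have that Gram matrix, the operator carries the frame
  dual to \<open>q, e0, e1\<close> to \<open>p, x0, x1\<close>; with a single frame it is the
  projection onto its span.\<close>

definition frame_op :: "real \<Rightarrow> real \<Rightarrow> real \<Rightarrow> real^'m \<Rightarrow> real^'m \<Rightarrow> real^'m \<Rightarrow>
    real^'m \<Rightarrow> real^'m \<Rightarrow> real^'m \<Rightarrow> real^'m::finite^'m" where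
  "frame_op a b d p x0 x1 q e0 e1 = outer p q + (1 / (a * d - b^2)) *\<^sub>R
     (d *\<^sub>R outer x0 e0 - b *\<^sub>R outer x0 e1 - b *\<^sub>R outer x1 e0 + a *\<^sub>R outer x1 e1)"

text \<open>A single \<open>b\<close> for both mixed pairings encodes
  \<open>\<omega>(v,a) = 0\<close>.\<close>

definition dual_frame :: "real \<Rightarrow> real \<Rightarrow> real \<Rightarrow> real^'m \<Rightarrow> real^'m \<Rightarrow> real^'m \<Rightarrow>
    real^'m \<Rightarrow> real^'m \<Rightarrow> real^'m::finite \<Rightarrow> bool" where
  "dual_frame a b d p x0 x1 q e0 e1 \<longleftrightarrow> q \<bullet> p = 1 \<and> q \<bullet> x0 = 0 \<and> q \<bullet> x1 = 0 \<and> e0 \<bullet> p = 0 \<and> e1 \<bullet> p = 0 \<and>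
     e0 \<bullet> x0 = a \<and> e0 \<bullet> x1 = b \<and> e1 \<bullet> x0 = b \<and> e1 \<bullet> x1 = d"

lemma frame_op_apply:
  assumes "a * d - b^2 \<noteq> 0" "dual_frame a b d p' x0' x1' q e0 e1"
  shows "frame_op a b d p x0 x1 q e0 e1 *v p' = p" "frame_op a b d p x0 x1 q e0 e1 *v x0' = x0"
    "frame_op a b d p x0 x1 q e0 e1 *v x1' = x1"
proof -
  have *: "frame_op a b d p x0 x1 q e0 e1 *v w = (q \<bullet> w) *\<^sub>R p
     + ((d * (e0 \<bullet> w) - b * (e1 \<bullet> w)) / (a * d - b^2)) *\<^sub>R x0
     + ((a * (e1 \<bullet> w) - b * (e0 \<bullet> w)) / (a * d - b^2)) *\<^sub>R x1" for w
    by (simp add: frame_op_def matrix_vector_mult_add_rdistrib matrix_vector_mult_diff_rdistrib outer_vec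
        scaleR_matrix_vector_assoc[symmetric] diff_divide_distrib algebra_simps)
  show "frame_op a b d p x0 x1 q e0 e1 *v p' = p" "frame_op a b d p x0 x1 q e0 e1 *v x0' = x0"
    "frame_op a b d p x0 x1 q e0 e1 *v x1' = x1"
    using assms unfolding * dual_frame_def by (simp_all add: power2_eq_square mult.commute)
qed

lemma apply_frame_op:
  assumes "a * d - b^2 \<noteq> 0" "dual_frame a b d p x0 x1 q' e0' e1'"
  shows "q' v* frame_op a b d p x0 x1 q e0 e1 = q" "e0' v* frame_op a b d p x0 x1 q e0 e1 = e0"
    "e1' v* frame_op a b d p x0 x1 q e0 e1 = e1"
proof -
  have *: "w v* frame_op a b d p x0 x1 q e0 e1 = (w \<bullet> p) *\<^sub>R q
     + ((d * (w \<bullet> x0) - b * (w \<bullet> x1)) / (a * d - b^2)) *\<^sub>R e0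
     + ((a * (w \<bullet> x1) - b * (w \<bullet> x0)) / (a * d - b^2)) *\<^sub>R e1" for w
  proof -
    have t: "w v* frame_op a b d p x0 x1 q e0 e1 = frame_op a b d q e0 e1 p x0 x1 *v w"
    proof -
      have "transpose (frame_op a b d p x0 x1 q e0 e1) = frame_op a b d q e0 e1 p x0 x1"
        by (simp add: frame_op_def transpose_def vec_eq_iff algebra_simps)
      then show ?thesis by (metis transpose_matrix_vector)
    qed
    show ?thesis unfolding t
      by (simp add: frame_op_def matrix_vector_mult_add_rdistrib matrix_vector_mult_diff_rdistrib outer_vec
        scaleR_matrix_vector_assoc[symmetric] diff_divide_distrib inner_commute algebra_simps)
  qed
  show "q' v* frame_op a b d p x0 x1 q e0 e1 = q" "e0' v* frame_op a b d p x0 x1 q e0 e1 = e0"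
    "e1' v* frame_op a b d p x0 x1 q e0 e1 = e1"
    using assms unfolding * dual_frame_def by (simp_all add: power2_eq_square mult.commute)
qed

lemma frame_op_conj:
  "frame_op a b d (r *\<^sub>R (h *v p)) (r *\<^sub>R (h *v x0)) (r *\<^sub>R (h *v x1)) q e0 e1
     = r *\<^sub>R (h ** frame_op a b d p x0 x1 q e0 e1)"
  "frame_op a b d p x0 x1 (s *\<^sub>R (q v* h)) (s *\<^sub>R (e0 v* h)) (s *\<^sub>R (e1 v* h))
     = s *\<^sub>R (frame_op a b d p x0 x1 q e0 e1 ** h)"
  by (simp_all add: frame_op_def matrix_algebra mult_outer outer_mult_right outer_linear algebra_simps)

text \<open>\<open>R\<close> carries one frame to another with the same Gram matrix; the second summand only fills in the complement.
  When \<open>h\<close> itself carries a nearby frame to a nearby one, the result is close to \<open>h\<close>, hence invertible.\<close>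

definition frame_map :: "real \<Rightarrow> real^'m^'m \<Rightarrow> real^'m^'m \<Rightarrow> real^'m^'m \<Rightarrow> real^'m^'m \<Rightarrow> real^'m::finite^'m" where
  "frame_map \<mu> h R Et Es = \<mu> *\<^sub>R R + (mat 1 - Et) ** h ** (mat 1 - Es)"

text \<open>The complementary summand vanishes on the source vectors and on the target covectors.
  Thus \<open>F\<close> multiplies vectors by \<open>\<mu>\<close>, its inverse multiplies covectors
  by \<open>1 / \<mu>\<close>, and the factors cancel in the conjugated matrices.\<close>

lemma frame_map_conj:
  fixes h :: "real^'m::finite^'m"
  assumes nz: "a * d - b^2 \<noteq> 0"
    and t: "dual_frame a b d p x0 x1 q e0 e1" and s: "dual_frame a b d p' x0' x1' q' e0' e1'"
    and mu: "\<mu> \<noteq> 0"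
  defines "F \<equiv> frame_map \<mu> h (frame_op a b d p x0 x1 q' e0' e1') (frame_op a b d p x0 x1 q e0 e1)
      (frame_op a b d p' x0' x1' q' e0' e1')"
  assumes inv: "F ** F' = mat 1"
  shows "F ** outer p' q' ** F' = outer p q"
    "F ** (outer x0' q' + outer p' e0') ** F' = outer x0 q + outer p e0"
    "F ** (outer x1' q' + outer p' e1') ** F' = outer x1 q + outer p e1"
proof -
  have ann: "(mat 1 - Et) ** h ** (mat 1 - Es) *v w = 0" if "Es *v w = w" for w :: "real^'m" and Et Es
    by (simp add: matrix_vector_mul_assoc[symmetric] matrix_vector_mult_diff_rdistrib that)
  have ann': "w v* ((mat 1 - Et) ** h ** (mat 1 - Es)) = 0" if "w v* Et = w" for w :: "real^'m" and Et Es
    by (simp add: vector_matrix_mul_assoc[symmetric] vector_matrix_mult_diff_rdistrib that)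
  have 1: "F *v p' = \<mu> *\<^sub>R p" "F *v x0' = \<mu> *\<^sub>R x0" "F *v x1' = \<mu> *\<^sub>R x1"
    unfolding F_def frame_map_def matrix_vector_mult_add_rdistrib
    by (simp_all add: ann frame_op_apply[OF nz s] scaleR_matrix_vector_assoc[symmetric])
  have 2: "q v* F = \<mu> *\<^sub>R q'" "e0 v* F = \<mu> *\<^sub>R e0'" "e1 v* F = \<mu> *\<^sub>R e1'"
    unfolding F_def frame_map_def vector_matrix_mult_add_rdistrib
    by (simp_all add: ann' apply_frame_op[OF nz t] vector_scaleR_matrix_ac scaleR_vector_matrix_assoc[symmetric])
  have 3: "w' v* F' = (1 / \<mu>) *\<^sub>R w" if "w v* F = \<mu> *\<^sub>R w'" for w w'
  proof -
    have "\<mu> *\<^sub>R (w' v* F') = (w v* F) v* F'" unfolding that by (simp add: scaleR_vector_matrix_assoc)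
    also have "\<dots> = w" unfolding vector_matrix_mul_assoc inv by simp
    finally have "(1 / \<mu>) *\<^sub>R (\<mu> *\<^sub>R (w' v* F')) = (1 / \<mu>) *\<^sub>R w" by (rule arg_cong)
    then show ?thesis using mu by simp
  qed
  show "F ** outer p' q' ** F' = outer p q"
    "F ** (outer x0' q' + outer p' e0') ** F' = outer x0 q + outer p e0"
    "F ** (outer x1' q' + outer p' e1') ** F' = outer x1 q + outer p e1"
    using mu by (simp_all add: matrix_algebra mult_outer outer_mult_right 1 3[OF 2(1)] 3[OF 2(2)] 3[OF 2(3)] outer_linear)
qed

text \<open>If \<open>E\<close> projects onto the span of the source frame, the first summand
  becomes \<open>h ** E\<close>, the target projection is the conjugate of \<open>E\<close> by
  \<open>h\<close>, and the second summand reduces to \<open>h ** (mat 1 - E)\<close>.\<close>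

lemma frame_map_self:
  assumes nz: "a * d - b^2 \<noteq> 0" and s: "dual_frame a b d p' x0' x1' q' e0' e1'"
    and h: "h' ** h = mat 1" and mu: "\<mu> \<noteq> 0"
    and p: "p = (1 / \<mu>) *\<^sub>R (h *v p')" "x0 = (1 / \<mu>) *\<^sub>R (h *v x0')" "x1 = (1 / \<mu>) *\<^sub>R (h *v x1')"
    and q: "q = \<mu> *\<^sub>R (q' v* h')" "e0 = \<mu> *\<^sub>R (e0' v* h')" "e1 = \<mu> *\<^sub>R (e1' v* h')"
  shows "frame_map \<mu> h (frame_op a b d p x0 x1 q' e0' e1') (frame_op a b d p x0 x1 q e0 e1)
      (frame_op a b d p' x0' x1' q' e0' e1') = h"
proof -
  define E where "E = frame_op a b d p' x0' x1' q' e0' e1'"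
  have R: "frame_op a b d p x0 x1 q' e0' e1' = (1 / \<mu>) *\<^sub>R (h ** E)"
    unfolding p frame_op_conj E_def ..
  have Et: "frame_op a b d p x0 x1 q e0 e1 = h ** E ** h'"
    unfolding p q frame_op_conj E_def using mu by (simp add: matrix_scaleR_left)
  have EE: "E ** E = E"
    unfolding E_def
    by (subst (1 3) frame_op_def) (simp add: matrix_algebra outer_mult_right apply_frame_op[OF nz s])
  have "h ** E ** h' ** h = h ** E" by (simp add: matrix_mul_assoc[symmetric] h)
  moreover have "h ** E ** E = h ** E" by (simp add: matrix_mul_assoc[symmetric] EE)
  ultimately show ?thesis
    unfolding frame_map_def R Et E_def[symmetric] using mu by (simp add: matrix_algebra)
qed

lemma det_scaleR: "det (c *\<^sub>R A) = c ^ CARD('m) * det A" for A :: "real^'m::finite^'m"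
proof -
  have "c *\<^sub>R A = (\<chi> i. c *s A $ i)" by (simp add: vec_eq_iff)
  then show ?thesis using det_rows_mul[of "\<lambda>_. c" "\<lambda>i. A $ i"] by simp
qed

text \<open>Dividing by the root of the determinant of order the matrix size gives determinant 1,
  and scalar factors do not affect conjugation.\<close>

lemma K_grp_normalize:
  fixes F :: "'n::finite mat_K"
  assumes "det F > 0"
  obtains h where "h \<in> K_grp" "\<And>Z. h ** Z ** matrix_inv h = F ** Z ** matrix_inv F" "F ** matrix_inv F = mat 1"
proof -
  define N where "N = CARD('n option)"
  have N: "N > 0" by (simp add: N_def)
  define r where "r = 1 / root N (det F)"
  have r: "r \<noteq> 0" using assms N by (simp add: r_def)
  have "det (r *\<^sub>R F) = 1"
    unfolding det_scaleR N_def[symmetric] r_def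
    using assms real_root_pow_pos2[OF N, of "det F"] by (simp add: power_divide)
  then have h: "r *\<^sub>R F \<in> K_grp" by (simp add: K_grp_def)
  have "invertible F" using assms by (simp add: invertible_det_nz)
  then obtain B where "F ** B = mat 1" unfolding invertible_def by blast
  then have i: "F ** matrix_inv F = mat 1" using matrix_inv_eqI by metis
  have "matrix_inv (r *\<^sub>R F) = (1 / r) *\<^sub>R matrix_inv F"
    by (rule matrix_inv_eqI) (use r i in \<open>simp add: matrix_scaleR_left matrix_scaleR_right\<close>)
  then have "(r *\<^sub>R F) ** Z ** matrix_inv (r *\<^sub>R F) = F ** Z ** matrix_inv F" for Z
    using r by (simp add: matrix_scaleR_left matrix_scaleR_right)
  then show ?thesis using h i that by blast
qed

lemma dual_frame_jet:
  assumes "bet x v A = bet x A v"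
  shows "dual_frame (bet x v v) (bet x v A) (bet x A A) (pvec x) (xi x v) (xi x A) (qvec x) (eta x v) (eta x A)"
  using assms by (simp add: dual_frame_def eta_xi)

lemma dPhi_apply: "dPhi z v *v pvec z = xi z v" "qvec z v* dPhi z v = eta z v"
  by (simp_all add: dPhi_def matrix_vector_mult_add_rdistrib vector_matrix_mult_add_rdistrib outer_vec vec_outer)

lemma dPhi_conj_frame:
  fixes x z :: "'n::finite coords"
  assumes e: "Phi x = h ** Phi z ** h'" and h: "h' ** h = mat 1" and d: "dPhi x v = h ** dPhi z u ** h'"
  defines "\<mu> \<equiv> (h *v pvec z) $ None"
  shows "xi x v = (1 / \<mu>) *\<^sub>R (h *v xi z u)" "eta x v = \<mu> *\<^sub>R (eta z u v* h')"
proof -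
  note f = Phi_conj_frame[OF e, folded \<mu>_def]
  have p: "pvec x = (1 / \<mu>) *\<^sub>R (h *v pvec z)" using f(1) by (simp add: f(2))
  have q: "qvec x = \<mu> *\<^sub>R (qvec z v* h')" using f(1) by (simp add: f(3))
  have "xi x v = (h ** dPhi z u ** h') *v ((1 / \<mu>) *\<^sub>R (h *v pvec z))"
    unfolding dPhi_apply(1)[symmetric] d p ..
  also have "\<dots> = (1 / \<mu>) *\<^sub>R ((h ** dPhi z u ** (h' ** h)) *v pvec z)"
    by (simp add: matrix_vector_mult_scaleR matrix_vector_mul_assoc matrix_mul_assoc)
  finally show "xi x v = (1 / \<mu>) *\<^sub>R (h *v xi z u)"
    by (simp add: h matrix_vector_mul_assoc[symmetric] dPhi_apply)
  have "eta x v = (\<mu> *\<^sub>R (qvec z v* h')) v* (h ** dPhi z u ** h')"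
    unfolding dPhi_apply(2)[symmetric] d q ..
  also have "\<dots> = \<mu> *\<^sub>R (qvec z v* ((h' ** h) ** dPhi z u ** h'))"
    by (simp add: scaleR_vector_matrix_assoc vector_matrix_mul_assoc matrix_mul_assoc)
  finally show "eta x v = \<mu> *\<^sub>R (eta z u v* h')"
    by (simp add: h vector_matrix_mul_assoc[symmetric] dPhi_apply)
qed

section \<open>Regular dependence of frames and frame maps on parameters\<close>

lemma bounded_bilinear_matrix_mult: "bounded_bilinear (\<lambda>(A :: real^'m::finite^'m) (B :: real^'m^'m). A ** B)"
  unfolding bilinear_conv_bounded_bilinear[symmetric] bilinear_def
  by (auto intro!: linearI simp: matrix_algebra)

lemma bounded_bilinear_matrix_vector: "bounded_bilinear (\<lambda>(A :: real^'m::finite^'m) v. A *v v)"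
  unfolding bilinear_conv_bounded_bilinear[symmetric] bilinear_def
  by (auto intro!: linearI simp: matrix_vector_mult_add_rdistrib matrix_vector_right_distrib
      matrix_vector_mult_scaleR scaleR_matrix_vector_assoc[symmetric])

lemmas Ck_on_outer = Ck_on_bilinear[OF _ bounded_bilinear_outer]
lemmas Ck_on_matrix_mult = Ck_on_bilinear[OF _ bounded_bilinear_matrix_mult]
lemmas Ck_on_matrix_vector_mult = Ck_on_bilinear[OF _ bounded_bilinear_matrix_vector]

lemma Ck_on_xi:
  assumes "open S" "Ck_on k S x" "Ck_on k S v" shows "Ck_on k S (\<lambda>s. xi (x s) (v s))"
  unfolding xi_def by (intro Ck_on_emb Ck_on_intros Ck_on_xpart Ck_on_ypart assms)

lemma Ck_on_eta:
  assumes "open S" "Ck_on k S x" "Ck_on k S v" shows "Ck_on k S (\<lambda>s. eta (x s) (v s))"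
  unfolding eta_def Let_def by (intro Ck_on_emb Ck_on_intros Ck_on_xpart Ck_on_ypart assms)

lemma Ck_on_dPhi:
  assumes "open S" "Ck_on k S x" "Ck_on k S v" shows "Ck_on k S (\<lambda>s. dPhi (x s) (v s))"
  unfolding dPhi_def by (intro Ck_on_add Ck_on_outer Ck_on_xi Ck_on_eta Ck_on_pvec Ck_on_qvec assms)

lemma Ck_on_recov:
  assumes "open S" "Ck_on k S x" "Ck_on k S N" shows "Ck_on k S (\<lambda>s. recov (x s) (N s))"
proof (rule Ck_on_coordsI[OF assms(1)])
  have P: "Ck_on k S (\<lambda>s. (N s *v pvec (x s)) $ a)" for a
    by (intro Ck_on_nth Ck_on_matrix_vector_mult Ck_on_pvec assms)
  have Q: "Ck_on k S (\<lambda>s. N s $ a $ b)" for a b by (intro Ck_on_nth assms)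
  show "Ck_on k S (\<lambda>s. recov (x s) (N s) $ Inl i)" for i
    unfolding recov_def by simp (intro Ck_on_diff Ck_on_mult P assms Ck_on_nth)
  show "Ck_on k S (\<lambda>s. recov (x s) (N s) $ Inr i)" for i
    unfolding recov_def by simp (intro Ck_on_minus Q assms)
qed

lemma Ck_on_frame_op:
  assumes "open S" "Ck_on k S a" "Ck_on k S b" "Ck_on k S d" "Ck_on k S p" "Ck_on k S x0" "Ck_on k S x1"
    "Ck_on k S q" "Ck_on k S e0" "Ck_on k S e1" "\<And>s. s \<in> S \<Longrightarrow> a s * d s - (b s)^2 \<noteq> 0"
  shows "Ck_on k S (\<lambda>s. frame_op (a s) (b s) (d s) (p s) (x0 s) (x1 s) (q s) (e0 s) (e1 s))"
  unfolding frame_op_def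
  by (intro Ck_on_add Ck_on_diff Ck_on_scaleR Ck_on_divide Ck_on_mult Ck_on_power Ck_on_const Ck_on_outer assms) simp

lemma Ck_on_curve:
  assumes i12: "i1 \<noteq> i2" and "open S" "Ck_on k S c" "\<And>s. s \<in> S \<Longrightarrow> c s \<noteq> 0" "t \<noteq> 0"
  shows "Ck_on k S (\<lambda>s. circle_curve i1 i2 (c s) t)" "Ck_on k S (\<lambda>s. curve_d1 i1 i2 (c s) t)"
    "Ck_on k S (\<lambda>s. curve_d2 i1 i2 (c s) t)"
  unfolding circle_curve_join[OF i12] curve_d1_def curve_d2_def
  by (intro Ck_on_join Ck_on_add Ck_on_diff Ck_on_minus Ck_on_scaleR Ck_on_divide Ck_on_mult Ck_on_power Ck_on_const assms;
      simp add: assms)+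

section \<open>The invariants of a jet and the curve parameters matching them\<close>

definition b00 :: "'n::finite jet \<Rightarrow> real" where "b00 z = bet (jx z) (jv z) (jv z)"
definition b01 :: "'n::finite jet \<Rightarrow> real" where "b01 z = bet (jx z) (jv z) (jA z)"
definition b11 :: "'n::finite jet \<Rightarrow> real" where "b11 z = bet (jx z) (jA z) (jA z)"
definition gram :: "'n::finite jet \<Rightarrow> real" where "gram z = b00 z * b11 z - (b01 z)^2"

text \<open>The parameters for which the jet of \<open>circle_curve\<close> at time \<open>t\<close> has the same invariants as \<open>z\<close>, if
  \<open>kform z = 0\<close>; \<open>e\<close> is a sign.\<close>

definition par_c :: "'n::finite jet \<Rightarrow> real" where "par_c z = root 3 (1 + gram z / b00 z ^ 3)"
definition par_f1 :: "real \<Rightarrow> real \<Rightarrow> 'n::finite jet \<Rightarrow> real" where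
  "par_f1 t e z = e * sqrt (- b00 z * par_c z ^ 3 * t^2)"
definition par_f2 :: "real \<Rightarrow> real \<Rightarrow> 'n::finite jet \<Rightarrow> real" where
  "par_f2 t e z = (par_f1 t e z ^ 3 / (par_c z ^ 3 * t^3) - b01 z) * (par_c z ^ 3 * t^2) / par_f1 t e z"

text \<open>The three conditions make the parameters real with \<open>f1\<close> nonzero, make
  \<open>c^3\<close> positive, and make the Gram matrix invertible.\<close>

definition generic_jets :: "'n::finite jet set" where
  "generic_jets = {z. b00 z < 0} \<inter> {z. b00 z ^ 3 + gram z < 0} \<inter> {z. gram z \<noteq> 0}"

lemma Ck_on_gram:
  assumes "open S" shows "Ck_on k S b00" "Ck_on k S b01" "Ck_on k S b11" "Ck_on k S gram"
proof -
  show 1: "Ck_on k S b00" "Ck_on k S b01" "Ck_on k S b11"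
    unfolding b00_def[abs_def] b01_def[abs_def] b11_def[abs_def] by (intro Ck_on_bet Ck_on_jet assms)+
  show "Ck_on k S gram"
    unfolding gram_def[abs_def] by (intro Ck_on_diff Ck_on_mult Ck_on_power 1 assms)
qed

lemma continuous_on_gram: "continuous_on S b00" "continuous_on S b01" "continuous_on S gram"
  using Ck_on_gram[OF open_UNIV, of 0] continuous_on_subset[OF _ subset_UNIV] by auto

lemma open_generic_jets: "open generic_jets"
  unfolding generic_jets_def
  by (intro open_Int open_Collect_less open_Collect_neq continuous_intros continuous_on_gram)

lemma generic_jets_D:
  assumes "z \<in> generic_jets"
  shows "b00 z < 0" "gram z \<noteq> 0" "par_c z > 0" "par_c z ^ 3 = 1 + gram z / b00 z ^ 3"
proof -
  show b: "b00 z < 0" "gram z \<noteq> 0" using assms by (auto simp: generic_jets_def)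
  have "b00 z ^ 3 < 0" using b(1) by (simp add: power_less_zero_eq)
  moreover have "b00 z ^ 3 + gram z < 0" using assms by (simp add: generic_jets_def)
  ultimately have "1 + gram z / b00 z ^ 3 > 0"
    by (metis add_divide_distrib divide_neg_neg divide_self less_irrefl)
  then show "par_c z > 0" by (simp add: par_c_def)
  show "par_c z ^ 3 = 1 + gram z / b00 z ^ 3" unfolding par_c_def by (rule odd_real_root_pow) simp
qed

lemma par_f1_square:
  assumes z: "z \<in> generic_jets" and t: "t \<noteq> 0" and e: "e * e = 1"
  shows "(par_f1 t e z)^2 = - b00 z * par_c z ^ 3 * t^2" "par_f1 t e z \<noteq> 0"
proof -
  have "par_c z ^ 3 * t^2 > 0" using generic_jets_D(3)[OF z] t by simp
  then have p: "- b00 z * par_c z ^ 3 * t^2 > 0"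
    using generic_jets_D(1)[OF z] mult_neg_pos[of "b00 z" "par_c z ^ 3 * t^2"] by (simp add: mult.assoc)
  show 1: "(par_f1 t e z)^2 = - b00 z * par_c z ^ 3 * t^2"
    using p e by (simp add: par_f1_def power_mult_distrib power2_eq_square[of e])
  show "par_f1 t e z \<noteq> 0" using 1 p by auto
qed

lemma curve_jet_bet:
  fixes i1 i2 :: "'n::finite" and f1 f2 :: real
  assumes i12: "i1 \<noteq> i2" and c: "c > 0" and t: "t \<noteq> 0"
  defines "s \<equiv> circle_curve i1 i2 c t" and "v \<equiv> f1 *\<^sub>R curve_d1 i1 i2 c t"
    and "A \<equiv> f1^2 *\<^sub>R curve_d2 i1 i2 c t + f2 *\<^sub>R curve_d1 i1 i2 c t"
    and "r \<equiv> 1 / (c^3 * t^2)" and "q \<equiv> 1 / t"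
  shows "bet s v v = - (f1^2) * r" "bet s v A = f1^3 * r * q - f1 * f2 * r" "bet s A v = f1^3 * r * q - f1 * f2 * r"
    "bet s A A = - (f1^4) * r^2 + 2 * f1^2 * f2 * r * q - f2^2 * r" "c^3 * r = q^2" "r > 0"
proof -
  have b: "bet s (curve_d1 i1 i2 c t) (curve_d1 i1 i2 c t) = - r"
    "bet s (curve_d1 i1 i2 c t) (curve_d2 i1 i2 c t) = r * q"
    "bet s (curve_d2 i1 i2 c t) (curve_d1 i1 i2 c t) = r * q"
    "bet s (curve_d2 i1 i2 c t) (curve_d2 i1 i2 c t) = - (r^2)"
    unfolding s_def curve_bet[OF i12 c t] using c t by (simp_all add: r_def q_def field_simps eval_nat_numeral)
  show "bet s v v = - (f1^2) * r" "bet s v A = f1^3 * r * q - f1 * f2 * r" "bet s A v = f1^3 * r * q - f1 * f2 * r"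
    "bet s A A = - (f1^4) * r^2 + 2 * f1^2 * f2 * r * q - f2^2 * r"
    unfolding v_def A_def bet_linear b by (simp_all add: algebra_simps eval_nat_numeral)
  show "c^3 * r = q^2" "r > 0" using c t by (simp_all add: r_def q_def field_simps)
qed

definition src_x :: "'n::finite \<Rightarrow> 'n \<Rightarrow> real \<Rightarrow> 'n jet \<Rightarrow> 'n coords" where
  "src_x i1 i2 t z = circle_curve i1 i2 (par_c z) t"
definition src_v :: "'n::finite \<Rightarrow> 'n \<Rightarrow> real \<Rightarrow> real \<Rightarrow> 'n jet \<Rightarrow> 'n coords" where
  "src_v i1 i2 t e z = par_f1 t e z *\<^sub>R curve_d1 i1 i2 (par_c z) t"
definition src_A :: "'n::finite \<Rightarrow> 'n \<Rightarrow> real \<Rightarrow> real \<Rightarrow> 'n jet \<Rightarrow> 'n coords" where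
  "src_A i1 i2 t e z = (par_f1 t e z)^2 *\<^sub>R curve_d2 i1 i2 (par_c z) t + par_f2 t e z *\<^sub>R curve_d1 i1 i2 (par_c z) t"

text \<open>\<open>b00\<close> determines the square of \<open>f1\<close>, after which
  \<open>b01\<close> is linear in \<open>f2\<close>. The determinant is matched through
  \<open>c\<close>, and \<open>b11\<close> follows since \<open>b00\<close> is nonzero.\<close>

lemma src_bet:
  assumes i12: "i1 \<noteq> i2" and z: "z \<in> generic_jets" and t: "t \<noteq> 0" and e: "e * e = 1"
  shows "bet (src_x i1 i2 t z) (src_v i1 i2 t e z) (src_v i1 i2 t e z) = b00 z"
    "bet (src_x i1 i2 t z) (src_v i1 i2 t e z) (src_A i1 i2 t e z) = b01 z"
    "bet (src_x i1 i2 t z) (src_A i1 i2 t e z) (src_v i1 i2 t e z) = b01 z"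
    "bet (src_x i1 i2 t z) (src_A i1 i2 t e z) (src_A i1 i2 t e z) = b11 z"
proof -
  define c where "c = par_c z"
  define f1 where "f1 = par_f1 t e z"
  define f2 where "f2 = par_f2 t e z"
  define r where "r = 1 / (c^3 * t^2)"
  define q where "q = 1 / t"
  have c: "c > 0" "c^3 = 1 + gram z / b00 z ^ 3" and b0: "b00 z < 0"
    using generic_jets_D[OF z] by (simp_all add: c_def)
  note f = par_f1_square[OF z t e, folded f1_def c_def]
  note B = curve_jet_bet[OF i12 c(1) t, folded r_def q_def]
  note src = src_x_def src_v_def src_A_def c_def[symmetric] f1_def[symmetric] f2_def[symmetric]
  have 0: "- (f1^2) * r = b00 z" using f(1) c(1) t by (simp add: r_def)
  have f2: "f2 = (f1^3 / (c^3 * t^3) - b01 z) * (c^3 * t^2) / f1"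
    unfolding f2_def par_f2_def c_def f1_def ..
  have 1: "f1^3 * r * q - f1 * f2 * r = b01 z"
    unfolding f2 using f(2) c(1) t by (simp add: r_def q_def field_simps eval_nat_numeral)
  have g: "gram z = c^3 * b00 z ^ 3 - b00 z ^ 3"
    unfolding c(2) using b0 by (simp add: algebra_simps)
  \<comment> \<open>All terms with \<open>f2\<close> cancel, because adding a multiple of the
    velocity to the acceleration does not change the determinant.\<close>
  have "b00 z * (- (f1^4) * r^2 + 2 * f1^2 * f2 * r * q - f2^2 * r) - (b01 z)^2 = f1^6 * r^3 - f1^6 * r^2 * q^2"
    unfolding 0[symmetric] 1[symmetric] by (simp add: algebra_simps eval_nat_numeral)
  also have "\<dots> = gram z"
    unfolding g 0[symmetric] B(5)[symmetric] by (simp add: algebra_simps eval_nat_numeral)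
  finally have "b00 z * (- (f1^4) * r^2 + 2 * f1^2 * f2 * r * q - f2^2 * r) = b00 z * b11 z"
    by (simp add: gram_def)
  then have 2: "- (f1^4) * r^2 + 2 * f1^2 * f2 * r * q - f2^2 * r = b11 z" using b0 by simp
  show "bet (src_x i1 i2 t z) (src_v i1 i2 t e z) (src_v i1 i2 t e z) = b00 z"
    "bet (src_x i1 i2 t z) (src_v i1 i2 t e z) (src_A i1 i2 t e z) = b01 z"
    "bet (src_x i1 i2 t z) (src_A i1 i2 t e z) (src_v i1 i2 t e z) = b01 z"
    "bet (src_x i1 i2 t z) (src_A i1 i2 t e z) (src_A i1 i2 t e z) = b11 z"
    unfolding src B 0 1 2 by (rule refl)+
qed

text \<open>Target frame: that of \<open>z\<close>; source frame: that of the matching jet of the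
  family. The values \<open>h\<close> and \<open>\<mu>\<close> are frozen at a known orbit jet while
  \<open>z\<close> varies, and the sign \<open>e\<close> chooses the square root in
  \<open>par_f1\<close>.\<close>

definition move :: "'n::finite \<Rightarrow> 'n \<Rightarrow> real \<Rightarrow> real \<Rightarrow> real \<Rightarrow> 'n mat_K \<Rightarrow> 'n jet \<Rightarrow> 'n mat_K" where
  "move i1 i2 t e \<mu> h z = (let s = src_x i1 i2 t z; v = src_v i1 i2 t e z; A = src_A i1 i2 t e z;
       F = frame_op (b00 z) (b01 z) (b11 z) in
     frame_map \<mu> h
       (F (pvec (jx z)) (xi (jx z) (jv z)) (xi (jx z) (jA z)) (qvec s) (eta s v) (eta s A))
       (F (pvec (jx z)) (xi (jx z) (jv z)) (xi (jx z) (jA z)) (qvec (jx z)) (eta (jx z) (jv z)) (eta (jx z) (jA z)))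
       (F (pvec s) (xi s v) (xi s A) (qvec s) (eta s v) (eta s A)))"

lemma jet_dual_frames:
  assumes i12: "i1 \<noteq> i2" and z: "z \<in> generic_jets" and t: "t \<noteq> 0" and e: "e * e = 1" and k: "kform z = 0"
  shows "dual_frame (b00 z) (b01 z) (b11 z) (pvec (jx z)) (xi (jx z) (jv z)) (xi (jx z) (jA z))
      (qvec (jx z)) (eta (jx z) (jv z)) (eta (jx z) (jA z))"
    "dual_frame (b00 z) (b01 z) (b11 z) (pvec (src_x i1 i2 t z)) (xi (src_x i1 i2 t z) (src_v i1 i2 t e z))
      (xi (src_x i1 i2 t z) (src_A i1 i2 t e z)) (qvec (src_x i1 i2 t z))
      (eta (src_x i1 i2 t z) (src_v i1 i2 t e z)) (eta (src_x i1 i2 t z) (src_A i1 i2 t e z))"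
  using dual_frame_jet[of "jx z" "jv z" "jA z"] k
    dual_frame_jet[of "src_x i1 i2 t z" "src_v i1 i2 t e z" "src_A i1 i2 t e z"]
  unfolding src_bet[OF i12 z t e] by (simp_all add: b00_def b01_def b11_def kform_def)

text \<open>Equal Gram matrices make \<open>move\<close> conjugate the source jet into
  \<open>z\<close>; normalizing the determinant puts the conjugating matrix in
  \<open>K\<close>.\<close>

lemma move_orbit_jets:
  assumes i12: "i1 \<noteq> i2" and z: "z \<in> generic_jets" and t: "t \<noteq> 0" and e: "e * e = 1" and mu: "\<mu> \<noteq> 0"
    and k: "kform z = 0" and d: "det (move i1 i2 t e \<mu> h z) > 0"
  shows "z \<in> orbit_jets i1 i2"
proof -
  let ?F = "move i1 i2 t e \<mu> h z"
  obtain h0 where h0: "h0 \<in> K_grp" "\<And>Z. h0 ** Z ** matrix_inv h0 = ?F ** Z ** matrix_inv ?F"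
    and i: "?F ** matrix_inv ?F = mat 1"
    using K_grp_normalize[OF d] by metis
  have nz: "b00 z * b11 z - (b01 z)^2 \<noteq> 0" using generic_jets_D(2)[OF z] by (simp add: gram_def)
  have m: "?F = frame_map \<mu> h
       (frame_op (b00 z) (b01 z) (b11 z) (pvec (jx z)) (xi (jx z) (jv z)) (xi (jx z) (jA z))
          (qvec (src_x i1 i2 t z)) (eta (src_x i1 i2 t z) (src_v i1 i2 t e z)) (eta (src_x i1 i2 t z) (src_A i1 i2 t e z)))
       (frame_op (b00 z) (b01 z) (b11 z) (pvec (jx z)) (xi (jx z) (jv z)) (xi (jx z) (jA z))
          (qvec (jx z)) (eta (jx z) (jv z)) (eta (jx z) (jA z)))
       (frame_op (b00 z) (b01 z) (b11 z) (pvec (src_x i1 i2 t z)) (xi (src_x i1 i2 t z) (src_v i1 i2 t e z))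
          (xi (src_x i1 i2 t z) (src_A i1 i2 t e z))
          (qvec (src_x i1 i2 t z)) (eta (src_x i1 i2 t z) (src_v i1 i2 t e z)) (eta (src_x i1 i2 t z) (src_A i1 i2 t e z)))"
    unfolding move_def Let_def ..
  note c = frame_map_conj[OF nz jet_dual_frames[OF i12 z t e k] mu, of h "matrix_inv ?F", folded m, OF i]
  show ?thesis
  proof (rule orbit_jetsI[OF h0(1) generic_jets_D(3)[OF z] t par_f1_square(2)[OF z t e]])
    show "Phi (jx z) = h0 ** Phi (circle_curve i1 i2 (par_c z) t) ** matrix_inv h0"
      using c(1) unfolding h0(2) by (simp add: Phi_def src_x_def)
    show "dPhi (jx z) (jv z) = h0 ** dPhi (circle_curve i1 i2 (par_c z) t)
        (par_f1 t e z *\<^sub>R curve_d1 i1 i2 (par_c z) t) ** matrix_inv h0"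
      using c(2) unfolding h0(2) by (simp add: dPhi_def src_x_def src_v_def)
    show "dPhi (jx z) (jA z) = h0 ** dPhi (circle_curve i1 i2 (par_c z) t)
        ((par_f1 t e z)^2 *\<^sub>R curve_d2 i1 i2 (par_c z) t + par_f2 t e z *\<^sub>R curve_d1 i1 i2 (par_c z) t) ** matrix_inv h0"
      using c(3) unfolding h0(2) by (simp add: dPhi_def src_x_def src_A_def)
  qed
qed

lemma continuous_on_det_move:
  fixes i1 i2 :: "'n::finite"
  assumes i12: "i1 \<noteq> i2" and t: "t \<noteq> 0" and e: "e * e = 1"
  shows "continuous_on (generic_jets :: 'n jet set) (\<lambda>z. det (move i1 i2 t e \<mu> h z))"
proof -
  note op = open_generic_jets
  note D = generic_jets_D
  have c: "continuous_on (generic_jets :: 'n jet set) par_c" unfolding par_c_def[abs_def]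
    by (intro continuous_intros continuous_on_gram) (use D(1) in force)
  have f1: "continuous_on (generic_jets :: 'n jet set) (par_f1 t e)" unfolding par_f1_def[abs_def]
    by (intro continuous_intros continuous_on_gram c)
  have f2: "continuous_on (generic_jets :: 'n jet set) (par_f2 t e)" unfolding par_f2_def[abs_def]
    by (intro continuous_intros continuous_on_gram c f1)
      (use D(3) t par_f1_square(2)[OF _ t e] in force)+
  have C: "Ck_on 0 (generic_jets :: 'n jet set) par_c" "Ck_on 0 (generic_jets :: 'n jet set) (par_f1 t e)" "Ck_on 0 (generic_jets :: 'n jet set) (par_f2 t e)"
    using c f1 f2 by simp_all
  have c0: "par_c z \<noteq> 0" if "z \<in> generic_jets" for z using D(3)[OF that] by simp
  note K = Ck_on_curve[OF i12 op C(1) c0 t]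
  have s: "Ck_on 0 (generic_jets :: 'n jet set) (src_x i1 i2 t)" "Ck_on 0 (generic_jets :: 'n jet set) (src_v i1 i2 t e)" "Ck_on 0 (generic_jets :: 'n jet set) (src_A i1 i2 t e)"
    subgoal unfolding src_x_def[abs_def] by (rule K(1))
    subgoal unfolding src_v_def[abs_def] by (intro Ck_on_scaleR op C K)
    unfolding src_A_def[abs_def] by (intro Ck_on_add Ck_on_scaleR Ck_on_power op C K)
  have nz: "b00 z * b11 z - (b01 z)^2 \<noteq> 0" if "z \<in> generic_jets" for z using D(2)[OF that] by (simp add: gram_def)
  have "Ck_on 0 (generic_jets :: 'n jet set) (move i1 i2 t e \<mu> h)"
    unfolding move_def[abs_def] Let_def frame_map_def
    by (intro Ck_on_add Ck_on_diff Ck_on_scaleR Ck_on_const Ck_on_matrix_mult Ck_on_frame_op Ck_on_gram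
        Ck_on_pvec Ck_on_qvec Ck_on_xi Ck_on_eta Ck_on_jet s op nz)
  then have "Ck_on 0 (generic_jets :: 'n jet set) (\<lambda>z. move i1 i2 t e \<mu> h z $ a $ b)" for a b
    by (intro Ck_on_nth op)
  then show ?thesis unfolding det_def Ck_on.simps
    by (intro continuous_on_sum continuous_on_mult continuous_on_prod continuous_on_const)
qed

text \<open>The anchor of the continuity argument: away from \<open>c = 1\<close> the formulas
  recover the original parameters of an orbit jet, and the linear map built from them is
  \<open>h\<close> itself.\<close>

lemma orbit_jet_generic:
  assumes i12: "i1 \<noteq> i2" and h: "h \<in> K_grp" and c: "c > 0" "c \<noteq> 1" and t: "t \<noteq> 0" and f1: "f1 \<noteq> 0"
    and e: "Phi (jx z) = h ** Phi (circle_curve i1 i2 c t) ** matrix_inv h"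
     "dPhi (jx z) (jv z) = h ** dPhi (circle_curve i1 i2 c t) (f1 *\<^sub>R curve_d1 i1 i2 c t) ** matrix_inv h"
     "dPhi (jx z) (jA z) = h ** dPhi (circle_curve i1 i2 c t)
       (f1^2 *\<^sub>R curve_d2 i1 i2 c t + f2 *\<^sub>R curve_d1 i1 i2 c t) ** matrix_inv h"
  defines "\<mu> \<equiv> (h *v pvec (circle_curve i1 i2 c t)) $ None"
  shows "z \<in> generic_jets" "move i1 i2 t (sgn f1) \<mu> h z = h"
proof -
  note B = bet_conj[OF K_grp_inv(2)[OF h] e(1)]
  note b = curve_jet_bet[OF i12 c(1) t]
  define r where "r = 1 / (c^3 * t^2)"
  define q where "q = 1 / t"
  have b0: "b00 z = - (f1^2) * r" unfolding b00_def B[OF e(2,2)] b(1) r_def ..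
  have b1: "b01 z = f1^3 * r * q - f1 * f2 * r" unfolding b01_def B[OF e(2,3)] b(2) r_def q_def ..
  have b2: "b11 z = - (f1^4) * r^2 + 2 * f1^2 * f2 * r * q - f2^2 * r"
    unfolding b11_def B[OF e(3,3)] b(4) r_def q_def ..
  have rq: "c^3 * r = q^2" "r > 0" using b(5,6) by (simp_all add: r_def q_def)
  have g: "gram z = (c^3 - 1) * b00 z ^ 3"
  proof -
    have "gram z = f1^6 * r^3 - f1^6 * r^2 * q^2"
      unfolding gram_def b0 b1 b2 by (simp add: algebra_simps eval_nat_numeral)
    also have "\<dots> = (c^3 - 1) * b00 z ^ 3"
      unfolding b0 rq(1)[symmetric] by (simp add: algebra_simps eval_nat_numeral)
    finally show ?thesis .
  qed
  have n: "b00 z < 0" using f1 rq(2) by (simp add: b0)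
  then have n3: "b00 z ^ 3 < 0" by (simp add: power_less_zero_eq)
  have c3: "c^3 > 0" using c(1) by simp
  have c31: "c^3 \<noteq> 1" using c power_eq_imp_eq_base[of c 3 1] by auto
  have "b00 z ^ 3 + gram z = c^3 * b00 z ^ 3" unfolding g by (simp add: algebra_simps)
  then have "b00 z ^ 3 + gram z < 0" using mult_pos_neg[OF c3 n3] by simp
  moreover have "gram z \<noteq> 0" unfolding g using c31 n3 by simp
  ultimately show z: "z \<in> generic_jets" using n by (simp add: generic_jets_def)
  have pc: "par_c z = c"
  proof -
    have "1 + gram z / b00 z ^ 3 = c^3" unfolding g using n3 by (simp add: field_simps)
    then show ?thesis unfolding par_c_def using c(1) by (simp add: real_root_power_cancel)
  qed
  have p1: "par_f1 t (sgn f1) z = f1"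
  proof -
    have "- b00 z * par_c z ^ 3 * t^2 = f1^2" unfolding b0 pc r_def using c(1) t by (simp add: field_simps)
    then show ?thesis unfolding par_f1_def by (simp add: sgn_mult_abs)
  qed
  have p2: "par_f2 t (sgn f1) z = f2"
    unfolding par_f2_def p1 pc b1 r_def q_def using c(1) t f1 by (simp add: field_simps eval_nat_numeral)
  have s: "src_x i1 i2 t z = circle_curve i1 i2 c t" "src_v i1 i2 t (sgn f1) z = f1 *\<^sub>R curve_d1 i1 i2 c t"
    "src_A i1 i2 t (sgn f1) z = f1^2 *\<^sub>R curve_d2 i1 i2 c t + f2 *\<^sub>R curve_d1 i1 i2 c t"
    unfolding src_x_def src_v_def src_A_def pc p1 p2 by (rule refl)+
  have k: "kform z = 0" unfolding kform_def B[OF e(2,3)] B[OF e(3,2)] b(2,3) by simp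
  have sg: "sgn f1 * sgn f1 = 1" using f1 by (simp add: sgn_if)
  have nz: "b00 z * b11 z - (b01 z)^2 \<noteq> 0" using generic_jets_D(2)[OF z] by (simp add: gram_def)
  note F = Phi_conj_frame[OF e(1), folded \<mu>_def]
  note G = dPhi_conj_frame[OF e(1) K_grp_inv(2)[OF h], folded \<mu>_def]
  have p: "pvec (jx z) = (1 / \<mu>) *\<^sub>R (h *v pvec (circle_curve i1 i2 c t))"
    and q: "qvec (jx z) = \<mu> *\<^sub>R (qvec (circle_curve i1 i2 c t) v* matrix_inv h)"
    using F(1) by (simp_all add: F(2,3))
  show "move i1 i2 t (sgn f1) \<mu> h z = h"
    unfolding move_def Let_def s
    by (rule frame_map_self[OF nz jet_dual_frames(2)[OF i12 z t sg k, unfolded s] K_grp_inv(2)[OF h] F(1)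
        p G(1)[OF e(2)] G(1)[OF e(3)] q G(2)[OF e(2)] G(2)[OF e(3)]])
qed

text \<open>At \<open>c = 1\<close> the Gram matrix of the jet degenerates, so such points are approached through \<open>c \<noteq> 1\<close>.\<close>

lemma orbit_jets_perturb:
  assumes i12: "i1 \<noteq> i2" and W: "open W" "z \<in> W" and h: "h \<in> K_grp" and c: "c > 0" and t: "t \<noteq> 0" and f1: "f1 \<noteq> 0"
    and e: "Phi (jx z) = h ** Phi (circle_curve i1 i2 c t) ** matrix_inv h"
     "dPhi (jx z) (jv z) = h ** dPhi (circle_curve i1 i2 c t) (f1 *\<^sub>R curve_d1 i1 i2 c t) ** matrix_inv h"
     "dPhi (jx z) (jA z) = h ** dPhi (circle_curve i1 i2 c t)
       (f1^2 *\<^sub>R curve_d2 i1 i2 c t + f2 *\<^sub>R curve_d1 i1 i2 c t) ** matrix_inv h"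
  obtains c' y where "c' > 0" "c' \<noteq> 1" "y \<in> W"
     "Phi (jx y) = h ** Phi (circle_curve i1 i2 c' t) ** matrix_inv h"
     "dPhi (jx y) (jv y) = h ** dPhi (circle_curve i1 i2 c' t) (f1 *\<^sub>R curve_d1 i1 i2 c' t) ** matrix_inv h"
     "dPhi (jx y) (jA y) = h ** dPhi (circle_curve i1 i2 c' t)
       (f1^2 *\<^sub>R curve_d2 i1 i2 c' t + f2 *\<^sub>R curve_d1 i1 i2 c' t) ** matrix_inv h"
proof -
  define s where "s c = circle_curve i1 i2 c t" for c
  define u where "u c = f1 *\<^sub>R curve_d1 i1 i2 c t" for c
  define b where "b c = f1^2 *\<^sub>R curve_d2 i1 i2 c t + f2 *\<^sub>R curve_d1 i1 i2 c t" for c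
  define S where "S = {0<..} \<inter> (\<lambda>c. (h *v pvec (s c)) $ None) -` (- {0})"
  \<comment> \<open>Only \<open>c\<close> varies, with \<open>h\<close>, \<open>t\<close>,
    \<open>f1\<close> and \<open>f2\<close> fixed. The conjugated jet is brought back to coordinates
    by \<open>chart_act\<close> and \<open>recov\<close>, so it moves continuously with
    \<open>c\<close>.\<close>
  define X where "X c = chart_act h (s c)" for c
  define V where "V c = recov (X c) (h ** dPhi (s c) (u c) ** matrix_inv h)" for c
  define A where "A c = recov (X c) (h ** dPhi (s c) (b c) ** matrix_inv h)" for c
  define Z where "Z c = (X c, V c, A c - Gam (X c) (V c) (V c))" for c
  have R: "open {0::real<..}" "Ck_on 0 {0<..} (\<lambda>c::real. c)" "\<And>c::real. c \<in> {0<..} \<Longrightarrow> c \<noteq> 0"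
    by (auto intro: continuous_on_id)
  note K = Ck_on_curve[OF i12 R t]
  have sC: "Ck_on 0 {0<..} s" unfolding s_def[abs_def] by (rule K(1))
  have "Ck_on 0 {0<..} (\<lambda>c. (h *v pvec (s c)) $ None)"
    by (intro Ck_on_nth Ck_on_matrix_vector Ck_on_pvec sC R(1))
  then have "continuous_on {0<..} (\<lambda>c. (h *v pvec (s c)) $ None)" by simp
  then have S: "open S" unfolding S_def by (rule continuous_open_preimage[OF _ R(1)]) auto
  have SR: "S \<subseteq> {0<..}" and Sm: "\<And>c. c \<in> S \<Longrightarrow> (h *v pvec (s c)) $ None \<noteq> 0" by (auto simp: S_def)
  note KS = Ck_on_subset[OF K(2) SR] Ck_on_subset[OF K(3) SR]
  have ub: "Ck_on 0 S u" "Ck_on 0 S b" "Ck_on 0 S s"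
    subgoal unfolding u_def[abs_def] by (intro Ck_on_scaleR Ck_on_const S KS)
    subgoal unfolding b_def[abs_def] by (intro Ck_on_add Ck_on_scaleR Ck_on_const S KS)
    by (rule Ck_on_subset[OF sC SR])
  have XC: "Ck_on 0 S X" unfolding X_def[abs_def] by (rule Ck_on_chart_act[OF S ub(3) Sm])
  have VC: "Ck_on 0 S V" "Ck_on 0 S A" unfolding V_def[abs_def] A_def[abs_def]
    by (intro Ck_on_recov Ck_on_matrix_mult Ck_on_dPhi Ck_on_const S XC ub)+
  have "Ck_on 0 S Z" unfolding Z_def[abs_def]
    by (intro Ck_on_Pair Ck_on_diff Ck_on_Gam S XC VC)
  then have "continuous_on S Z" by simp
  then have op: "open (S \<inter> Z -` W)" by (rule continuous_open_preimage[OF _ S W(1)])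
  have XP: "Phi (X c) = h ** Phi (s c) ** matrix_inv h" if "c \<in> S" for c
    unfolding X_def by (rule Phi_chart_act[OF K_grp_inv(2)[OF h] Sm[OF that]])
  have VP: "dPhi (X c) (V c) = h ** dPhi (s c) (u c) ** matrix_inv h"
    and AP: "dPhi (X c) (A c) = h ** dPhi (s c) (b c) ** matrix_inv h" if cS: "c \<in> S" for c
  proof -
    obtain v where v: "dPhi (X c) v = h ** dPhi (s c) (u c) ** matrix_inv h"
      by (rule dPhi_conj_surj[OF XP[OF cS] K_grp_inv(2)[OF h]])
    then show "dPhi (X c) (V c) = h ** dPhi (s c) (u c) ** matrix_inv h"
      unfolding V_def v[symmetric] recov_dPhi by simp
    obtain w where w: "dPhi (X c) w = h ** dPhi (s c) (b c) ** matrix_inv h"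
      by (rule dPhi_conj_surj[OF XP[OF cS] K_grp_inv(2)[OF h]])
    then show "dPhi (X c) (A c) = h ** dPhi (s c) (b c) ** matrix_inv h"
      unfolding A_def w[symmetric] recov_dPhi by simp
  qed
  have cS: "c \<in> S" using c Phi_conj_nonzero[OF e(1)] by (simp add: S_def s_def)
  have Xc: "X c = jx z" by (rule Phi_inject) (simp add: XP[OF cS] e(1) s_def)
  have Vc: "V c = jv z"
    using VP[OF cS, unfolded Xc s_def u_def, folded e(2)] by (simp only: dPhi_inject)
  have Ac: "A c = jA z"
    using AP[OF cS, unfolded Xc s_def b_def, folded e(3)] by (simp only: dPhi_inject)
  have "Z c = z" unfolding Z_def Xc Vc Ac by (simp add: jx_def jv_def jA_def)
  then have "c \<in> S \<inter> Z -` W" using cS W(2) by simp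
  then obtain d where d: "d > 0" "ball c d \<subseteq> S \<inter> Z -` W" using op open_contains_ball by blast
  define c' where "c' = (if c = 1 then c + d / 2 else c)"
  have "c' \<in> ball c d" using d(1) by (simp add: c'_def dist_real_def)
  then have c'S: "c' \<in> S" "Z c' \<in> W" using d(2) by auto
  have j: "jx (Z c') = X c'" "jv (Z c') = V c'" "jA (Z c') = A c'"
    by (simp_all add: Z_def jx_def jv_def jA_def)
  show ?thesis
  proof (rule that[of c' "Z c'"])
    show "c' > 0" "c' \<noteq> 1" using c d(1) by (auto simp: c'_def)
    show "Z c' \<in> W" by (rule c'S(2))
  qed (use XP[OF c'S(1)] VP[OF c'S(1)] AP[OF c'S(1)] in \<open>simp_all add: j s_def u_def b_def\<close>)
qed

text \<open>Near a generic orbit jet the determinant of \<open>move\<close> stays positive by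
  continuity. There the single equation \<open>kform z = 0\<close> already suffices for membership
  in the orbit, so a piece of the hypersurface lies in it.\<close>

lemma orbit_jets_local:
  assumes i12: "i1 \<noteq> i2" and W: "open W" "W \<inter> orbit_jets i1 i2 \<noteq> {}"
  shows "\<exists>N. submanifold (DIM('n::finite jet) - 1) N \<and> N \<noteq> {} \<and> N \<subseteq> W \<inter> orbit_jets i1 (i2 :: 'n)"
proof -
  obtain z where z: "z \<in> W" "z \<in> orbit_jets i1 i2" using W(2) by blast
  obtain h c t f1 f2 where h: "h \<in> K_grp" and c: "c > 0" and t: "t \<noteq> 0" and f1: "f1 \<noteq> 0"
    and e: "Phi (jx z) = h ** Phi (circle_curve i1 i2 c t) ** matrix_inv h"
     "dPhi (jx z) (jv z) = h ** dPhi (circle_curve i1 i2 c t) (f1 *\<^sub>R curve_d1 i1 i2 c t) ** matrix_inv h"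
     "dPhi (jx z) (jA z) = h ** dPhi (circle_curve i1 i2 c t)
       (f1^2 *\<^sub>R curve_d2 i1 i2 c t + f2 *\<^sub>R curve_d1 i1 i2 c t) ** matrix_inv h"
    using z(2) by (rule orbit_jetsE)
  obtain c' y where c': "c' > 0" "c' \<noteq> 1" and y: "y \<in> W"
     "Phi (jx y) = h ** Phi (circle_curve i1 i2 c' t) ** matrix_inv h"
     "dPhi (jx y) (jv y) = h ** dPhi (circle_curve i1 i2 c' t) (f1 *\<^sub>R curve_d1 i1 i2 c' t) ** matrix_inv h"
     "dPhi (jx y) (jA y) = h ** dPhi (circle_curve i1 i2 c' t)
       (f1^2 *\<^sub>R curve_d2 i1 i2 c' t + f2 *\<^sub>R curve_d1 i1 i2 c' t) ** matrix_inv h"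
    by (rule orbit_jets_perturb[OF i12 W(1) z(1) h c t f1 e])
  define \<mu> where "\<mu> = (h *v pvec (circle_curve i1 i2 c' t)) $ None"
  have mu: "\<mu> \<noteq> 0" unfolding \<mu>_def by (rule Phi_conj_nonzero[OF y(2)])
  have e1: "sgn f1 * sgn f1 = 1" using f1 by (simp add: sgn_if)
  let ?m = "\<lambda>z. move i1 i2 t (sgn f1) \<mu> h z"
  note g = orbit_jet_generic[OF i12 h c' t f1 y(2,3,4), folded \<mu>_def]
  have yo: "y \<in> orbit_jets i1 i2" by (rule orbit_jetsI[OF h c'(1) t f1 y(2,3,4)])
  define W' where "W' = W \<inter> (generic_jets \<inter> (\<lambda>z. det (?m z)) -` {0<..})"
  have "open W'" unfolding W'_def
    by (intro open_Int W(1) continuous_open_preimage[OF continuous_on_det_move[OF i12 t e1] open_generic_jets])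
      (rule open_greaterThan)
  moreover have "bet (jx w) (jv w) (jv w) \<noteq> 0" if "w \<in> W'" for w
    using that generic_jets_D(1)[of w] by (auto simp: W'_def b00_def)
  ultimately have "submanifold (DIM('n jet) - 1) {w \<in> W'. kform w = 0}"
    by (rule kform_submanifold)
  \<comment> \<open>At \<open>y\<close> the map \<open>move\<close> equals \<open>h\<close>, whose
    determinant is 1.\<close>
  moreover have "y \<in> {w \<in> W'. kform w = 0}"
    using y(1) g h orbit_jets_kform(2)[OF i12 yo] by (simp add: W'_def K_grp_def)
  moreover have "{w \<in> W'. kform w = 0} \<subseteq> W \<inter> orbit_jets i1 i2"
    using move_orbit_jets[OF i12 _ t e1 mu] by (auto simp: W'_def)
  ultimately show ?thesis by blast
qed

lemma has_dimension_orbit_jets: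
  assumes i12: "i1 \<noteq> i2"
  shows "has_dimension (DIM('n::finite jet) - 1) (orbit_jets i1 (i2 :: 'n))"
  unfolding has_dimension_def
proof (intro conjI allI impI)
  obtain h :: "'n mat_K" where h: "h = mat 1" "h \<in> K_grp" by (simp add: K_grp_def)
  have i: "matrix_inv h = mat 1" unfolding h(1) by (rule matrix_inv_eqI) simp
  let ?x = "circle_curve i1 i2 1 1" and ?v = "curve_d1 i1 i2 1 1" and ?A = "curve_d2 i1 i2 1 1"
  \<comment> \<open>The jet at time 1 of the curve with \<open>c = 1\<close>, neither translated nor
    reparametrized.\<close>
  have "(?x, ?v, ?A - Gam ?x ?v ?v) \<in> orbit_jets i1 i2"
    by (rule orbit_jetsI[OF h(2), of 1 1 1 _ _ _ 0]) (simp_all add: i[unfolded h(1)] h(1) jx_def jv_def jA_def)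
  then show "orbit_jets i1 i2 \<noteq> {}" by blast
  let ?N = "{z :: 'n jet. bet (jx z) (jv z) (jv z) \<noteq> 0} \<inter> {z. kform z = 0}"
  have "submanifold (DIM('n jet) - 1) ?N"
    using kform_submanifold[OF open_bet_nonzero] by (simp add: Int_def)
  \<comment> \<open>One hypersurface covers the whole orbit, including the jets with
    \<open>c = 1\<close>, so the countable cover is constant.\<close>
  then show "\<exists>N. (\<forall>j::nat. submanifold (DIM('n jet) - 1) (N j)) \<and> orbit_jets i1 i2 \<subseteq> (\<Union>j. N j)"
    using orbit_jets_kform[OF i12] by (intro exI[of _ "\<lambda>_. ?N"]) auto
next
  fix W :: "'n jet set"
  assume "open W \<and> W \<inter> orbit_jets i1 i2 \<noteq> {}"
  then show "\<exists>N. submanifold (DIM('n jet) - 1) N \<and> N \<noteq> {} \<and> N \<subseteq> W \<inter> orbit_jets i1 i2"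
    using orbit_jets_local[OF i12] by blast
qed

theorem theorem5p2:
  fixes i1 i2 :: "'n::finite"
  assumes "CARD('n) \<ge> 2" and "i1 \<noteq> i2"
  shows "(\<forall>c>0. conformal_circle_on fs_metric (- {0}) (circle_curve i1 i2 c)) \<and>
         has_codimension_in 1 (K_orbit (circle_curve i1 i2)) conformal_circles"
proof (intro conjI allI impI)
  fix c :: real assume c: "c > 0"
  have "smooth_on (- {0}) (\<lambda>s::real. s)" unfolding smooth_on_def by (intro allI Ck_on_ident) auto
  then show "conformal_circle_on fs_metric (- {0}) (circle_curve i1 i2 c)"
    using circle_curve_conformal_circle[OF assms(2) c, of "- {0}" "\<lambda>s. s"] by (simp add: open_Compl)
next
  \<comment> \<open>The jets of all circles form an open set, hence have full dimension, one more
    than the jets of the orbit.\<close>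
  have "submanifold (DIM('n jet) - 1 + 1) (jets2 k (conformal_circles :: 'n arc set))" if k: "k \<in> K_grp" for k
  proof -
    have "jets2 k (conformal_circles :: 'n arc set) = {z. bet (jx z) (jv z) (jv z) \<noteq> 0}"
      unfolding jets2_conformal_circles[OF k] by (auto simp: ip_bet jx_def jv_def)
    then show ?thesis using submanifold_open[OF open_bet_nonzero] by simp
  qed
  then show "has_codimension_in 1 (K_orbit (circle_curve i1 i2)) conformal_circles"
    unfolding has_codimension_in_def using K_orbit_subset[OF assms(2)]
    by (intro conjI exI[of _ "DIM('n jet) - 1"] ballI)
      (simp_all only: jets2_K_orbit[OF assms(2)] has_dimension_orbit_jets[OF assms(2)])
qed

end
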